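(* Let $\alpha,\beta,\lambda\in\mathbf{C}$ with $\alpha,\beta\neq0$. Let $(-A_1,B_0,C_0)$ and $(-A_2,B_0,C_0)$ be $(2,2)$ admissible linear systems with input and output space $\mathbf{C}$ and common state space $H$, where $A_1,A_2\in\mathcal{L}(H)$. Let $$C(y;t)=C_0e^{t(A_1^3+\lambda A_1)/\alpha-yA_1^2/\beta},\qquad B(y;t)=e^{t(A_2^3+\lambda A_2)/\alpha+yA_2^2/\beta}B_0,$$ $$R_x(y,t)=\int_x^\infty e^{-A_2s}B(y;t)C(y;t)e^{-A_1s}\,ds,\qquad u(x,y,t)=-2\frac{\partial^2}{\partial x^2}\log\det(I+R_x(y,t)).$$ Then $u$ satisfies the Kadomtsev--Petviashvili equation in the form $$\frac{\partial}{\partial x}\Big(\frac{\partial^3u}{\partial x^3}-6u\frac{\partial u}{\partial x}+4\lambda\frac{\partial u}{\partial x}+4\alpha\frac{\partial u}{\partial t}\Big)+3\beta^2\frac{\partial^2u}{\partial y^2}=0.$$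
   Context: $\mathcal{L}(H)$ is the algebra of bounded operators on the complex separable Hilbert space $H$. A linear system $(-A,B,C)$ with state space $H$ and input/output space $H_0$ consists of the generator $-A$ of a strongly continuous semigroup with $\sup_{t\ge0}\|e^{-tA}\|<\infty$ and bounded operators $B:H_0\to H$, $C:H\to H_0$. It is $(2,2)$ admissible if $\Theta_0f=\int_0^\infty e^{-sA^\dagger}C^\dagger f(s)\,ds$ and $\Xi_0f=\int_0^\infty e^{-sA}Bf(s)\,ds$ define Hilbert--Schmidt operators $L^2((0,\infty);H_0)\to H$. The determinant is the Fredholm determinant of identity plus trace class. $A_1$ and $A_2$ are not assumed to commute. The equation is understood where $\det(I+R_x(y,t))\ne0$. *)

theory Defs
  imports "HOL-Analysis.Analysis"
begin

section \<open>Complex Hilbert spaces\<close>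

class complex_vector = real_vector +
  fixes scaleC :: "complex \<Rightarrow> 'a \<Rightarrow> 'a" (infixr "*\<^sub>C" 75)
  assumes scaleC_add_right: "c *\<^sub>C (x + y) = c *\<^sub>C x + c *\<^sub>C y"
    and scaleC_add_left: "(c + d) *\<^sub>C x = c *\<^sub>C x + d *\<^sub>C x"
    and scaleC_scaleC: "c *\<^sub>C d *\<^sub>C x = (c * d) *\<^sub>C x"
    and scaleC_one: "1 *\<^sub>C x = x"
    and scaleR_scaleC: "r *\<^sub>R x = complex_of_real r *\<^sub>C x"

text \<open>The inner product is linear in its first and conjugate-linear in its second argument.
  Separability is imposed where needed by the sort \<open>second_countable_topology\<close>.\<close>

class complex_hilbert = complex_vector + real_normed_vector + complete_space +
  fixes cinner :: "'a \<Rightarrow> 'a \<Rightarrow> complex"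
  assumes cinner_commute: "cinner x y = cnj (cinner y x)"
    and cinner_add_left: "cinner (x + y) z = cinner x z + cinner y z"
    and cinner_scaleC_left: "cinner (c *\<^sub>C x) y = c * cinner x y"
    and cinner_self: "cinner x x = complex_of_real ((norm x)\<^sup>2)"
begin

subclass banach ..

end

lemma norm_scaleC:
  fixes x :: "'a::complex_hilbert"
  shows "norm (c *\<^sub>C x) = cmod c * norm x"
proof -
  have "cinner (c *\<^sub>C x) (c *\<^sub>C x) = c * cnj c * cinner x x"
    by (metis cinner_scaleC_left cinner_commute complex_cnj_mult mult.assoc)
  then have "complex_of_real ((norm (c *\<^sub>C x))\<^sup>2) = complex_of_real ((cmod c * norm x)\<^sup>2)"
    by (simp add: cinner_self complex_norm_square[symmetric] power_mult_distrib)
  then have "(norm (c *\<^sub>C x))\<^sup>2 = (cmod c * norm x)\<^sup>2"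
    using of_real_eq_iff by blast
  then show ?thesis
    by (simp add: power2_eq_iff_nonneg)
qed

instantiation complex :: complex_hilbert
begin

definition scaleC_complex :: "complex \<Rightarrow> complex \<Rightarrow> complex"
  where "scaleC_complex c z = c * z"

definition cinner_complex :: "complex \<Rightarrow> complex \<Rightarrow> complex"
  where "cinner_complex z w = z * cnj w"

instance
proof
  fix x :: complex
  show "cinner x x = complex_of_real ((norm x)\<^sup>2)"
    by (simp add: cinner_complex_def complex_norm_square[symmetric])
qed (auto simp: scaleC_complex_def cinner_complex_def algebra_simps scaleR_conv_of_real)

end

section \<open>Bounded operators\<close>

text \<open>The type \<open>'a \<Rightarrow>\<^sub>L 'b\<close> consists of real-linear bounded operators; complex linearity is the
  predicate \<open>clinear_op\<close>.\<close>

definition clinear_op :: "('a::complex_hilbert \<Rightarrow>\<^sub>L 'b::complex_hilbert) \<Rightarrow> bool"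
  where "clinear_op T \<longleftrightarrow> (\<forall>c x. blinfun_apply T (c *\<^sub>C x) = c *\<^sub>C blinfun_apply T x)"

lemma bounded_linear_scaleC: "bounded_linear (\<lambda>x::'a::complex_hilbert. c *\<^sub>C x)"
proof (rule bounded_linear_intro)
  show "norm (c *\<^sub>C x) \<le> norm x * cmod c" for x :: 'a
    by (simp add: norm_scaleC)
qed (simp_all add: scaleC_add_right scaleR_scaleC scaleC_scaleC mult.commute)

instantiation blinfun :: (real_normed_vector, complex_hilbert) complex_vector
begin

lift_definition scaleC_blinfun :: "complex \<Rightarrow> ('a \<Rightarrow>\<^sub>L 'b) \<Rightarrow> ('a \<Rightarrow>\<^sub>L 'b)"
  is "\<lambda>c f x. c *\<^sub>C f x"
  by (rule bounded_linear_compose[OF bounded_linear_scaleC])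

instance
  by standard
    (transfer; simp add: fun_eq_iff scaleC_add_right scaleC_add_left scaleC_scaleC scaleC_one
      scaleR_scaleC)+

end

definition op_pow :: "('a::real_normed_vector \<Rightarrow>\<^sub>L 'a) \<Rightarrow> nat \<Rightarrow> ('a \<Rightarrow>\<^sub>L 'a)"
  where "op_pow A n = ((\<lambda>T. A o\<^sub>L T) ^^ n) id_blinfun"

text \<open>The library function \<open>exp\<close> lives on the class \<open>real_normed_algebra_1\<close>, which the operators
  on a possibly trivial space do not form.\<close>

definition op_exp :: "('a::banach \<Rightarrow>\<^sub>L 'a) \<Rightarrow> ('a \<Rightarrow>\<^sub>L 'a)"
  where "op_exp A = (\<Sum>n. op_pow A n /\<^sub>R fact n)"

definition cadj :: "('a::complex_hilbert \<Rightarrow>\<^sub>L 'b::complex_hilbert) \<Rightarrow> ('b \<Rightarrow>\<^sub>L 'a)"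
  where "cadj T = (THE S. \<forall>x y. cinner (blinfun_apply T x) y = cinner x (blinfun_apply S y))"

section \<open>Hilbert--Schmidt operators on \<open>L\<^sup>2\<close>\<close>

text \<open>Elements of \<open>L\<^sup>2\<close> are represented by square-integrable functions; functions that agree
  almost everywhere are not identified.\<close>

definition L2 :: "'s measure \<Rightarrow> ('s \<Rightarrow> 'k::{complex_hilbert, second_countable_topology}) set"
  where "L2 M = {f \<in> borel_measurable M. integrable M (\<lambda>s. (norm (f s))\<^sup>2)}"

definition L2_inner ::
    "'s measure \<Rightarrow> ('s \<Rightarrow> 'k::{complex_hilbert, second_countable_topology}) \<Rightarrow> ('s \<Rightarrow> 'k) \<Rightarrow> complex"
  where "L2_inner M f g = (LINT s|M. cinner (f s) (g s))"

definition L2_orthonormal_basis ::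
    "'s measure \<Rightarrow> ('s \<Rightarrow> 'k::{complex_hilbert, second_countable_topology}) set \<Rightarrow> bool"
  where "L2_orthonormal_basis M E \<longleftrightarrow>
    E \<subseteq> L2 M \<and>
    (\<forall>e\<in>E. \<forall>e'\<in>E. L2_inner M e e' = (if e = e' then 1 else 0)) \<and>
    (\<forall>f\<in>L2 M. (\<forall>e\<in>E. L2_inner M f e = 0) \<longrightarrow> (AE s in M. f s = 0))"

definition hilbert_schmidt_L2 ::
    "'s measure \<Rightarrow> (('s \<Rightarrow> 'k::{complex_hilbert, second_countable_topology}) \<Rightarrow> 'h::complex_hilbert) \<Rightarrow> bool"
  where "hilbert_schmidt_L2 M T \<longleftrightarrow>
    (\<forall>f\<in>L2 M. \<forall>g\<in>L2 M. T (\<lambda>s. f s + g s) = T f + T g) \<and>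
    (\<forall>c. \<forall>f\<in>L2 M. T (\<lambda>s. c *\<^sub>C f s) = c *\<^sub>C T f) \<and>
    (\<exists>K. \<forall>f\<in>L2 M. norm (T f) \<le> K * sqrt (LINT s|M. (norm (f s))\<^sup>2)) \<and>
    (\<exists>E. L2_orthonormal_basis M E \<and> (\<lambda>e. (norm (T e))\<^sup>2) summable_on E)"

section \<open>Admissible linear systems\<close>

text \<open>Linear systems \<open>(-A, B, C)\<close> with bounded \<open>A\<close>: the strongly continuous semigroup generated by
  \<open>-A\<close> is then the exponential series \<open>op_exp (- t *\<^sub>R A)\<close>, so only its uniform boundedness for
  \<open>t \<ge> 0\<close> is a condition.\<close>

definition linear_system ::
    "('h::{complex_hilbert, second_countable_topology} \<Rightarrow>\<^sub>L 'h) \<Rightarrow>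
     ('k::{complex_hilbert, second_countable_topology} \<Rightarrow>\<^sub>L 'h) \<Rightarrow> ('h \<Rightarrow>\<^sub>L 'k) \<Rightarrow> bool"
  where "linear_system A B C \<longleftrightarrow>
    clinear_op A \<and> clinear_op B \<and> clinear_op C \<and>
    bounded ((\<lambda>t. op_exp (- t *\<^sub>R A)) ` {0..})"

abbreviation half_line :: "real measure"
  where "half_line \<equiv> restrict_space lborel {0<..}"

definition Xi_integrand ::
    "('h::complex_hilbert \<Rightarrow>\<^sub>L 'h) \<Rightarrow> ('k::complex_hilbert \<Rightarrow>\<^sub>L 'h) \<Rightarrow> (real \<Rightarrow> 'k) \<Rightarrow> real \<Rightarrow> 'h"
  where "Xi_integrand A B f s = blinfun_apply (op_exp (- s *\<^sub>R A)) (blinfun_apply B (f s))"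

definition Theta_integrand ::
    "('h::complex_hilbert \<Rightarrow>\<^sub>L 'h) \<Rightarrow> ('h \<Rightarrow>\<^sub>L 'k::complex_hilbert) \<Rightarrow> (real \<Rightarrow> 'k) \<Rightarrow> real \<Rightarrow> 'h"
  where "Theta_integrand A C f s =
    blinfun_apply (op_exp (- s *\<^sub>R cadj A)) (blinfun_apply (cadj C) (f s))"

definition admissible_2_2 ::
    "('h::{complex_hilbert, second_countable_topology} \<Rightarrow>\<^sub>L 'h) \<Rightarrow>
     ('k::{complex_hilbert, second_countable_topology} \<Rightarrow>\<^sub>L 'h) \<Rightarrow> ('h \<Rightarrow>\<^sub>L 'k) \<Rightarrow> bool"
  where "admissible_2_2 A B C \<longleftrightarrow>
    (\<forall>f\<in>L2 half_line. integrable half_line (Theta_integrand A C f)) \<and>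
    (\<forall>f\<in>L2 half_line. integrable half_line (Xi_integrand A B f)) \<and>
    hilbert_schmidt_L2 half_line (\<lambda>f. LINT s|half_line. Theta_integrand A C f s) \<and>
    hilbert_schmidt_L2 half_line (\<lambda>f. LINT s|half_line. Xi_integrand A B f s)"

section \<open>Fredholm determinants\<close>

definition orthonormal_basis :: "'h::complex_hilbert set \<Rightarrow> bool"
  where "orthonormal_basis E \<longleftrightarrow>
    (\<forall>e\<in>E. \<forall>e'\<in>E. cinner e e' = (if e = e' then 1 else 0)) \<and>
    (\<forall>x. (\<forall>e\<in>E. cinner x e = 0) \<longrightarrow> x = 0)"

definition principal_minor :: "('h::complex_hilbert \<Rightarrow>\<^sub>L 'h) \<Rightarrow> 'h set \<Rightarrow> complex"
  where "principal_minor T F =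
    (\<Sum>p | p permutes F. of_int (sign p) * (\<Prod>e\<in>F. cinner (blinfun_apply T (p e)) e))"

text \<open>\<open>det (I + T) = (\<Sum>k. tr (\<Lambda>\<^sup>k T))\<close>, the trace of the \<open>k\<close>-th exterior power being the sum of
  the principal \<open>k \<times> k\<close> minors of the matrix of \<open>T\<close> in an orthonormal basis. For \<open>T\<close> of trace class
  the series converges absolutely and its sum does not depend on the basis.\<close>

definition fredholm_det :: "('h::complex_hilbert \<Rightarrow>\<^sub>L 'h) \<Rightarrow> complex"
  where "fredholm_det T =
    (let E = (SOME E. orthonormal_basis E)
     in \<Sum>\<^sub>\<infinity>F\<in>{F. finite F \<and> F \<subseteq> E}. principal_minor T F)"

section \<open>The tau function and the potential\<close>

definition C_op ::
    "complex \<Rightarrow> complex \<Rightarrow> complex \<Rightarrow> ('h::complex_hilbert \<Rightarrow>\<^sub>L 'h) \<Rightarrow> ('h \<Rightarrow>\<^sub>L complex) \<Rightarrow>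
     real \<Rightarrow> real \<Rightarrow> ('h \<Rightarrow>\<^sub>L complex)"
  where "C_op \<alpha> \<beta> lam A1 C0 y t =
    C0 o\<^sub>L op_exp ((of_real t / \<alpha>) *\<^sub>C (op_pow A1 3 + lam *\<^sub>C A1) - (of_real y / \<beta>) *\<^sub>C op_pow A1 2)"

definition B_op ::
    "complex \<Rightarrow> complex \<Rightarrow> complex \<Rightarrow> ('h::complex_hilbert \<Rightarrow>\<^sub>L 'h) \<Rightarrow> (complex \<Rightarrow>\<^sub>L 'h) \<Rightarrow>
     real \<Rightarrow> real \<Rightarrow> (complex \<Rightarrow>\<^sub>L 'h)"
  where "B_op \<alpha> \<beta> lam A2 B0 y t =
    op_exp ((of_real t / \<alpha>) *\<^sub>C (op_pow A2 3 + lam *\<^sub>C A2) + (of_real y / \<beta>) *\<^sub>C op_pow A2 2) o\<^sub>L B0"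

text \<open>The operator-valued integral is a gauge integral, since the Bochner integral of the library
  requires values in a second-countable space, and operator spaces are not second countable.\<close>

definition R_op ::
    "complex \<Rightarrow> complex \<Rightarrow> complex \<Rightarrow> ('h::complex_hilbert \<Rightarrow>\<^sub>L 'h) \<Rightarrow> ('h \<Rightarrow>\<^sub>L 'h) \<Rightarrow>
     (complex \<Rightarrow>\<^sub>L 'h) \<Rightarrow> ('h \<Rightarrow>\<^sub>L complex) \<Rightarrow> real \<Rightarrow> real \<Rightarrow> real \<Rightarrow> ('h \<Rightarrow>\<^sub>L 'h)"
  where "R_op \<alpha> \<beta> lam A1 A2 B0 C0 x y t =
    integral {x..} (\<lambda>s. op_exp (- s *\<^sub>R A2) o\<^sub>L B_op \<alpha> \<beta> lam A2 B0 y t o\<^sub>L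
      C_op \<alpha> \<beta> lam A1 C0 y t o\<^sub>L op_exp (- s *\<^sub>R A1))"

definition tau ::
    "complex \<Rightarrow> complex \<Rightarrow> complex \<Rightarrow> ('h::complex_hilbert \<Rightarrow>\<^sub>L 'h) \<Rightarrow> ('h \<Rightarrow>\<^sub>L 'h) \<Rightarrow>
     (complex \<Rightarrow>\<^sub>L 'h) \<Rightarrow> ('h \<Rightarrow>\<^sub>L complex) \<Rightarrow> real \<Rightarrow> real \<Rightarrow> real \<Rightarrow> complex"
  where "tau \<alpha> \<beta> lam A1 A2 B0 C0 x y t = fredholm_det (R_op \<alpha> \<beta> lam A1 A2 B0 C0 x y t)"

text \<open>A branch of \<open>log f\<close> near a point \<open>x\<close> with \<open>f x \<noteq> 0\<close>. The principal logarithm of \<open>f\<close> itself may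
  be discontinuous near \<open>x\<close>; the one of \<open>f s / f x\<close> is not, as this quotient is close to \<open>1\<close>. By the
  lemma below, any other continuous branch differs from this one by a constant near \<open>x\<close>.\<close>

definition local_log :: "(real \<Rightarrow> complex) \<Rightarrow> real \<Rightarrow> real \<Rightarrow> complex"
  where "local_log f x s = Ln (f x) + Ln (f s / f x)"

lemma local_log_unique:
  assumes L: "isCont L x" and exp_L: "eventually (\<lambda>s. exp (L s) = f s) (nhds x)"
  shows "eventually (\<lambda>s. local_log f x s = L s + (Ln (f x) - L x)) (nhds x)"
proof -
  have fx: "exp (L x) = f x"
    using exp_L by (rule eventually_nhds_x_imp_x)
  have "(L \<longlongrightarrow> L x) (nhds x)"
    using L by (simp add: isCont_def tendsto_at_iff_tendsto_nhds)
  then have "eventually (\<lambda>s. dist (L s) (L x) < 1) (nhds x)"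
    by (rule tendstoD) simp
  with exp_L show ?thesis
  proof eventually_elim
    case (elim s)
    have "\<bar>Im (L s - L x)\<bar> < 1"
      using elim(2) abs_Im_le_cmod[of "L s - L x"] by (simp add: dist_norm)
    then have "Ln (exp (L s - L x)) = L s - L x"
      using pi_gt3 by (intro Ln_exp) linarith+
    moreover have "f s / f x = exp (L s - L x)"
      by (simp add: exp_diff fx elim(1))
    ultimately show ?case
      by (simp add: local_log_def)
  qed
qed

definition dx :: "(real \<Rightarrow> real \<Rightarrow> real \<Rightarrow> complex) \<Rightarrow> real \<Rightarrow> real \<Rightarrow> real \<Rightarrow> complex"
  where "dx f x y t = vector_derivative (\<lambda>s. f s y t) (at x)"

definition dy :: "(real \<Rightarrow> real \<Rightarrow> real \<Rightarrow> complex) \<Rightarrow> real \<Rightarrow> real \<Rightarrow> real \<Rightarrow> complex"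
  where "dy f x y t = vector_derivative (\<lambda>s. f x s t) (at y)"

definition dt :: "(real \<Rightarrow> real \<Rightarrow> real \<Rightarrow> complex) \<Rightarrow> real \<Rightarrow> real \<Rightarrow> real \<Rightarrow> complex"
  where "dt f x y t = vector_derivative (\<lambda>s. f x y s) (at t)"

text \<open>\<open>-2 \<partial>\<^sub>x\<^sup>2 log \<tau>\<close>, meaningful at the points where \<open>\<tau>\<close> does not vanish.\<close>

definition potential :: "(real \<Rightarrow> real \<Rightarrow> real \<Rightarrow> complex) \<Rightarrow> real \<Rightarrow> real \<Rightarrow> real \<Rightarrow> complex"
  where "potential \<tau> x y t = - 2 *
    vector_derivative (\<lambda>s. vector_derivative (local_log (\<lambda>r. \<tau> r y t) x) (at s)) (at x)"

end

theory Submission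
  imports Defs "HOL-Complex_Analysis.Cauchy_Integral_Formula" "Jordan_Normal_Form.Schur_Decomposition" "Jordan_Normal_Form.Char_Poly"
begin

text \<open>
  Write \<open>b = e\<^sup>-\<^sup>x\<^sup>A\<^sup>2 B(y;t) 1\<close> and \<open>c = C(y;t) e\<^sup>-\<^sup>x\<^sup>A\<^sup>1\<close>, a vector and a functional. The operator \<open>R\<close> is the
  integral over \<open>(x, \<infinity>)\<close> of the rank-one operators \<open>b \<otimes> c\<close>, so \<open>\<partial>\<^sub>x R = - b \<otimes> c\<close>, and
  \<open>\<partial>\<^sub>x log \<tau> = - v\<close> with \<open>v = c (I + R)\<^sup>-\<^sup>1 b\<close>. Hence \<open>u = 2 \<partial>\<^sub>x v\<close>.

  Comparison of the derivatives in \<open>x\<close> gives the Sylvester equation \<open>A2 R + R A1 = b \<otimes> c\<close> (\<open>Sylvester\<close>). Because of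
  it, the derivatives of \<open>R\<close> in \<open>y\<close> and \<open>t\<close> also have finite rank, although \<open>A1\<close>, \<open>A2\<close> and \<open>R\<close> need not commute: they are
  combinations of the operators \<open>(A2\<^sup>k b) \<otimes> (c A1\<^sup>j)\<close> (\<open>R_derivative_finite_rank\<close>). The entries
  \<open>P j k = c A1\<^sup>j (I + R)\<^sup>-\<^sup>1 A2\<^sup>k b\<close> therefore have derivatives that are quadratic polynomials in entries
  (\<open>P_derivative\<close>), for instance \<open>\<partial>\<^sub>x P j k = P j 0 * P 0 k - P (j + 1) k - P j (k + 1)\<close>. The equation for
  \<open>v = P 0 0\<close> becomes an identity between polynomials in independent variables (\<open>kp_identity\<close>), which expansion proves.

  The analytic part is the formula for \<open>\<partial>\<^sub>x log \<tau>\<close> with \<open>\<tau>\<close> the sum of the Fredholm series of principal minors.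
  By admissibility, \<open>norm b\<close> and \<open>norm c\<close> are square integrable over half-lines: the Hilbert--Schmidt norm of integration
  against a function is its \<open>L\<^sup>2\<close> norm (\<open>hilbert_schmidt_square_integrable\<close>). So \<open>R\<close> has a property that takes
  the place of trace class here: its numerical values are dominated by those of a positive operator of finite trace
  \<open>K\<close> (\<open>dominated\<close>, \<open>dominated_integral_rank1\<close>). For matrices this implies \<open>\<bar>det (I + T)\<bar> \<le> exp K\<close>
  (\<open>det_dominated\<close>, \<open>detn_bound\<close>), in every dimension. From this single bound follow the convergence of the determinants
  of finite-dimensional compressions to the Fredholm determinant (\<open>detn_tendsto_infsum\<close>), by Cauchy's inequality
  a bound for their derivatives in rank-one directions (\<open>rank1_derivative_bound\<close>), and by Cramer's rule a bound
  for the inverses of the compressions where the limit is not zero. As the compressions converge in norm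
  (\<open>compress_tendsto\<close>), \<open>I + T\<close> is then invertible (\<open>invertible_if_limit_nonzero\<close>), and dominated convergence
  in the integrated derivative formula gives the logarithmic derivative of the determinant along a path of operators
  with finite-rank derivative (\<open>determinant_path_derivative\<close>). The same uniform bounds show that \<open>\<tau>\<close> is
  continuous in each variable, so that the points with \<open>\<tau> \<noteq> 0\<close> form an open set on every line parallel to an axis, and
  the identities between derivatives can be differentiated again.
\<close>

section \<open>Complex Hilbert spaces\<close>

lemma scaleC_zero_left [simp]: "0 *\<^sub>C (x::'a::complex_vector) = 0"
  using scaleR_scaleC[of 0 x] by simp

lemma scaleC_zero_right [simp]: "c *\<^sub>C (0::'a::complex_vector) = 0"
  using scaleC_add_right[of c 0 0] by simp

lemma scaleC_minus_right: "c *\<^sub>C (- x::'a::complex_vector) = - (c *\<^sub>C x)"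
  using scaleC_add_right[of c x "- x"] by (simp add: eq_neg_iff_add_eq_0 add.commute)

lemma scaleC_diff_right: "c *\<^sub>C (x - y::'a::complex_vector) = c *\<^sub>C x - c *\<^sub>C y"
  by (simp only: diff_conv_add_uminus scaleC_add_right scaleC_minus_right)

lemma scaleC_complex [simp]: "c *\<^sub>C (z::complex) = c * z"
  by (simp add: scaleC_complex_def)

lemma bounded_bilinear_scaleC:
  "bounded_bilinear (\<lambda>c (x::'a::complex_hilbert). c *\<^sub>C x)"
  by (rule bounded_bilinear.intro)
    (auto simp: scaleC_add_left scaleC_add_right scaleR_scaleC scaleC_scaleC mult.commute
      norm_scaleC scaleR_conv_of_real intro!: exI[of _ 1])

lemma cinner_add_right: "cinner x (y + z) = cinner x y + cinner (x::'a::complex_hilbert) z"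
  by (metis cinner_add_left cinner_commute complex_cnj_add)

lemma cinner_scaleC_right: "cinner x (c *\<^sub>C y) = cnj c * cinner (x::'a::complex_hilbert) y"
  by (metis cinner_scaleC_left cinner_commute complex_cnj_mult)

lemma cinner_zero_left [simp]: "cinner 0 (y::'a::complex_hilbert) = 0"
  using cinner_add_left[of 0 0 y] by simp

lemma cinner_zero_right [simp]: "cinner (y::'a::complex_hilbert) 0 = 0"
  using cinner_add_right[of y 0 0] by simp

lemma cinner_minus_left: "cinner (- x) (y::'a::complex_hilbert) = - cinner x y"
  using cinner_add_left[of x "- x" y] by (simp add: eq_neg_iff_add_eq_0 add.commute)

lemma cinner_minus_right: "cinner x (- y::'a::complex_hilbert) = - cinner x y"
  using cinner_add_right[of x y "- y"] by (simp add: eq_neg_iff_add_eq_0 add.commute)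

lemma cinner_diff_left: "cinner (x - y) (z::'a::complex_hilbert) = cinner x z - cinner y z"
  by (simp only: diff_conv_add_uminus cinner_add_left cinner_minus_left)

lemma cinner_diff_right: "cinner x (y - z::'a::complex_hilbert) = cinner x y - cinner x z"
  by (simp only: diff_conv_add_uminus cinner_add_right cinner_minus_right)

lemma cinner_sum_left: "cinner (\<Sum>i\<in>F. f i) (z::'a::complex_hilbert) = (\<Sum>i\<in>F. cinner (f i) z)"
  by (induction F rule: infinite_finite_induct) (simp_all add: cinner_add_left)

lemma cinner_sum_right: "cinner z (\<Sum>i\<in>F. f i::'a::complex_hilbert) = (\<Sum>i\<in>F. cinner z (f i))"
  by (induction F rule: infinite_finite_induct) (simp_all add: cinner_add_right)

lemma cinner_scaleR_left: "cinner (r *\<^sub>R x) (y::'a::complex_hilbert) = r *\<^sub>R cinner x y"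
  by (simp add: scaleR_scaleC cinner_scaleC_left)

lemma cinner_scaleR_right: "cinner x (r *\<^sub>R y::'a::complex_hilbert) = r *\<^sub>R cinner x y"
  by (simp add: scaleR_scaleC cinner_scaleC_right)

lemma cinner_self_eq_0 [simp]: "cinner x x = 0 \<longleftrightarrow> x = (0::'a::complex_hilbert)"
  by (simp add: cinner_self)

lemma cmod_cinner_commute: "cmod (cinner x y) = cmod (cinner y (x::'a::complex_hilbert))"
  by (metis cinner_commute complex_mod_cnj)

lemma mult_cnj_cmod: "z * cnj z = of_real ((cmod z)\<^sup>2)" "cnj z * z = of_real ((cmod z)\<^sup>2)"
  by (simp_all add: complex_norm_square[symmetric] mult.commute)

lemma cinner_Cauchy_Schwarz: "cmod (cinner x y) \<le> norm x * norm (y::'a::complex_hilbert)"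
proof (cases "y = 0")
  case False
  define a where "a = cinner x y / of_real ((norm y)\<^sup>2)"
  define z where "z = x - a *\<^sub>C y"
  have y: "norm y > 0" using False by simp
  have zy: "cinner z y = 0"
    using False by (simp add: z_def a_def cinner_diff_left cinner_scaleC_left cinner_self)
  have "cinner x y * cnj (cinner x y) = a * cnj a * of_real ((norm y)^4)"
    using y by (simp add: a_def power2_eq_square power4_eq_xxxx)
  have xz: "x = z + a *\<^sub>C y" by (simp add: z_def)
  have "of_real ((norm x)\<^sup>2) = cinner (z + a *\<^sub>C y) (z + a *\<^sub>C y)"
    by (simp add: cinner_self xz[symmetric])
  also have "\<dots> = cinner z z + a * cnj a * cinner y y"
    using zy cinner_commute[of y z]
    by (simp add: cinner_add_left cinner_add_right cinner_scaleC_left cinner_scaleC_right algebra_simps)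
  also have "\<dots> = of_real ((norm z)\<^sup>2 + (cmod a)\<^sup>2 * (norm y)\<^sup>2)"
    by (simp add: cinner_self mult_cnj_cmod)
  finally have "(norm x)\<^sup>2 = (norm z)\<^sup>2 + (cmod a)\<^sup>2 * (norm y)\<^sup>2"
    using of_real_eq_iff by blast
  then have "(cmod a * norm y)\<^sup>2 \<le> (norm x)\<^sup>2" by (simp add: power_mult_distrib)
  then have "cmod a * norm y \<le> norm x"
    by (rule power2_le_imp_le) simp
  moreover have "cmod a = cmod (cinner x y) / (norm y)\<^sup>2"
    by (simp add: a_def norm_divide norm_power)
  ultimately show ?thesis using y by (simp add: field_simps power2_eq_square)
qed simp

lemma bounded_bilinear_cinner:
  "bounded_bilinear (\<lambda>x (y::'a::complex_hilbert). cinner x y)"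
  by (rule bounded_bilinear.intro)
    (auto simp: cinner_add_left cinner_add_right cinner_scaleR_left cinner_scaleR_right
      cinner_Cauchy_Schwarz intro!: exI[of _ 1])

lemmas tendsto_cinner = bounded_bilinear.tendsto[OF bounded_bilinear_cinner]
lemmas tendsto_scaleC = bounded_bilinear.tendsto[OF bounded_bilinear_scaleC]
lemmas bounded_linear_cinner_left = bounded_bilinear.bounded_linear_left[OF bounded_bilinear_cinner]
lemmas bounded_linear_cinner_right = bounded_bilinear.bounded_linear_right[OF bounded_bilinear_cinner]

lemma cinner_right_eqI:
  assumes "\<And>x. cinner x y = cinner x (z::'a::complex_hilbert)" shows "y = z"
  using assms[of "y - z"] by (metis cinner_diff_right cinner_self_eq_0 eq_iff_diff_eq_0)

lemma clinear_opD: "clinear_op T \<Longrightarrow> T (c *\<^sub>C x) = c *\<^sub>C T x"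
  by (simp add: clinear_op_def)

section \<open>Orthonormal systems\<close>

definition orthonormal :: "'h::complex_hilbert set \<Rightarrow> bool"
  where "orthonormal F \<longleftrightarrow> (\<forall>e\<in>F. \<forall>e'\<in>F. cinner e e' = (if e = e' then 1 else 0))"

lemma orthonormalD:
  "orthonormal F \<Longrightarrow> e \<in> F \<Longrightarrow> e' \<in> F \<Longrightarrow> cinner e e' = (if e = e' then 1 else 0)"
  by (simp add: orthonormal_def)

lemma orthonormal_subset: "orthonormal F \<Longrightarrow> G \<subseteq> F \<Longrightarrow> orthonormal G"
  unfolding orthonormal_def by blast

lemma cinner_orthonormal_sum:
  assumes "orthonormal F" "finite F" "e \<in> F"
  shows "cinner (\<Sum>i\<in>F. a i *\<^sub>C i) e = a e"
proof -
  have "cinner (\<Sum>i\<in>F. a i *\<^sub>C i) e = (\<Sum>i\<in>F. if i = e then a i else 0)"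
    unfolding cinner_sum_left cinner_scaleC_left
    by (rule sum.cong) (use assms in \<open>auto simp: orthonormal_def\<close>)
  then show ?thesis using assms by simp
qed

lemma norm_orthonormal_sum:
  assumes "orthonormal F" "finite F"
  shows "(norm (\<Sum>i\<in>F. a i *\<^sub>C i))\<^sup>2 = (\<Sum>i\<in>F. (cmod (a i))\<^sup>2)"
proof -
  have "complex_of_real ((norm (\<Sum>i\<in>F. a i *\<^sub>C i))\<^sup>2) = (\<Sum>j\<in>F. cnj (a j) * a j)"
    unfolding cinner_self[symmetric] cinner_sum_right cinner_scaleC_right
    by (rule sum.cong) (use assms in \<open>auto simp: cinner_orthonormal_sum\<close>)
  also have "\<dots> = complex_of_real (\<Sum>i\<in>F. (cmod (a i))\<^sup>2)"
    by (simp add: mult_cnj_cmod)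
  finally show ?thesis using of_real_eq_iff by blast
qed

lemma norm_minus_projection:
  assumes "orthonormal F" "finite F"
  shows "(norm (x - (\<Sum>i\<in>F. cinner x i *\<^sub>C i)))\<^sup>2 = (norm x)\<^sup>2 - (\<Sum>i\<in>F. (cmod (cinner x i))\<^sup>2)"
proof -
  define y where "y = (\<Sum>i\<in>F. cinner x i *\<^sub>C i)"
  have yy: "cinner y y = (\<Sum>i\<in>F. of_real ((cmod (cinner x i))\<^sup>2))"
    using norm_orthonormal_sum[OF assms, of "cinner x"] by (simp add: cinner_self y_def)
  have xy: "cinner x y = (\<Sum>i\<in>F. of_real ((cmod (cinner x i))\<^sup>2))"
    unfolding y_def cinner_sum_right cinner_scaleC_right by (simp add: mult_cnj_cmod)
  then have yx: "cinner y x = (\<Sum>i\<in>F. of_real ((cmod (cinner x i))\<^sup>2))"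
    by (subst cinner_commute) simp
  have "complex_of_real ((norm (x - y))\<^sup>2) = of_real ((norm x)\<^sup>2) - (\<Sum>i\<in>F. of_real ((cmod (cinner x i))\<^sup>2))"
    unfolding cinner_self[symmetric] cinner_diff_left cinner_diff_right xy yx yy by simp
  also have "\<dots> = of_real ((norm x)\<^sup>2 - (\<Sum>i\<in>F. (cmod (cinner x i))\<^sup>2))" by simp
  finally show ?thesis using of_real_eq_iff unfolding y_def by blast
qed

lemma Bessel_inequality:
  assumes "orthonormal F" "finite F"
  shows "(\<Sum>i\<in>F. (cmod (cinner x i))\<^sup>2) \<le> (norm x)\<^sup>2"
  using norm_minus_projection[OF assms, of x] zero_le_power2[of "norm (x - (\<Sum>i\<in>F. cinner x i *\<^sub>C i))"]
  by linarith

text \<open>A maximal orthonormal set, which Zorn's lemma provides, is total: a nonzero vector orthogonal to it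
  could be normalised and added.\<close>

lemma orthonormal_basis_exists: "\<exists>E::'h::complex_hilbert set. orthonormal_basis E"
proof -
  have "\<exists>M\<in>Collect orthonormal. \<forall>X\<in>Collect (orthonormal::'h set \<Rightarrow> bool). M \<subseteq> X \<longrightarrow> X = M"
  proof (rule subset_Zorn)
    fix C :: "'h set set" assume C: "subset.chain (Collect orthonormal) C"
    have "orthonormal (\<Union>C)"
      unfolding orthonormal_def
    proof (intro ballI)
      fix e e' assume "e \<in> \<Union>C" "e' \<in> \<Union>C"
      then obtain X Y where "X \<in> C" "e \<in> X" "Y \<in> C" "e' \<in> Y" by blast
      moreover have "X \<subseteq> Y \<or> Y \<subseteq> X"
        using C \<open>X \<in> C\<close> \<open>Y \<in> C\<close> by (auto simp: subset.chain_def)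
      ultimately obtain Z where "Z \<in> C" "e \<in> Z" "e' \<in> Z" by blast
      moreover have "orthonormal Z" using C \<open>Z \<in> C\<close> by (auto simp: subset.chain_def)
      ultimately show "cinner e e' = (if e = e' then 1 else 0)" by (simp add: orthonormalD)
    qed
    then show "\<exists>U\<in>Collect orthonormal. \<forall>X\<in>C. X \<subseteq> U" by blast
  qed
  then obtain M where M: "orthonormal M" and max: "\<And>X. orthonormal X \<Longrightarrow> M \<subseteq> X \<Longrightarrow> X = (M::'h set)"
    by auto
  have "x = 0" if x: "\<forall>e\<in>M. cinner x e = 0" for x
  proof (rule ccontr)
    assume "x \<noteq> 0"
    define y where "y = inverse (norm x) *\<^sub>R x"
    have y1: "cinner y y = 1"
      using \<open>x \<noteq> 0\<close> by (simp add: cinner_self y_def)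
    have ye: "cinner y e = 0" "cinner e y = 0" if "e \<in> M" for e
      using x that cinner_commute[of e x] by (auto simp: y_def cinner_scaleR_left cinner_scaleR_right)
    have "orthonormal (insert y M)"
      using M y1 ye unfolding orthonormal_def by auto
    then have "y \<in> M" using max by blast
    then show False using ye y1 by fastforce
  qed
  with M show ?thesis
    unfolding orthonormal_basis_def orthonormal_def by blast
qed

lemma orthonormal_dist:
  assumes "orthonormal F" "e \<in> F" "e' \<in> F" "e \<noteq> e'"
  shows "1 < dist e e'"
proof -
  have "complex_of_real ((norm (e - e'))\<^sup>2) = 2"
    unfolding cinner_self[symmetric] cinner_diff_left cinner_diff_right
    using assms by (simp add: orthonormalD)
  then have "(norm (e - e'))\<^sup>2 = 2" by (metis of_real_eq_iff of_real_numeral)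
  then have "1\<^sup>2 < (norm (e - e'))\<^sup>2" by simp
  then show ?thesis unfolding dist_norm by (rule power2_less_imp_less) simp
qed

text \<open>Distinct members are at distance \<open>\<surd>2\<close>, so the balls of radius \<open>1/2\<close> about them are disjoint.\<close>

lemma countable_orthonormal:
  fixes F :: "'h::{complex_hilbert, second_countable_topology} set"
  assumes "orthonormal F" shows "countable F"
proof -
  have disj: "e = e'" if "e \<in> F" "e' \<in> F" "x \<in> ball e (1/2)" "x \<in> ball e' (1/2)" for e e' x
  proof (rule ccontr)
    assume "e \<noteq> e'"
    then have "1 < dist e e'" using assms that orthonormal_dist by blast
    moreover have "dist e e' \<le> dist e x + dist e' x" by (rule dist_triangle2)
    ultimately show False using that by simp
  qed
  have "countable ((\<lambda>e. ball e (1/2)) ` F)"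
  proof (rule countable_disjoint_open_subsets)
    show "disjoint ((\<lambda>e. ball e (1/2)) ` F)"
    proof (rule pairwiseI)
      fix X Y assume "X \<in> (\<lambda>e. ball e (1/2)) ` F" "Y \<in> (\<lambda>e. ball e (1/2)) ` F" "X \<noteq> Y"
      then obtain e e' where "X = ball e (1/2)" "Y = ball e' (1/2)" "e \<in> F" "e' \<in> F" "e \<noteq> e'" by blast
      then show "disjnt X Y" unfolding disjnt_iff using disj by metis
    qed
  qed auto
  moreover have "inj_on (\<lambda>e. ball e (1/2)) F"
  proof (rule inj_onI)
    fix x y assume F: "x \<in> F" "y \<in> F" and eq: "ball x (1/2) = ball y (1/2)"
    have "x \<in> ball x (1/2)" by simp
    moreover from this have "x \<in> ball y (1/2)" unfolding eq .
    ultimately show "x = y" by (rule disj[OF F])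
  qed
  ultimately show ?thesis using countable_image_inj_on by blast
qed

text \<open>A Hilbert space is handled through an orthonormal basis together with an exhaustion
  of it by finite sets, all limits being taken along that exhaustion.\<close>

locale exhausted_basis =
  fixes E :: "'h::complex_hilbert set" and G :: "nat \<Rightarrow> 'h set"
  assumes basis: "orthonormal_basis E"
    and finite_G: "finite (G n)" and mono_G: "m \<le> n \<Longrightarrow> G m \<subseteq> G n" and Union_G: "(\<Union>n. G n) = E"
begin

lemma orthonormal_E: "orthonormal E"
  using basis by (auto simp: orthonormal_basis_def orthonormal_def)

lemma G_subset: "G n \<subseteq> E"
  using Union_G by blast

lemma orthonormal_G: "orthonormal (G n)"
  using orthonormal_E G_subset orthonormal_subset by blast

lemma eq_0I: "(\<And>e. e \<in> E \<Longrightarrow> cinner x e = 0) \<Longrightarrow> x = 0"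
  using basis by (auto simp: orthonormal_basis_def)

text \<open>By Pythagoras the partial sums are Cauchy, since their squared distances are differences of a bounded
  increasing sequence.\<close>

lemma orthonormal_series_convergent:
  assumes bound: "\<And>n. (\<Sum>e\<in>G n. (cmod (a e))\<^sup>2) \<le> K"
  shows "convergent (\<lambda>n. \<Sum>e\<in>G n. a e *\<^sub>C e)"
proof -
  let ?s = "\<lambda>n. \<Sum>e\<in>G n. (cmod (a e))\<^sup>2" and ?v = "\<lambda>n. \<Sum>e\<in>G n. a e *\<^sub>C e"
  have "incseq ?s"
    by (intro incseq_SucI sum_mono2 finite_G mono_G) auto
  then have "convergent ?s"
    using bound incseq_convergent[of ?s K] by (metis convergentI)
  then have cauchy: "Cauchy ?s" by (rule convergent_Cauchy)
  have diff: "(norm (?v n - ?v m))\<^sup>2 = ?s n - ?s m" if "m \<le> n" for m n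
  proof -
    have "?v n - ?v m = (\<Sum>e\<in>G n - G m. a e *\<^sub>C e)"
      by (rule sum_diff[OF finite_G mono_G[OF that], symmetric])
    moreover have "?s n - ?s m = (\<Sum>e\<in>G n - G m. (cmod (a e))\<^sup>2)"
      by (rule sum_diff[OF finite_G mono_G[OF that], symmetric])
    moreover have "orthonormal (G n - G m)" "finite (G n - G m)"
      using orthonormal_subset[OF orthonormal_G, of "G n - G m" n] finite_G by auto
    ultimately show ?thesis
      using norm_orthonormal_sum[of "G n - G m" a] by simp
  qed
  have "Cauchy ?v"
  proof (rule CauchyI')
    fix r :: real assume "r > 0"
    then obtain M where M: "\<And>m n. m \<ge> M \<Longrightarrow> n \<ge> M \<Longrightarrow> norm (?s m - ?s n) < r\<^sup>2"
      using CauchyD[OF cauchy, of "r\<^sup>2"] by auto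
    have "norm (?v m - ?v n) < r" if "m \<ge> M" "n > m" for m n
    proof -
      have "(norm (?v n - ?v m))\<^sup>2 < r\<^sup>2"
        using diff[of m n] M[of n m] that by auto
      then show ?thesis using \<open>r > 0\<close> by (metis norm_minus_commute less_imp_le power2_less_imp_less)
    qed
    then show "\<exists>M. \<forall>m\<ge>M. \<forall>n>m. dist (?v m) (?v n) < r" unfolding dist_norm by blast
  qed
  then show ?thesis using Cauchy_convergent_iff by blast
qed

lemma cinner_series_eq:
  assumes lim: "(\<lambda>n. \<Sum>e\<in>G n. a e *\<^sub>C e) \<longlonglongrightarrow> y" and e: "e \<in> E"
  shows "cinner y e = a e"
proof -
  obtain m where m: "e \<in> G m" using e Union_G by blast
  have "(\<lambda>n. cinner (\<Sum>e\<in>G n. a e *\<^sub>C e) e) \<longlonglongrightarrow> cinner y e"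
    by (intro tendsto_cinner lim tendsto_const)
  moreover have "\<forall>\<^sub>F n in sequentially. cinner (\<Sum>e\<in>G n. a e *\<^sub>C e) e = a e"
    using eventually_ge_at_top[of m]
    by eventually_elim (use m mono_G in \<open>auto intro!: cinner_orthonormal_sum orthonormal_G finite_G\<close>)
  ultimately have "(\<lambda>n. a e) \<longlonglongrightarrow> cinner y e"
    using tendsto_cong by (smt (verit) eventually_mono)
  then show ?thesis by (simp add: LIMSEQ_const_iff)
qed

text \<open>The series converges by Bessel's inequality; its limit has the coefficients of \<open>x\<close>, hence equals \<open>x\<close>.\<close>

lemma Fourier_expansion: "(\<lambda>n. \<Sum>e\<in>G n. cinner x e *\<^sub>C e) \<longlonglongrightarrow> x"
proof -
  have "convergent (\<lambda>n. \<Sum>e\<in>G n. cinner x e *\<^sub>C e)"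
    by (rule orthonormal_series_convergent) (rule Bessel_inequality[OF orthonormal_G finite_G])
  then obtain y where y: "(\<lambda>n. \<Sum>e\<in>G n. cinner x e *\<^sub>C e) \<longlonglongrightarrow> y"
    by (auto simp: convergent_def)
  then have "x - y = 0"
    by (intro eq_0I) (simp add: cinner_diff_left cinner_series_eq)
  then show ?thesis using y by simp
qed

lemma Parseval: "(\<lambda>n. \<Sum>e\<in>G n. (cmod (cinner x e))\<^sup>2) \<longlonglongrightarrow> (norm x)\<^sup>2"
proof -
  have "(\<lambda>n. (norm (\<Sum>e\<in>G n. cinner x e *\<^sub>C e))\<^sup>2) \<longlonglongrightarrow> (norm x)\<^sup>2"
    by (intro tendsto_intros Fourier_expansion)
  then show ?thesis
    by (simp add: norm_orthonormal_sum[OF orthonormal_G finite_G])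
qed

text \<open>The representing vector has the coefficients \<open>cnj (C e)\<close>, which are square summable because \<open>C\<close>
  is bounded on the partial sums themselves.\<close>

lemma Riesz_representation:
  assumes "clinear_op C"
  shows "\<exists>y. \<forall>x. blinfun_apply C x = cinner x (y::'h)"
proof -
  let ?z = "\<lambda>n. \<Sum>e\<in>G n. cnj (C e) *\<^sub>C e"
  have bound: "(\<Sum>e\<in>G n. (cmod (cnj (C e)))\<^sup>2) \<le> (norm C)\<^sup>2" for n
  proof -
    let ?s = "\<Sum>e\<in>G n. (cmod (C e))\<^sup>2"
    have nz: "(norm (?z n))\<^sup>2 = ?s"
      by (simp add: norm_orthonormal_sum[OF orthonormal_G finite_G])
    have "C (?z n) = of_real ?s"
      using assms by (simp add: blinfun.sum_right clinear_opD mult_cnj_cmod)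
    then have "cmod (C (?z n)) = \<bar>?s\<bar>" by (simp only: norm_of_real)
    then have "?s = cmod (C (?z n))" by (simp add: sum_nonneg)
    also have "\<dots> \<le> norm C * norm (?z n)" by (rule norm_blinfun)
    finally have "(norm (?z n))\<^sup>2 \<le> norm C * norm (?z n)" using nz by simp
    then have "norm (?z n) \<le> norm C"
      by (cases "norm (?z n) = 0") (auto simp: power2_eq_square)
    then show ?thesis using nz power_mono[of "norm (?z n)" "norm C" 2] by simp
  qed
  then obtain y where y: "?z \<longlonglongrightarrow> y"
    using orthonormal_series_convergent[of "\<lambda>e. cnj (C e)"] by (auto simp: convergent_def)
  have "C x = cinner x y" for x
  proof (rule LIMSEQ_unique)
    show "(\<lambda>n. C (\<Sum>e\<in>G n. cinner x e *\<^sub>C e)) \<longlonglongrightarrow> C x"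
      by (intro tendsto_intros Fourier_expansion)
    have "(\<lambda>n. cinner x (?z n)) \<longlonglongrightarrow> cinner x y"
      by (intro tendsto_cinner y tendsto_const)
    moreover have "cinner x (?z n) = C (\<Sum>e\<in>G n. cinner x e *\<^sub>C e)" for n
      using assms by (simp add: blinfun.sum_right clinear_opD cinner_sum_right cinner_scaleC_right mult.commute)
    ultimately show "(\<lambda>n. C (\<Sum>e\<in>G n. cinner x e *\<^sub>C e)) \<longlonglongrightarrow> cinner x y" by simp
  qed
  then show ?thesis by blast
qed

end

lemma exhausted_basis_exists:
  fixes E :: "'h::{complex_hilbert, second_countable_topology} set"
  assumes "orthonormal_basis E"
  shows "\<exists>G. exhausted_basis E G"
proof -
  have "countable E"
    using assms by (intro countable_orthonormal) (auto simp: orthonormal_basis_def orthonormal_def)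
  then have inj: "inj_on (to_nat_on E) E" by (rule inj_on_to_nat_on)
  have "exhausted_basis E (\<lambda>n. {e \<in> E. to_nat_on E e < n})"
  proof
    show "finite {e \<in> E. to_nat_on E e < n}" for n
      by (rule inj_on_finite[of "to_nat_on E" _ "{..<n}"]) (use inj in \<open>auto intro: inj_on_subset\<close>)
  qed (use assms in auto)
  then show ?thesis by blast
qed

section \<open>Adjoints\<close>

lemma Riesz_representation:
  fixes C :: "'h::{complex_hilbert, second_countable_topology} \<Rightarrow>\<^sub>L complex"
  assumes "clinear_op C"
  shows "\<exists>y. \<forall>x. C x = cinner x y"
  using exhausted_basis.Riesz_representation[OF _ assms] exhausted_basis_exists orthonormal_basis_exists
  by blast

lemma adjoint_exists:
  fixes T :: "'h::{complex_hilbert, second_countable_topology} \<Rightarrow>\<^sub>L 'k::complex_hilbert"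
  assumes T: "clinear_op T"
  shows "\<exists>S. \<forall>x y. cinner (T x) y = cinner x (blinfun_apply S y)"
proof -
  have "\<exists>z. \<forall>x. cinner (T x) y = cinner x z" for y
  proof -
    have bl: "bounded_linear (\<lambda>x. cinner (T x) y)"
      by (rule bounded_linear_compose[OF bounded_linear_cinner_left blinfun.bounded_linear_right])
    have "clinear_op (Blinfun (\<lambda>x. cinner (T x) y))"
      using T by (simp add: clinear_op_def bounded_linear_Blinfun_apply[OF bl] cinner_scaleC_left)
    then show ?thesis
      using Riesz_representation[of "Blinfun (\<lambda>x. cinner (T x) y)"]
      by (simp add: bounded_linear_Blinfun_apply[OF bl])
  qed
  then obtain s where s: "\<And>x y. cinner (T x) y = cinner x (s y)" by metis
  have "bounded_linear s"
  proof (rule bounded_linear_intro)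
    show "s (x + y) = s x + s y" for x y
      by (rule cinner_right_eqI) (simp add: cinner_add_right flip: s)
    show "s (r *\<^sub>R x) = r *\<^sub>R s x" for r x
      by (rule cinner_right_eqI) (simp add: cinner_scaleR_right flip: s)
    show "norm (s x) \<le> norm x * norm T" for x
    proof -
      have "(norm (s x))\<^sup>2 = cmod (cinner (s x) (s x))" by (simp add: cinner_self norm_power)
      also have "\<dots> = cmod (cinner (T (s x)) x)" by (simp add: s)
      also have "\<dots> \<le> norm (T (s x)) * norm x" by (rule cinner_Cauchy_Schwarz)
      also have "\<dots> \<le> norm T * norm (s x) * norm x"
        by (intro mult_right_mono norm_blinfun) simp
      finally show ?thesis
        by (cases "norm (s x) = 0") (auto simp: power2_eq_square mult_ac)
    qed
  qed
  then have "blinfun_apply (Blinfun s) = s" by (rule bounded_linear_Blinfun_apply)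
  then show ?thesis using s by metis
qed

lemma cadj_unique:
  assumes "\<And>x y. cinner (blinfun_apply T x) y = cinner x (blinfun_apply S y)"
  shows "cadj T = S"
  unfolding cadj_def
proof (rule the_equality)
  show "S' = S" if "\<forall>x y. cinner (T x) y = cinner x (blinfun_apply S' y)" for S'
  proof (rule blinfun_eqI, rule cinner_right_eqI)
    show "cinner x (S' y) = cinner x (S y)" for x y
      by (simp only: that[rule_format, symmetric] assms[symmetric])
  qed
  show "\<forall>x y. cinner (T x) y = cinner x (S y)"
    by (simp only: assms) blast
qed

lemma cinner_cadj:
  fixes T :: "'h::{complex_hilbert, second_countable_topology} \<Rightarrow>\<^sub>L 'k::complex_hilbert"
  assumes "clinear_op T"
  shows "cinner (T x) y = cinner x (cadj T y)"
proof -
  obtain S where S: "\<And>x y. cinner (T x) y = cinner x (blinfun_apply S y)"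
    using adjoint_exists[OF assms] by blast
  have *: "cadj T = S"
    by (rule cadj_unique[OF S])
  show ?thesis
    unfolding *
    by (rule S)
qed

lemma clinear_cadj:
  fixes T :: "'h::{complex_hilbert, second_countable_topology} \<Rightarrow>\<^sub>L 'k::complex_hilbert"
  assumes "clinear_op T"
  shows "clinear_op (cadj T)"
  unfolding clinear_op_def
  by (intro allI, rule cinner_right_eqI) (simp only: cinner_scaleC_right cinner_cadj[OF assms, symmetric])

section \<open>Rank-one operators\<close>

lift_definition rank1 :: "'h::complex_hilbert \<Rightarrow> 'h \<Rightarrow> ('h \<Rightarrow>\<^sub>L 'h)" is "\<lambda>x y h. cinner h y *\<^sub>C x"
  by (rule bounded_linear_compose[OF bounded_bilinear.bounded_linear_left[OF bounded_bilinear_scaleC]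
        bounded_linear_cinner_left])

lemmas rank1_apply = rank1.rep_eq

lemma norm_rank1_le: "norm (rank1 x y) \<le> norm x * norm y"
proof (rule norm_blinfun_bound)
  show "norm (rank1 x y h) \<le> norm x * norm y * norm h" for h
    using mult_left_mono[OF cinner_Cauchy_Schwarz[of h y], of "norm x"]
    by (simp add: rank1_apply norm_scaleC mult_ac)
qed simp

lemma bounded_bilinear_rank1: "bounded_bilinear rank1"
proof (rule bounded_bilinear.intro)
  note blin = bounded_bilinear.scaleR_left[OF bounded_bilinear_scaleC]
    bounded_bilinear.scaleR_right[OF bounded_bilinear_scaleC]
  show "rank1 (a + a') b = rank1 a b + rank1 a' b" for a a' b :: 'a
    by (rule blinfun_eqI) (simp only: rank1_apply blinfun.add_left scaleC_add_right)
  show "rank1 a (b + b') = rank1 a b + rank1 a b'" for a b b' :: 'a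
    by (rule blinfun_eqI) (simp only: rank1_apply blinfun.add_left scaleC_add_left cinner_add_right)
  show "rank1 (r *\<^sub>R a) b = r *\<^sub>R rank1 a b" for r and a b :: 'a
    by (rule blinfun_eqI) (simp only: rank1_apply blinfun.scaleR_left blin)
  show "rank1 a (r *\<^sub>R b) = r *\<^sub>R rank1 a b" for r and a b :: 'a
    by (rule blinfun_eqI) (simp only: rank1_apply blinfun.scaleR_left blin cinner_scaleR_right)
  show "\<exists>K. \<forall>a b :: 'a. norm (rank1 a b) \<le> norm a * norm b * K"
    by (intro exI[of _ 1]) (simp add: norm_rank1_le)
qed

lemma clinear_rank1: "clinear_op (rank1 x y)"
  unfolding clinear_op_def
proof (intro allI)
  fix c h
  have "rank1 x y (c *\<^sub>C h) = (c * cinner h y) *\<^sub>C x"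
    by (simp only: rank1_apply cinner_scaleC_left)
  also have "\<dots> = c *\<^sub>C (cinner h y *\<^sub>C x)"
    by (rule scaleC_scaleC[symmetric])
  also have "cinner h y *\<^sub>C x = rank1 x y h"
    by (simp only: rank1_apply)
  finally show "rank1 x y (c *\<^sub>C h) = c *\<^sub>C rank1 x y h" .
qed

section \<open>The operator exponential\<close>

lemma comp_assoc: "(a o\<^sub>L b) o\<^sub>L c = a o\<^sub>L (b o\<^sub>L c)"
  by (rule blinfun_eqI) simp

lemma comp_id [simp]: "id_blinfun o\<^sub>L a = a" "a o\<^sub>L id_blinfun = a"
  by (auto intro: blinfun_eqI)

lemmas comp_linear =
  bounded_bilinear.add_left[OF bounded_bilinear_blinfun_compose]
  bounded_bilinear.add_right[OF bounded_bilinear_blinfun_compose]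
  bounded_bilinear.diff_left[OF bounded_bilinear_blinfun_compose]
  bounded_bilinear.diff_right[OF bounded_bilinear_blinfun_compose]
  bounded_bilinear.minus_left[OF bounded_bilinear_blinfun_compose]
  bounded_bilinear.minus_right[OF bounded_bilinear_blinfun_compose]
  bounded_bilinear.scaleR_left[OF bounded_bilinear_blinfun_compose]
  bounded_bilinear.scaleR_right[OF bounded_bilinear_blinfun_compose]

lemma comp_scaleC_left: "(c *\<^sub>C a) o\<^sub>L b = c *\<^sub>C (a o\<^sub>L b)"
  by (rule blinfun_eqI) (simp add: scaleC_blinfun.rep_eq)

lemma comp_scaleC_right: "clinear_op a \<Longrightarrow> a o\<^sub>L (c *\<^sub>C b) = c *\<^sub>C (a o\<^sub>L b)"
  by (rule blinfun_eqI) (simp add: scaleC_blinfun.rep_eq clinear_opD)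

lemma op_pow_0 [simp]: "op_pow A 0 = id_blinfun"
  by (simp add: op_pow_def)

lemma op_pow_Suc: "op_pow A (Suc n) = A o\<^sub>L op_pow A n"
  by (simp add: op_pow_def)

lemma norm_op_pow: "norm (op_pow A n) \<le> norm A ^ n"
proof (induction n)
  case (Suc n)
  have "norm (A o\<^sub>L op_pow A n) \<le> norm A * norm (op_pow A n)" by (rule norm_blinfun_compose)
  also have "\<dots> \<le> norm A * norm A ^ n" by (intro mult_left_mono Suc) simp
  finally show ?case by (simp add: op_pow_Suc)
qed (simp add: norm_blinfun_id_le)

lemma op_pow_scaleR: "op_pow (s *\<^sub>R A) n = s ^ n *\<^sub>R op_pow A n"
  by (induction n) (simp_all add: op_pow_Suc comp_linear)

lemma op_pow_commute:
  assumes "B o\<^sub>L A = A o\<^sub>L B" shows "B o\<^sub>L op_pow A n = op_pow A n o\<^sub>L B"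
proof (induction n)
  case (Suc n)
  have "B o\<^sub>L (A o\<^sub>L op_pow A n) = A o\<^sub>L (B o\<^sub>L op_pow A n)"
    by (simp add: assms flip: comp_assoc)
  then show ?case by (simp add: op_pow_Suc Suc comp_assoc)
qed simp

lemma op_exp_summand_bound:
  "norm (op_pow A n /\<^sub>R fact n) \<le> norm A ^ n /\<^sub>R fact n"
  by (simp add: norm_op_pow divide_right_mono mult_left_mono)

lemma op_exp_sums: "(\<lambda>n. op_pow A n /\<^sub>R fact n) sums op_exp A"
  unfolding op_exp_def
  by (rule summable_sums, rule summable_comparison_test'[OF summable_exp_generic[of "norm A"], of 0])
    (rule op_exp_summand_bound)

lemma op_exp_0 [simp]: "op_exp (0 :: 'a::banach \<Rightarrow>\<^sub>L 'a) = id_blinfun"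
proof -
  have pos: "op_pow (0 :: 'a \<Rightarrow>\<^sub>L 'a) n = 0" if "n > 0" for n
    using that by (cases n) (simp_all add: op_pow_Suc)
  have "(\<lambda>n. op_pow (0 :: 'a \<Rightarrow>\<^sub>L 'a) n /\<^sub>R fact n) sums (\<Sum>n\<in>{0}. op_pow (0 :: 'a \<Rightarrow>\<^sub>L 'a) n /\<^sub>R fact n)"
    by (rule sums_finite) (simp_all add: pos)
  from sums_unique2[OF op_exp_sums this] show ?thesis by simp
qed

lemma op_exp_commute:
  assumes "B o\<^sub>L A = A o\<^sub>L B" shows "B o\<^sub>L op_exp A = op_exp A o\<^sub>L B"
proof (rule sums_unique2)
  show "(\<lambda>n. B o\<^sub>L (op_pow A n /\<^sub>R fact n)) sums (B o\<^sub>L op_exp A)"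
    by (intro bounded_linear.sums[OF bounded_bilinear.bounded_linear_right[OF bounded_bilinear_blinfun_compose]]
        op_exp_sums)
  have "(\<lambda>n. (op_pow A n /\<^sub>R fact n) o\<^sub>L B) sums (op_exp A o\<^sub>L B)"
    by (intro bounded_linear.sums[OF bounded_bilinear.bounded_linear_left[OF bounded_bilinear_blinfun_compose]]
        op_exp_sums)
  then show "(\<lambda>n. B o\<^sub>L (op_pow A n /\<^sub>R fact n)) sums (op_exp A o\<^sub>L B)"
    by (simp add: comp_linear op_pow_commute[OF assms])
qed

text \<open>The partial sums converge locally uniformly, and the derivative of one partial sum is \<open>A\<close> times the
  previous one.\<close>

lemma op_exp_scaleR_derivative:
  "((\<lambda>s. op_exp (s *\<^sub>R A)) has_vector_derivative (A o\<^sub>L op_exp (s *\<^sub>R A))) (at s)"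
proof -
  define c where "c n = op_pow A n /\<^sub>R fact n" for n
  define f where "f n s = (\<Sum>i<n. s ^ i *\<^sub>R c i)" for n and s :: real
  define f' where "f' n s h = (h *\<^sub>R (A o\<^sub>L f (n - 1) s))" for n and s h :: real
  define B where "B = \<bar>s\<bar> + 1"
  have sum_exp: "(\<Sum>i. s ^ i *\<^sub>R c i) = op_exp (s *\<^sub>R A)" for s
    unfolding op_exp_def c_def by (simp add: op_pow_scaleR mult.commute)
  have unif: "uniform_limit {-B..B} f (\<lambda>s. op_exp (s *\<^sub>R A)) sequentially"
    unfolding f_def sum_exp[symmetric]
  proof (rule Weierstrass_m_test)
    show "norm (x ^ n *\<^sub>R c n) \<le> (B * norm A) ^ n /\<^sub>R fact n" if "x \<in> {-B..B}" for n x
    proof -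
      have "norm (x ^ n *\<^sub>R c n) = \<bar>x\<bar> ^ n * norm (c n)" by (simp add: power_abs)
      also have "\<dots> \<le> B ^ n * (norm A ^ n /\<^sub>R fact n)"
        unfolding c_def using that by (intro mult_mono op_exp_summand_bound power_mono) (auto simp: B_def)
      finally show ?thesis by (simp add: power_mult_distrib mult_ac)
    qed
  qed (rule summable_exp_generic)
  have c_Suc: "real (Suc i) *\<^sub>R c (Suc i) = A o\<^sub>L c i" for i
  proof -
    have "real (Suc i) * inverse (fact (Suc i)) = inverse (fact i)"
      by (simp add: field_simps del: of_nat_Suc)
    then show ?thesis unfolding c_def op_pow_Suc comp_linear scaleR_scaleR by metis
  qed
  have deriv: "(f n has_derivative f' n x) (at x within {-B..B})" for n x
  proof -
    have "(f n has_derivative (\<lambda>h. \<Sum>i<n. (h * (real i * x ^ (i - 1))) *\<^sub>R c i)) (at x within {-B..B})"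
      unfolding f_def by (auto intro!: derivative_eq_intros simp: mult_ac)
    moreover have "(\<Sum>i<n. (h * (real i * x ^ (i - 1))) *\<^sub>R c i) = f' n x h" for h
    proof (cases n)
      case (Suc m)
      have "(h * (real (Suc i) * x ^ i)) *\<^sub>R c (Suc i) = h *\<^sub>R x ^ i *\<^sub>R (A o\<^sub>L c i)" for i
        unfolding c_Suc[symmetric] by (simp add: mult_ac del: of_nat_Suc)
      then show ?thesis
        by (simp add: f'_def f_def Suc sum.lessThan_Suc_shift comp_linear scaleR_sum_right
            bounded_bilinear.sum_right[OF bounded_bilinear_blinfun_compose] del: sum.lessThan_Suc of_nat_Suc)
    qed (simp add: f'_def f_def)
    ultimately show ?thesis by simp
  qed
  have "\<exists>g. \<forall>x\<in>{-B..B}. (\<lambda>n. f n x) \<longlonglongrightarrow> g x \<and>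
      (g has_derivative (\<lambda>h. h *\<^sub>R (A o\<^sub>L op_exp (x *\<^sub>R A)))) (at x within {-B..B})"
  proof (rule has_derivative_sequence[OF _ deriv])
    fix e :: real assume "e > 0"
    define d where "d = e / (norm A + 1)"
    have nA: "norm A + 1 > 0" by (rule add_nonneg_pos) auto
    have "d > 0" using \<open>e > 0\<close> nA by (simp add: d_def)
    have Ad: "norm A * d \<le> e"
      using \<open>e > 0\<close> nA by (simp add: d_def field_simps)
    have "\<forall>\<^sub>F n in sequentially. \<forall>x\<in>{-B..B}. dist (f n x) (op_exp (x *\<^sub>R A)) < d"
      using uniform_limitD[OF unif \<open>d > 0\<close>] .
    then have "\<forall>\<^sub>F n in sequentially. \<forall>x\<in>{-B..B}. dist (f (n - 1) x) (op_exp (x *\<^sub>R A)) < d"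
      by (subst eventually_sequentially_Suc[symmetric]) simp
    then show "\<forall>\<^sub>F n in sequentially. \<forall>x\<in>{-B..B}. \<forall>h.
        norm (f' n x h - h *\<^sub>R (A o\<^sub>L op_exp (x *\<^sub>R A))) \<le> e * norm h"
    proof (rule eventually_mono, intro ballI allI)
      fix n x h assume *: "\<forall>x\<in>{-B..B}. dist (f (n - 1) x) (op_exp (x *\<^sub>R A)) < d" and "x \<in> {-B..B}"
      have "f' n x h - h *\<^sub>R (A o\<^sub>L op_exp (x *\<^sub>R A)) = h *\<^sub>R (A o\<^sub>L (f (n - 1) x - op_exp (x *\<^sub>R A)))"
        by (simp add: f'_def comp_linear scaleR_diff_right)
      also have "norm \<dots> \<le> \<bar>h\<bar> * (norm A * d)"
        using * \<open>x \<in> {-B..B}\<close>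
        by (auto intro!: mult_left_mono order_trans[OF norm_blinfun_compose] simp: dist_norm less_imp_le)
      also have "\<dots> \<le> e * norm h" using mult_left_mono[OF Ad, of "\<bar>h\<bar>"] by (simp add: mult_ac)
      finally show "norm (f' n x h - h *\<^sub>R (A o\<^sub>L op_exp (x *\<^sub>R A))) \<le> e * norm h" .
    qed
  next
    show "(\<lambda>n. f n s) \<longlonglongrightarrow> op_exp (s *\<^sub>R A)"
      by (rule tendsto_uniform_limitI[OF unif]) (auto simp: B_def)
  qed (auto simp: B_def)
  then obtain g where g: "\<And>x. x \<in> {-B..B} \<Longrightarrow> (\<lambda>n. f n x) \<longlonglongrightarrow> g x"
    "\<And>x. x \<in> {-B..B} \<Longrightarrow> (g has_derivative (\<lambda>h. h *\<^sub>R (A o\<^sub>L op_exp (x *\<^sub>R A)))) (at x within {-B..B})"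
    by blast
  have "g x = op_exp (x *\<^sub>R A)" if "x \<in> {-B..B}" for x
    using g(1)[OF that] tendsto_uniform_limitI[OF unif that] LIMSEQ_unique by blast
  moreover have "s \<in> {-B<..<B}" by (auto simp: B_def)
  moreover have "(g has_vector_derivative (A o\<^sub>L op_exp (s *\<^sub>R A))) (at s)"
    using g(2)[of s] \<open>s \<in> {-B<..<B}\<close> at_within_interior[of s "{-B..B}"]
    by (simp add: has_vector_derivative_def interior_atLeastAtMost_real)
  ultimately show ?thesis
    using has_vector_derivative_transform_within_open[of g _ s "{-B<..<B}" "\<lambda>s. op_exp (s *\<^sub>R A)"]
    by auto
qed

lemmas comp_has_vector_derivative =
  bounded_bilinear.has_vector_derivative[OF bounded_bilinear_blinfun_compose]

text \<open>The product \<open>e\<^sup>s\<^sup>(\<^sup>X\<^sup>+\<^sup>Y\<^sup>) e\<^sup>-\<^sup>s\<^sup>Y e\<^sup>-\<^sup>s\<^sup>X\<close> has derivative zero in \<open>s\<close>, and so equals its value at \<open>0\<close>.\<close>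

lemma op_exp_add:
  assumes XY: "X o\<^sub>L Y = Y o\<^sub>L X"
  shows "op_exp (X + Y) = op_exp X o\<^sub>L op_exp Y"
proof -
  have deriv: "((\<lambda>s. op_exp (s *\<^sub>R Z)) has_vector_derivative (Z o\<^sub>L op_exp (s *\<^sub>R Z))) (at s within UNIV)"
    for Z :: "'a \<Rightarrow>\<^sub>L 'a" and s
    using op_exp_scaleR_derivative[of Z s] by simp
  have triple: "op_exp (X + Y) o\<^sub>L (op_exp (- Y) o\<^sub>L op_exp (- X)) = id_blinfun"
    if XY: "X o\<^sub>L Y = Y o\<^sub>L X" for X Y :: "'a \<Rightarrow>\<^sub>L 'a"
  proof -
    define P where "P s = op_exp (s *\<^sub>R (X + Y)) o\<^sub>L (op_exp (s *\<^sub>R - Y) o\<^sub>L op_exp (s *\<^sub>R - X))" for s :: real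
    have "(P has_vector_derivative 0) (at s within UNIV)" for s
    proof -
      let ?a = "op_exp (s *\<^sub>R (X + Y))" and ?b = "op_exp (s *\<^sub>R - Y)" and ?c = "op_exp (s *\<^sub>R - X)"
      have comm: "Z o\<^sub>L op_exp (s *\<^sub>R W) = op_exp (s *\<^sub>R W) o\<^sub>L Z" if "Z o\<^sub>L W = W o\<^sub>L Z" for Z W :: "'a \<Rightarrow>\<^sub>L 'a"
        using that by (intro op_exp_commute) (simp add: comp_linear)
      have 1: "(X + Y) o\<^sub>L ?a = ?a o\<^sub>L (X + Y)"
        by (rule comm) simp
      have "X o\<^sub>L ?b = ?b o\<^sub>L X" by (rule comm) (simp add: comp_linear XY)
      then have 2: "?b o\<^sub>L (X o\<^sub>L ?c) = X o\<^sub>L (?b o\<^sub>L ?c)" by (simp flip: comp_assoc)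
      have 3: "(?a o\<^sub>L ((?b o\<^sub>L (- X o\<^sub>L ?c)) + ((- Y o\<^sub>L ?b) o\<^sub>L ?c))) + (((X + Y) o\<^sub>L ?a) o\<^sub>L (?b o\<^sub>L ?c)) = 0"
        unfolding 1 unfolding comp_assoc comp_linear 2 by simp
      show ?thesis
        unfolding P_def[abs_def]
        by (rule has_vector_derivative_eq_rhs[OF comp_has_vector_derivative[OF deriv
              comp_has_vector_derivative[OF deriv deriv]] 3])
    qed
    then obtain k where "\<And>s. P s = k"
      using has_vector_derivative_zero_constant[of UNIV P] by auto
    then have "P 1 = P 0" by simp
    then show ?thesis by (simp add: P_def)
  qed
  have inv: "op_exp (- Z) o\<^sub>L op_exp Z = id_blinfun" for Z :: "'a \<Rightarrow>\<^sub>L 'a"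
    using triple[of "- Z" 0] by simp
  have "op_exp (X + Y) = op_exp (X + Y) o\<^sub>L (op_exp (- Y) o\<^sub>L (op_exp (- X) o\<^sub>L op_exp X) o\<^sub>L op_exp Y)"
    by (simp add: inv comp_assoc)
  also have "\<dots> = (op_exp (X + Y) o\<^sub>L (op_exp (- Y) o\<^sub>L op_exp (- X))) o\<^sub>L (op_exp X o\<^sub>L op_exp Y)"
    by (simp only: comp_assoc)
  also have "\<dots> = op_exp X o\<^sub>L op_exp Y" by (simp add: triple[OF XY])
  finally show ?thesis .
qed

lemma op_exp_derivative:
  assumes "M o\<^sub>L Z = Z o\<^sub>L M"
  shows "((\<lambda>s. op_exp (Z + s *\<^sub>R M)) has_vector_derivative (M o\<^sub>L op_exp (Z + s *\<^sub>R M))) (at s)"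
proof -
  have eq: "op_exp (Z + r *\<^sub>R M) = op_exp (r *\<^sub>R M) o\<^sub>L op_exp Z" for r
    unfolding add.commute[of Z] by (rule op_exp_add) (simp add: comp_linear assms)
  have "((\<lambda>s. op_exp (s *\<^sub>R M) o\<^sub>L op_exp Z) has_vector_derivative ((M o\<^sub>L op_exp (s *\<^sub>R M)) o\<^sub>L op_exp Z)) (at s)"
    using comp_has_vector_derivative[OF op_exp_scaleR_derivative[of M s] has_vector_derivative_const[of "op_exp Z"]]
    by simp
  then show ?thesis unfolding eq by (simp add: comp_assoc)
qed

section \<open>Complex-linear operators\<close>

lemma clinear_id: "clinear_op id_blinfun"
  by (simp add: clinear_op_def)

lemma clinear_comp: "clinear_op S \<Longrightarrow> clinear_op T \<Longrightarrow> clinear_op (S o\<^sub>L T)"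
  by (simp add: clinear_op_def)

lemma clinear_add: "clinear_op S \<Longrightarrow> clinear_op T \<Longrightarrow> clinear_op (S + T)"
  by (simp add: clinear_op_def blinfun.add_left scaleC_add_right)

lemma clinear_diff: "clinear_op S \<Longrightarrow> clinear_op T \<Longrightarrow> clinear_op (S - T)"
  by (simp add: clinear_op_def blinfun.diff_left scaleC_diff_right)

lemma clinear_scaleC: "clinear_op T \<Longrightarrow> clinear_op (c *\<^sub>C T)"
  by (simp add: clinear_op_def scaleC_blinfun.rep_eq scaleC_scaleC mult.commute)

lemma clinear_scaleR: "clinear_op T \<Longrightarrow> clinear_op (r *\<^sub>R T)"
  by (simp add: scaleR_scaleC clinear_scaleC)

lemma clinear_op_pow: "clinear_op T \<Longrightarrow> clinear_op (op_pow T n)"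
  by (induction n) (simp_all add: op_pow_Suc clinear_comp clinear_id)

lemma clinear_limit:
  assumes "\<And>n. clinear_op (f n)" "f \<longlonglongrightarrow> T" shows "clinear_op T"
  unfolding clinear_op_def
proof (intro allI)
  fix c x
  have "(\<lambda>n. f n (c *\<^sub>C x)) \<longlonglongrightarrow> T (c *\<^sub>C x)"
    by (intro tendsto_intros assms)
  moreover have "(\<lambda>n. c *\<^sub>C f n x) \<longlonglongrightarrow> c *\<^sub>C T x"
    by (intro tendsto_scaleC tendsto_intros assms)
  ultimately show "T (c *\<^sub>C x) = c *\<^sub>C T x"
    using assms(1) LIMSEQ_unique by (simp add: clinear_opD)
qed

lemma clinear_op_exp: "clinear_op T \<Longrightarrow> clinear_op (op_exp T)"
proof (rule clinear_limit)
  assume T: "clinear_op T"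
  show "clinear_op (\<Sum>i<n. op_pow T i /\<^sub>R fact i)" for n
    by (induction n) (simp_all add: T clinear_add clinear_scaleR clinear_op_pow,
      simp add: clinear_op_def)
  show "(\<lambda>n. \<Sum>i<n. op_pow T i /\<^sub>R fact i) \<longlonglongrightarrow> op_exp T"
    using op_exp_sums[of T] by (simp add: sums_def)
qed

lemma cinner_op_exp:
  fixes T :: "'h::{complex_hilbert, second_countable_topology} \<Rightarrow>\<^sub>L 'h"
  assumes T: "clinear_op T"
  shows "cinner (op_exp T x) y = cinner x (op_exp (cadj T) y)"
proof (rule sums_unique2)
  have pow: "cinner (op_pow T n x) y = cinner x (op_pow (cadj T) n y)" for n
  proof (induction n arbitrary: x y)
    case (Suc n)
    have "cinner (T (op_pow T n x)) y = cinner x (op_pow (cadj T) n (cadj T y))"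
      by (simp add: cinner_cadj[OF T] Suc)
    also have "op_pow (cadj T) n (cadj T y) = (op_pow (cadj T) n o\<^sub>L cadj T) y" by simp
    also have "op_pow (cadj T) n o\<^sub>L cadj T = cadj T o\<^sub>L op_pow (cadj T) n"
      by (rule op_pow_commute[symmetric]) simp
    finally show ?case by (simp add: op_pow_Suc)
  qed simp
  have app: "(\<lambda>n. (op_pow A n /\<^sub>R fact n) z) sums (op_exp A z)" for A :: "'h \<Rightarrow>\<^sub>L 'h" and z
    by (rule bounded_linear.sums[OF blinfun.bounded_linear_left op_exp_sums])
  show "(\<lambda>n. cinner ((op_pow T n /\<^sub>R fact n) x) y) sums cinner (op_exp T x) y"
    by (rule bounded_linear.sums[OF bounded_linear_cinner_left app])
  have "(\<lambda>n. cinner x ((op_pow (cadj T) n /\<^sub>R fact n) y)) sums cinner x (op_exp (cadj T) y)"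
    by (rule bounded_linear.sums[OF bounded_linear_cinner_right app])
  then show "(\<lambda>n. cinner ((op_pow T n /\<^sub>R fact n) x) y) sums cinner x (op_exp (cadj T) y)"
    by (simp add: blinfun.scaleR_left cinner_scaleR_left cinner_scaleR_right pow)
qed

section \<open>Square-integrable functions\<close>

lemma L2D:
  assumes "f \<in> L2 M" shows "f \<in> borel_measurable M" "integrable M (\<lambda>s. (norm (f s))\<^sup>2)"
  using assms by (auto simp: L2_def)

lemma squeeze_zero:
  fixes f g :: "nat \<Rightarrow> real"
  assumes "\<And>n. f n \<le> g n" "\<And>n. 0 \<le> f n" "g \<longlonglongrightarrow> 0"
  shows "f \<longlonglongrightarrow> 0"
  by (rule tendsto_sandwich[OF always_eventually always_eventually tendsto_const assms(3)])
    (use assms in auto)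

lemma norm_add_square_le: "(norm (x + y))\<^sup>2 \<le> 2 * (norm x)\<^sup>2 + 2 * (norm (y::'a::real_normed_vector))\<^sup>2"
proof -
  have "(norm (x + y))\<^sup>2 \<le> (norm x + norm y)\<^sup>2"
    by (intro power_mono norm_triangle_ineq) simp
  also have "\<dots> \<le> 2 * (norm x)\<^sup>2 + 2 * (norm y)\<^sup>2"
    using zero_le_power2[of "norm x - norm y"] by (simp add: power2_sum power2_diff)
  finally show ?thesis .
qed

lemma L2_add:
  fixes f g :: "'s \<Rightarrow> complex"
  assumes "f \<in> L2 M" "g \<in> L2 M" shows "(\<lambda>s. f s + g s) \<in> L2 M"
proof -
  note [measurable] = L2D(1)[OF assms(1)] L2D(1)[OF assms(2)]
  have "integrable M (\<lambda>s. (norm (f s + g s))\<^sup>2)"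
    by (rule Bochner_Integration.integrable_bound[where f = "\<lambda>s. 2 * (norm (f s))\<^sup>2 + 2 * (norm (g s))\<^sup>2"])
      (auto intro!: Bochner_Integration.integrable_add integrable_mult_right L2D(2) assms norm_add_square_le)
  then show ?thesis by (simp add: L2_def)
qed

lemma L2_mult:
  fixes f :: "'s \<Rightarrow> complex"
  assumes "f \<in> L2 M" shows "(\<lambda>s. c * f s) \<in> L2 M"
proof -
  note [measurable] = L2D(1)[OF assms(1)]
  show ?thesis using L2D(2)[OF assms] by (simp add: L2_def norm_mult power_mult_distrib)
qed

lemma borel_measurable_cnj' [measurable (raw)]:
  "f \<in> borel_measurable M \<Longrightarrow> (\<lambda>s. cnj (f s)) \<in> borel_measurable M"
  by (rule measurable_compose[of f M borel cnj])
    (auto intro!: borel_measurable_continuous_onI continuous_intros)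

lemma L2_cnj: "f \<in> L2 M \<Longrightarrow> (\<lambda>s. cnj (f s)) \<in> L2 M"
  by (simp add: L2_def borel_measurable_cnj')

lemma L2_zero: "(\<lambda>s. 0::complex) \<in> L2 M"
  by (simp add: L2_def)

lemma L2_sum:
  fixes f :: "'i \<Rightarrow> 's \<Rightarrow> complex"
  assumes "\<And>i. i \<in> F \<Longrightarrow> f i \<in> L2 M" shows "(\<lambda>s. \<Sum>i\<in>F. f i s) \<in> L2 M"
  using assms by (induction F rule: infinite_finite_induct) (auto simp: L2_zero L2_add)

lemma L2_diff:
  fixes f g :: "'s \<Rightarrow> complex"
  assumes "f \<in> L2 M" "g \<in> L2 M" shows "(\<lambda>s. f s - g s) \<in> L2 M"
  using L2_add[OF assms(1) L2_mult[OF assms(2), of "- 1"]] by simp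

lemma L2_integrable_mult:
  fixes f g :: "'s \<Rightarrow> complex"
  assumes "f \<in> L2 M" "g \<in> L2 M" shows "integrable M (\<lambda>s. f s * cnj (g s))"
proof -
  note [measurable] = L2D(1)[OF assms(1)] L2D(1)[OF assms(2)]
  have bound: "norm (f s * cnj (g s)) \<le> norm ((norm (f s))\<^sup>2 + (norm (g s))\<^sup>2)" for s
  proof -
    have "norm (f s) * norm (g s) \<le> (norm (f s))\<^sup>2 + (norm (g s))\<^sup>2"
      using zero_le_power2[of "norm (f s) - norm (g s)"] zero_le_power2[of "norm (f s)"]
        zero_le_power2[of "norm (g s)"] unfolding power2_diff by linarith
    then show ?thesis by (simp add: norm_mult)
  qed
  show ?thesis
    by (rule Bochner_Integration.integrable_bound[where f = "\<lambda>s. (norm (f s))\<^sup>2 + (norm (g s))\<^sup>2"])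
      (use bound in \<open>auto intro!: Bochner_Integration.integrable_add L2D(2) assms\<close>)
qed

lemma L2_inner_self: "L2_inner M f f = of_real (LINT s|M. (cmod (f s))\<^sup>2)"
  for f :: "'s \<Rightarrow> complex"
  unfolding L2_inner_def cinner_complex_def mult_cnj_cmod by (rule integral_complex_of_real)

lemma L2_inner_commute: "L2_inner M g f = cnj (L2_inner M f g)"
  for f g :: "'s \<Rightarrow> complex"
proof -
  have "cnj (L2_inner M f g) = (LINT s|M. cnj (f s * cnj (g s)))"
    unfolding L2_inner_def cinner_complex_def by (rule Bochner_Integration.integral_cnj[symmetric])
  then show ?thesis unfolding L2_inner_def cinner_complex_def by (simp add: mult.commute)
qed

lemma L2_inner_sum_left:
  fixes f :: "'i \<Rightarrow> 's \<Rightarrow> complex"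
  assumes "\<And>i. i \<in> F \<Longrightarrow> f i \<in> L2 M" "g \<in> L2 M"
  shows "L2_inner M (\<lambda>s. \<Sum>i\<in>F. a i * f i s) g = (\<Sum>i\<in>F. a i * L2_inner M (f i) g)"
proof -
  have "L2_inner M (\<lambda>s. \<Sum>i\<in>F. a i * f i s) g = (LINT s|M. (\<Sum>i\<in>F. a i * (f i s * cnj (g s))))"
    unfolding L2_inner_def cinner_complex_def by (simp add: sum_distrib_right mult.assoc)
  also have "\<dots> = (\<Sum>i\<in>F. (LINT s|M. a i * (f i s * cnj (g s))))"
    by (rule Bochner_Integration.integral_sum) (auto intro!: integrable_mult_right L2_integrable_mult assms)
  finally show ?thesis by (simp add: L2_inner_def cinner_complex_def)
qed

lemma L2_inner_diff_left:
  fixes f g h :: "'s \<Rightarrow> complex"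
  assumes "f \<in> L2 M" "g \<in> L2 M" "h \<in> L2 M"
  shows "L2_inner M (\<lambda>s. f s - g s) h = L2_inner M f h - L2_inner M g h"
  unfolding L2_inner_def cinner_complex_def
  by (simp add: left_diff_distrib Bochner_Integration.integral_diff L2_integrable_mult assms)

lemma L2_norm_minus_projection:
  fixes f :: "'s \<Rightarrow> complex"
  assumes f: "f \<in> L2 M" and F: "finite F" "F \<subseteq> L2 M"
    and on: "\<And>e e'. e \<in> F \<Longrightarrow> e' \<in> F \<Longrightarrow> L2_inner M e e' = (if e = e' then 1 else 0)"
  shows "(LINT s|M. (cmod (f s - (\<Sum>e\<in>F. L2_inner M f e * e s)))\<^sup>2)
    = (LINT s|M. (cmod (f s))\<^sup>2) - (\<Sum>e\<in>F. (cmod (L2_inner M f e))\<^sup>2)"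
proof -
  define y where "y s = (\<Sum>e\<in>F. L2_inner M f e * e s)" for s
  have y: "y \<in> L2 M" unfolding y_def[abs_def] using F(2) by (intro L2_sum L2_mult) auto
  have ye: "L2_inner M y e = L2_inner M f e" if "e \<in> F" for e
  proof -
    have "L2_inner M y e = (\<Sum>e'\<in>F. L2_inner M f e' * L2_inner M e' e)"
      unfolding y_def[abs_def] using F(2) that by (intro L2_inner_sum_left) auto
    also have "\<dots> = (\<Sum>e'\<in>F. if e' = e then L2_inner M f e' else 0)"
      using that by (intro sum.cong) (auto simp: on)
    finally show ?thesis using that F(1) by simp
  qed
  have yg: "L2_inner M y g = (\<Sum>e\<in>F. L2_inner M f e * L2_inner M e g)" if "g \<in> L2 M" for g
    unfolding y_def[abs_def] using F(2) that by (intro L2_inner_sum_left) auto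
  let ?S = "\<Sum>e\<in>F. complex_of_real ((cmod (L2_inner M f e))\<^sup>2)"
  have yf: "L2_inner M y f = ?S"
    by (subst yg[OF f]) (rule sum.cong[OF refl], subst L2_inner_commute[of M _ f], rule mult_cnj_cmod)
  then have fy: "L2_inner M f y = ?S" by (subst L2_inner_commute) simp
  have yy: "L2_inner M y y = ?S"
  proof -
    have "L2_inner M e y = cnj (L2_inner M f e)" if "e \<in> F" for e
      using ye[OF that] L2_inner_commute by metis
    then have "(\<Sum>e\<in>F. L2_inner M f e * L2_inner M e y) = (\<Sum>e\<in>F. L2_inner M f e * cnj (L2_inner M f e))"
      by (intro sum.cong) auto
    then show ?thesis unfolding yg[OF y] mult_cnj_cmod .
  qed
  have "complex_of_real (LINT s|M. (cmod (f s - y s))\<^sup>2) = L2_inner M f (\<lambda>s. f s - y s) - L2_inner M y (\<lambda>s. f s - y s)"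
    unfolding L2_inner_self[symmetric] by (intro L2_inner_diff_left f y L2_diff)
  also have "\<dots> = cnj (L2_inner M f f - L2_inner M y f) - cnj (L2_inner M f y - L2_inner M y y)"
    by (simp only: L2_inner_commute[of M _ "\<lambda>s. f s - y s"] L2_inner_diff_left f y)
  also have "\<dots> = complex_of_real ((LINT s|M. (cmod (f s))\<^sup>2) - (\<Sum>e\<in>F. (cmod (L2_inner M f e))\<^sup>2))"
    unfolding yf fy yy unfolding L2_inner_self by simp
  finally show ?thesis unfolding y_def of_real_eq_iff .
qed

text \<open>A sequence whose consecutive distances decay fast enough converges pointwise almost everywhere,
  since the weighted series of the squared differences has a finite integral.\<close>

lemma L2_fast_Cauchy_converges:
  fixes f :: "nat \<Rightarrow> 's \<Rightarrow> complex"
  assumes f: "\<And>n. f n \<in> L2 M"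
    and fast: "\<And>n. (LINT s|M. (cmod (f (Suc n) s - f n s))\<^sup>2) \<le> 1 / 8 ^ n"
  shows "\<exists>g\<in>L2 M. (\<lambda>n. LINT s|M. (cmod (f n s - g s))\<^sup>2) \<longlonglongrightarrow> 0"
proof -
  note [measurable] = L2D(1)[OF f]
  \<comment> \<open>The weights \<open>4 ^ n\<close> leave a convergent series of integrals, of terms \<open>4 ^ n / 8 ^ n\<close>, and at the same
    time bound the pointwise differences by the terms of a geometric series.\<close>
  define q where "q n s = 4 ^ n * (cmod (f (Suc n) s - f n s))\<^sup>2" for n s
  define H where "H s = (\<Sum>n. q n s)" for s
  define g where "g s = lim (\<lambda>n. f n s)" for s
  have q_nonneg: "q n s \<ge> 0" for n s by (simp add: q_def)
  have q_int: "integrable M (q n)" for n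
    unfolding q_def[abs_def] by (intro integrable_mult_right L2D(2)[OF L2_diff] f)
  have [measurable]: "q n \<in> borel_measurable M" for n unfolding q_def[abs_def] by measurable
  have [measurable]: "H \<in> borel_measurable M" unfolding H_def[abs_def] by measurable
  have [measurable]: "g \<in> borel_measurable M" unfolding g_def[abs_def] by measurable
  have geo: "(\<lambda>n. (1/2::real) ^ n) sums 2" using geometric_sums[of "1/2::real"] by simp
  have nn: "(\<integral>\<^sup>+s. (\<Sum>n. ennreal (q n s)) \<partial>M) \<le> 2"
  proof -
    have "(\<integral>\<^sup>+s. (\<Sum>n. ennreal (q n s)) \<partial>M) = (\<Sum>n. \<integral>\<^sup>+s. ennreal (q n s) \<partial>M)"
      by (rule nn_integral_suminf) measurable
    also have "\<dots> \<le> (\<Sum>n. ennreal ((1/2) ^ n))"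
    proof (rule suminf_le)
      fix n
      have "(\<integral>\<^sup>+s. ennreal (q n s) \<partial>M) = ennreal (LINT s|M. q n s)"
        by (rule nn_integral_eq_integral[OF q_int]) (simp add: q_nonneg)
      also have "(LINT s|M. q n s) \<le> 4 ^ n * (1 / 8 ^ n)"
        unfolding q_def using mult_left_mono[OF fast[of n], of "4 ^ n"] by simp
      also have "4 ^ n * (1 / 8 ^ n) = (1/2::real) ^ n"
        by (simp add: power_divide[symmetric] flip: power_mult_distrib)
      finally show "(\<integral>\<^sup>+s. ennreal (q n s) \<partial>M) \<le> ennreal ((1/2) ^ n)"
        by (simp add: ennreal_leI)
    qed auto
    also have "\<dots> = ennreal 2" by (rule suminf_ennreal_eq[OF _ geo]) simp
    finally show ?thesis by simp
  qed
  then have "(\<integral>\<^sup>+s. (\<Sum>n. ennreal (q n s)) \<partial>M) < \<infinity>"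
    by (rule le_less_trans) simp
  then have "(\<integral>\<^sup>+s. (\<Sum>n. ennreal (q n s)) \<partial>M) \<noteq> \<infinity>" by simp
  then have "AE s in M. (\<Sum>n. ennreal (q n s)) \<noteq> \<infinity>"
    by (intro nn_integral_noteq_infinite) measurable
  then have summable: "AE s in M. summable (\<lambda>n. q n s)"
    by eventually_elim (auto intro!: summable_suminf_not_top q_nonneg)
  have H_int: "integrable M H"
  proof (rule integrableI_nonneg)
    show "AE s in M. 0 \<le> H s"
      using summable by eventually_elim (auto simp: H_def intro!: suminf_nonneg q_nonneg)
    have "(\<integral>\<^sup>+s. ennreal (H s) \<partial>M) = (\<integral>\<^sup>+s. (\<Sum>n. ennreal (q n s)) \<partial>M)"
      using summable unfolding H_def
      by (intro nn_integral_cong_AE) (auto elim!: eventually_mono simp: suminf_ennreal2[OF q_nonneg])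
    then show "(\<integral>\<^sup>+s. ennreal (H s) \<partial>M) < \<infinity>"
      using nn by (simp add: order_le_less_trans)
  qed simp
  have close: "AE s in M. \<forall>n. (cmod (f n s - g s))\<^sup>2 \<le> 4 * H s / 4 ^ n"
    using summable
  proof eventually_elim
    fix s assume sq: "summable (\<lambda>n. q n s)"
    have qH: "q n s \<le> H s" for n
      unfolding H_def using sum_le_suminf[OF sq, of "{n}"] q_nonneg by auto
    have H0: "H s \<ge> 0" using qH[of 0] q_nonneg[of 0 s] by linarith
    define c where "c = sqrt (H s)"
    have c0: "c \<ge> 0" and cc: "c\<^sup>2 = H s" using H0 by (auto simp: c_def)
    have step: "cmod (f (Suc n) s - f n s) \<le> c / 2 ^ n" for n
    proof (rule power2_le_imp_le)
      have "(cmod (f (Suc n) s - f n s))\<^sup>2 \<le> H s / 4 ^ n"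
        using qH[of n] by (simp add: q_def field_simps)
      also have "\<dots> = (c / 2 ^ n)\<^sup>2"
        by (simp add: power_divide cc power_mult[symmetric] mult.commute[of n 2] power_mult)
      finally show "(cmod (f (Suc n) s - f n s))\<^sup>2 \<le> (c / 2 ^ n)\<^sup>2" .
    qed (use c0 in simp)
    have far: "cmod (f m s - f n s) \<le> 2 * c * (1 / 2 ^ n - 1 / 2 ^ m)" if "m \<ge> n" for m n
      using that
    proof (induction m rule: dec_induct)
      case (step m)
      have "cmod (f (Suc m) s - f n s) \<le> cmod (f (Suc m) s - f m s) + cmod (f m s - f n s)"
        by (rule norm_diff_triangle_ineq[of _ "f m s", simplified] order_trans[OF _ norm_triangle_ineq]) simp
      also have "\<dots> \<le> c / 2 ^ m + 2 * c * (1 / 2 ^ n - 1 / 2 ^ m)"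
        by (intro add_mono \<open>\<And>n. cmod (f (Suc n) s - f n s) \<le> c / 2 ^ n\<close> step.IH)
      also have "\<dots> = 2 * c * (1 / 2 ^ n - 1 / 2 ^ Suc m)" by (simp add: field_simps)
      finally show ?case .
    qed simp
    have far': "cmod (f m s - f n s) \<le> 2 * c / 2 ^ n" if "m \<ge> n" for m n
    proof -
      have "2 * c * (1 / 2 ^ n - 1 / 2 ^ m) \<le> 2 * c * (1 / 2 ^ n)"
        using c0 by (intro mult_left_mono) auto
      then show ?thesis using far[OF that] by simp
    qed
    have lim0: "(\<lambda>n. 2 * c / 2 ^ n) \<longlonglongrightarrow> 0"
      by (rule LIMSEQ_divide_realpow_zero) simp
    have "Cauchy (\<lambda>n. f n s)"
    proof (rule metric_CauchyI)
      fix e :: real assume "e > 0"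
      then have "\<forall>\<^sub>F n in sequentially. 2 * c / 2 ^ n < e / 2"
        using order_tendstoD(2)[OF lim0, of "e / 2"] by simp
      then obtain N where N: "2 * c / 2 ^ N < e / 2" by (auto simp: eventually_sequentially)
      have "dist (f m s) (f n s) < e" if "m \<ge> N" "n \<ge> N" for m n
      proof -
        have "dist (f m s) (f n s) \<le> dist (f m s) (f N s) + dist (f n s) (f N s)" by (rule dist_triangle2)
        also have "\<dots> < e" using far'[OF that(1)] far'[OF that(2)] N by (simp add: dist_norm)
        finally show ?thesis .
      qed
      then show "\<exists>M. \<forall>m\<ge>M. \<forall>n\<ge>M. dist (f m s) (f n s) < e" by blast
    qed
    then have lim: "(\<lambda>n. f n s) \<longlonglongrightarrow> g s"
      unfolding g_def using Cauchy_convergent_iff convergent_LIMSEQ_iff by blast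
    show "\<forall>n. (cmod (f n s - g s))\<^sup>2 \<le> 4 * H s / 4 ^ n"
    proof
      fix n
      have "cmod (g s - f n s) \<le> 2 * c / 2 ^ n"
        by (rule LIMSEQ_le_const2[OF tendsto_norm[OF tendsto_diff[OF lim tendsto_const]]])
          (use far' in blast)
      then have "(cmod (f n s - g s))\<^sup>2 \<le> (2 * c / 2 ^ n)\<^sup>2"
        by (intro power_mono) (auto simp: norm_minus_commute)
      also have "\<dots> = 4 * H s / 4 ^ n"
        by (simp add: power_divide power_mult_distrib cc power_mult[symmetric] mult.commute[of n 2] power_mult)
      finally show "(cmod (f n s - g s))\<^sup>2 \<le> 4 * H s / 4 ^ n" .
    qed
  qed
  have diff_int: "integrable M (\<lambda>s. (cmod (f n s - g s))\<^sup>2)" for n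
  proof (rule Bochner_Integration.integrable_bound[where f = "\<lambda>s. 4 * H s / 4 ^ n"])
    show "AE s in M. norm ((cmod (f n s - g s))\<^sup>2) \<le> norm (4 * H s / 4 ^ n)"
      using close by eventually_elim (metis abs_of_nonneg order_trans real_norm_def zero_le_power2 abs_ge_self)
  qed (use H_int in auto)
  have "(\<lambda>s. f 0 s - (f 0 s - g s)) \<in> L2 M"
    by (rule L2_diff) (use f diff_int[of 0] in \<open>auto simp: L2_def\<close>)
  then have "g \<in> L2 M" by simp
  moreover have "(\<lambda>n. LINT s|M. (cmod (f n s - g s))\<^sup>2) \<longlonglongrightarrow> 0"
  proof (rule tendsto_sandwich)
    show "\<forall>\<^sub>F n in sequentially. 0 \<le> (LINT s|M. (cmod (f n s - g s))\<^sup>2)" by simp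
    show "\<forall>\<^sub>F n in sequentially. (LINT s|M. (cmod (f n s - g s))\<^sup>2) \<le> 4 * (LINT s|M. H s) / 4 ^ n"
    proof (rule always_eventually, rule allI)
      fix n
      have "(LINT s|M. (cmod (f n s - g s))\<^sup>2) \<le> (LINT s|M. 4 * H s / 4 ^ n)"
        by (rule integral_mono_AE[OF diff_int]) (use H_int close in auto)
      then show "(LINT s|M. (cmod (f n s - g s))\<^sup>2) \<le> 4 * (LINT s|M. H s) / 4 ^ n" by simp
    qed
    show "(\<lambda>n. 4 * (LINT s|M. H s) / 4 ^ n) \<longlonglongrightarrow> 0"
      by (rule LIMSEQ_divide_realpow_zero) simp
  qed simp
  ultimately show ?thesis by blast
qed

text \<open>The partial Fourier sums along finite sets that nearly exhaust the Bessel sum converge, and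
  totality of the basis identifies the limit.\<close>

lemma L2_Parseval_approx:
  fixes g :: "'s \<Rightarrow> complex"
  assumes B: "L2_orthonormal_basis M B" and g: "g \<in> L2 M" and "\<epsilon> > 0"
  shows "\<exists>F. finite F \<and> F \<subseteq> B \<and> (LINT s|M. (cmod (g s))\<^sup>2) \<le> (\<Sum>e\<in>F. (cmod (L2_inner M g e))\<^sup>2) + \<epsilon>"
proof -
  let ?I = "LINT s|M. (cmod (g s))\<^sup>2"
  have BL2: "B \<subseteq> L2 M" and on: "\<And>e e'. e \<in> B \<Longrightarrow> e' \<in> B \<Longrightarrow> L2_inner M e e' = (if e = e' then 1 else 0)"
    and total: "\<And>f. f \<in> L2 M \<Longrightarrow> (\<And>e. e \<in> B \<Longrightarrow> L2_inner M f e = 0) \<Longrightarrow> AE s in M. f s = 0"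
    using B by (auto simp: L2_orthonormal_basis_def)
  define S where "S F = (\<Sum>e\<in>F. (cmod (L2_inner M g e))\<^sup>2)" for F
  define proj where "proj F s = (\<Sum>e\<in>F. L2_inner M g e * e s)" for F :: "('s \<Rightarrow> complex) set" and s
  define Fs where "Fs = {F. finite F \<and> F \<subseteq> B}"
  have Fs_L2: "finite F" "F \<subseteq> L2 M" "F \<subseteq> B" if "F \<in> Fs" for F
    using that BL2 by (auto simp: Fs_def)
  have minus_proj: "(LINT s|M. (cmod (f s - (\<Sum>e\<in>F. L2_inner M f e * e s)))\<^sup>2)
      = (LINT s|M. (cmod (f s))\<^sup>2) - (\<Sum>e\<in>F. (cmod (L2_inner M f e))\<^sup>2)"
    if "F \<in> Fs" "f \<in> L2 M" for f F
    by (rule L2_norm_minus_projection[OF that(2) Fs_L2(1)[OF that(1)] Fs_L2(2)[OF that(1)] on])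
      (use Fs_L2(3)[OF that(1)] in auto)
  have Bessel: "(\<Sum>e\<in>F. (cmod (L2_inner M f e))\<^sup>2) \<le> (LINT s|M. (cmod (f s))\<^sup>2)" if "F \<in> Fs" "f \<in> L2 M" for f F
  proof -
    have "0 \<le> (LINT s|M. (cmod (f s - (\<Sum>e\<in>F. L2_inner M f e * e s)))\<^sup>2)" by simp
    then show ?thesis unfolding minus_proj[OF that] by simp
  qed
  have proj_L2: "proj F \<in> L2 M" if "F \<in> Fs" for F
    unfolding proj_def[abs_def] using Fs_L2[OF that] by (intro L2_sum L2_mult) auto
  have inner_proj: "L2_inner M (proj F) e = (if e \<in> F then L2_inner M g e else 0)" if "F \<in> Fs" "e \<in> B" for F e
  proof -
    have "L2_inner M (proj F) e = (\<Sum>e'\<in>F. L2_inner M g e' * L2_inner M e' e)"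
      unfolding proj_def[abs_def] using Fs_L2[OF that(1)] that BL2 by (intro L2_inner_sum_left) auto
    also have "\<dots> = (\<Sum>e'\<in>F. if e' = e then L2_inner M g e' else 0)"
      using that Fs_L2[OF that(1)] by (intro sum.cong) (auto simp: on)
    finally show ?thesis using Fs_L2[OF that(1)] by simp
  qed
  have S_le: "S F \<le> ?I" if "F \<in> Fs" for F unfolding S_def by (rule Bessel[OF that g])
  have ne: "{} \<in> Fs" by (simp add: Fs_def)
  define s where "s = (SUP F\<in>Fs. S F)"
  have bdd: "bdd_above (S ` Fs)" using S_le by (auto intro!: bdd_aboveI)
  have S_sup: "S F \<le> s" if "F \<in> Fs" for F unfolding s_def by (rule cSUP_upper[OF that bdd])
  have "\<exists>F\<in>Fs. s - 1 / 8 ^ n < S F" for n :: nat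
    using less_cSUP_iff[OF _ bdd, of "s - 1 / 8 ^ n"] ne unfolding s_def[symmetric] by auto
  then obtain A where A: "\<And>n. A n \<in> Fs" "\<And>n. s - 1 / 8 ^ n < S (A n)" by metis
  define F where "F n = (\<Union>k\<le>n. A k)" for n
  have F: "F n \<in> Fs" for n using A(1) by (auto simp: F_def Fs_def)
  have S_mono: "S X \<le> S Y" if "X \<subseteq> Y" "Y \<in> Fs" for X Y
    unfolding S_def using that by (intro sum_mono2) (auto simp: Fs_def)
  have SF: "s - S (F n) \<le> 1 / 8 ^ n" for n
  proof -
    have "A n \<subseteq> F n" by (auto simp: F_def)
    from S_mono[OF this F] show ?thesis using A(2)[of n] by linarith
  qed
  have "\<exists>p\<in>L2 M. (\<lambda>n. LINT s|M. (cmod (proj (F n) s - p s))\<^sup>2) \<longlonglongrightarrow> 0"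
  proof (rule L2_fast_Cauchy_converges)
    fix n
    let ?D = "F (Suc n) - F n"
    have D: "?D \<in> Fs" using F[of "Suc n"] by (auto simp: Fs_def)
    have sub: "F n \<subseteq> F (Suc n)" by (auto simp: F_def le_Suc_eq)
    have "proj (F (Suc n)) x - proj (F n) x = proj ?D x" for x
      unfolding proj_def by (rule sum_diff[OF Fs_L2(1)[OF F] sub, symmetric])
    moreover have "(LINT s|M. (cmod (proj ?D s))\<^sup>2) = S ?D"
    proof -
      have eq: "L2_inner M (proj ?D) e = L2_inner M g e" if "e \<in> ?D" for e
        using inner_proj[OF D] that F[of "Suc n"] by (auto simp: Fs_def)
      have "(LINT s|M. (cmod (proj ?D s - (\<Sum>e\<in>?D. L2_inner M (proj ?D) e * e s)))\<^sup>2) = 0"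
        by (simp add: eq proj_def)
      then show ?thesis unfolding minus_proj[OF D proj_L2[OF D]] by (simp add: eq S_def)
    qed
    moreover have "S ?D = S (F (Suc n)) - S (F n)"
      unfolding S_def by (rule sum_diff[OF Fs_L2(1)[OF F] sub])
    ultimately show "(LINT s|M. (cmod (proj (F (Suc n)) s - proj (F n) s))\<^sup>2) \<le> 1 / 8 ^ n"
      using SF[of n] S_sup[OF F[of "Suc n"]] by simp
  qed (rule proj_L2[OF F])
  then obtain p where p: "p \<in> L2 M" and lim: "(\<lambda>n. LINT s|M. (cmod (proj (F n) s - p s))\<^sup>2) \<longlonglongrightarrow> 0"
    by blast
  have "L2_inner M (\<lambda>x. g x - p x) e = 0" if e: "e \<in> B" for e
  proof -
    have eL2: "e \<in> L2 M" and eFs: "{e} \<in> Fs" using e BL2 by (auto simp: Fs_def)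
    have "(cmod (L2_inner M g e - L2_inner M (proj (F n)) e))\<^sup>2 \<le> 1 / 8 ^ n" for n
    proof (cases "e \<in> F n")
      case False
      have "insert e (F n) \<in> Fs" using F e by (auto simp: Fs_def)
      from S_sup[OF this] have "(cmod (L2_inner M g e))\<^sup>2 + S (F n) \<le> s"
        unfolding S_def sum.insert[OF Fs_L2(1)[OF F] False] .
      moreover have "L2_inner M (proj (F n)) e = 0" using inner_proj[OF F e] False by simp
      ultimately show ?thesis using SF[of n] by simp
    next
      case True
      then have "L2_inner M (proj (F n)) e = L2_inner M g e" using inner_proj[OF F e] by simp
      then show ?thesis by simp
    qed
    then have "(\<lambda>n. (cmod (L2_inner M g e - L2_inner M (proj (F n)) e))\<^sup>2) \<longlonglongrightarrow> 0"
      by (rule squeeze_zero) (simp, rule LIMSEQ_divide_realpow_zero, simp)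
    moreover have "(cmod (L2_inner M (proj (F n)) e - L2_inner M p e))\<^sup>2 \<le> (LINT s|M. (cmod (proj (F n) s - p s))\<^sup>2)" for n
      using Bessel[OF eFs L2_diff[OF proj_L2[OF F] p]] by (simp add: L2_inner_diff_left proj_L2 F p eL2)
    then have "(\<lambda>n. (cmod (L2_inner M (proj (F n)) e - L2_inner M p e))\<^sup>2) \<longlonglongrightarrow> 0"
      by (rule squeeze_zero[OF _ _ lim]) simp
    ultimately have "(\<lambda>n. 2 * (cmod (L2_inner M g e - L2_inner M (proj (F n)) e))\<^sup>2
        + 2 * (cmod (L2_inner M (proj (F n)) e - L2_inner M p e))\<^sup>2) \<longlonglongrightarrow> 2 * 0 + 2 * 0"
      by (intro tendsto_intros)
    moreover have "(cmod (L2_inner M g e - L2_inner M p e))\<^sup>2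
        \<le> 2 * (cmod (L2_inner M g e - L2_inner M (proj (F n)) e))\<^sup>2
        + 2 * (cmod (L2_inner M (proj (F n)) e - L2_inner M p e))\<^sup>2" for n
      using norm_add_square_le[of "L2_inner M g e - L2_inner M (proj (F n)) e" "L2_inner M (proj (F n)) e - L2_inner M p e"]
      by simp
    ultimately have "(cmod (L2_inner M g e - L2_inner M p e))\<^sup>2 \<le> 2 * 0 + 2 * 0"
      by (intro LIMSEQ_le_const) auto
    then have "cmod (L2_inner M g e - L2_inner M p e) = 0" by simp
    then show ?thesis by (simp add: L2_inner_diff_left g p eL2)
  qed
  then have AE: "AE x in M. g x - p x = 0" by (intro total L2_diff g p)
  have "(LINT x|M. (cmod (proj (F n) x - p x))\<^sup>2) = ?I - S (F n)" for n
  proof -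
    note [measurable] = L2D(1)[OF g] L2D(1)[OF p] L2D(1)[OF proj_L2[OF F[of n]]]
    have "(LINT x|M. (cmod (proj (F n) x - p x))\<^sup>2) = (LINT x|M. (cmod (g x - proj (F n) x))\<^sup>2)"
      by (rule integral_cong_AE) (use AE in \<open>auto elim!: eventually_mono simp: norm_minus_commute\<close>)
    then show ?thesis using minus_proj[OF F[of n] g] by (simp add: proj_def S_def)
  qed
  then have "\<forall>\<^sub>F n in sequentially. ?I - S (F n) < \<epsilon>"
    using order_tendstoD(2)[OF lim \<open>\<epsilon> > 0\<close>] by simp
  then obtain n where "?I - S (F n) < \<epsilon>" by (auto simp: eventually_sequentially)
  then show ?thesis using Fs_L2[OF F[of n]] by (intro exI[of _ "F n"]) (auto simp: S_def)
qed

text \<open>Monotone convergence for a sequence whose integrals are bounded, giving integrability of the limit.\<close>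

lemma integrable_incseq_limit:
  fixes u :: "'s \<Rightarrow> real"
  assumes f: "\<And>n. integrable M (f n)" and mono: "\<And>x. mono (\<lambda>n. f n x)"
    and lim: "\<And>x. x \<in> space M \<Longrightarrow> (\<lambda>n. f n x) \<longlonglongrightarrow> u x" and bound: "\<And>n. integral\<^sup>L M (f n) \<le> K"
  shows "integrable M u" "integral\<^sup>L M u \<le> K"
proof -
  have inc: "incseq (\<lambda>n. integral\<^sup>L M (f n))"
    using mono by (intro monoI integral_mono f) (auto simp: mono_def)
  then obtain L where L: "(\<lambda>n. integral\<^sup>L M (f n)) \<longlonglongrightarrow> L"
    using incseq_convergent[OF inc, of K] bound by metis
  have u: "u \<in> borel_measurable M"
    by (rule borel_measurable_LIMSEQ_real[OF lim]) (use f in auto)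
  show "integrable M u"
    by (rule integrable_monotone_convergence[OF f _ _ L u]) (use mono lim in auto)
  have "integral\<^sup>L M u = L"
    by (rule integral_monotone_convergence[OF f _ _ L u]) (use mono lim in auto)
  then show "integral\<^sup>L M u \<le> K" using LIMSEQ_le_const2[OF L] bound by blast
qed

text \<open>The Hilbert--Schmidt norm of integration against \<open>\<phi>\<close> is the \<open>L\<^sup>2\<close> norm of \<open>\<phi>\<close>: expand the
  coordinates of \<open>\<phi>\<close> in the given basis of \<open>L\<^sup>2\<close> and exchange the two sums.\<close>

lemma hilbert_schmidt_square_integrable:
  fixes \<phi> :: "'s \<Rightarrow> 'h::{complex_hilbert, second_countable_topology}"
  assumes \<phi> [measurable]: "\<phi> \<in> borel_measurable M"
    and A [measurable]: "\<And>n::nat. A n \<in> sets M" and inc: "incseq A" and cover: "space M \<subseteq> (\<Union>n. A n)"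
    and loc: "\<And>n. integrable M (\<lambda>s. indicator (A n) s * (norm (\<phi> s))\<^sup>2)"
    and int: "\<And>f::'s \<Rightarrow> complex. f \<in> L2 M \<Longrightarrow> integrable M (\<lambda>s. f s *\<^sub>C \<phi> s)"
    and HS: "hilbert_schmidt_L2 M (\<lambda>f::'s \<Rightarrow> complex. LINT s|M. f s *\<^sub>C \<phi> s)"
  shows "integrable M (\<lambda>s. (norm (\<phi> s))\<^sup>2)"
proof -
  define T where "T f = (LINT s|M. f s *\<^sub>C \<phi> s)" for f :: "'s \<Rightarrow> complex"
  obtain K B where K: "\<And>f. f \<in> L2 M \<Longrightarrow> norm (T f) \<le> K * sqrt (LINT s|M. (norm (f s))\<^sup>2)"
    and B: "L2_orthonormal_basis M B" and summable: "(\<lambda>e. (norm (T e))\<^sup>2) summable_on B"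
    using HS unfolding hilbert_schmidt_L2_def T_def by blast
  \<comment> \<open>The coordinates of \<open>\<phi>\<close>. Each is square integrable because testing \<open>T\<close> on its truncations
    bounds their norms by \<open>K * norm h\<close>.\<close>
  define g where "g h s = cinner (\<phi> s) h" for h s
  have g_meas [measurable]: "g h \<in> borel_measurable M" for h
    unfolding g_def
    by (rule measurable_compose[OF \<phi> borel_measurable_continuous_onI[OF linear_continuous_on[OF bounded_linear_cinner_left]]])
  have T_inner: "cinner (T f) h = (LINT s|M. f s * g h s)" if "f \<in> L2 M" for f h
    using integral_bounded_linear[OF bounded_linear_cinner_left int[OF that], of h]
    by (simp add: T_def g_def cinner_scaleC_left)
  have g_le: "(cmod (g h s))\<^sup>2 \<le> (norm (\<phi> s))\<^sup>2 * (norm h)\<^sup>2" for h s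
    using power_mono[OF cinner_Cauchy_Schwarz[of "\<phi> s" h], of 2] by (simp add: g_def power_mult_distrib)
  have g_L2: "g h \<in> L2 M" for h
  proof -
    let ?f = "\<lambda>n s. indicator (A n) s * (cmod (g h s))\<^sup>2"
    have int_f: "integrable M (?f n)" for n
    proof (rule Bochner_Integration.integrable_bound[OF integrable_mult_left[OF loc[of n], of "(norm h)\<^sup>2"]])
      show "AE s in M. norm (?f n s) \<le> norm (indicator (A n) s * (norm (\<phi> s))\<^sup>2 * (norm h)\<^sup>2)"
        using g_le by (auto simp: indicator_def)
    qed simp
    have "integrable M (\<lambda>s. (cmod (g h s))\<^sup>2)"
    proof (rule integrable_incseq_limit(1)[OF int_f])
      show "mono (\<lambda>n. ?f n s)" for s
        using inc by (auto simp: mono_def indicator_def dest: incseqD)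
      show "(\<lambda>n. ?f n s) \<longlonglongrightarrow> (cmod (g h s))\<^sup>2" if s: "s \<in> space M" for s
      proof -
        obtain m where "s \<in> A m" using s cover by blast
        then have "s \<in> A n" if "n \<ge> m" for n using incseqD[OF inc that] by blast
        then have "\<forall>n\<ge>m. ?f n s = (cmod (g h s))\<^sup>2" by simp
        then have "\<forall>\<^sub>F n in sequentially. ?f n s = (cmod (g h s))\<^sup>2"
          unfolding eventually_sequentially by blast
        then show ?thesis by (rule tendsto_eventually)
      qed
      show "integral\<^sup>L M (?f n) \<le> (K * norm h)\<^sup>2" for n
      proof -
        let ?x = "integral\<^sup>L M (?f n)"
        define t where "t s = complex_of_real (indicator (A n) s) * cnj (g h s)" for s
        have t_sq: "(norm (t s))\<^sup>2 = ?f n s" for s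
          by (simp add: t_def norm_mult indicator_def)
        have t: "t \<in> L2 M" using int_f[of n] by (simp add: L2_def t_sq) (simp add: t_def[abs_def])
        have "t s * g h s = complex_of_real (?f n s)" for s
          unfolding t_def mult.assoc mult_cnj_cmod by simp
        then have "cinner (T t) h = of_real ?x"
          unfolding T_inner[OF t] by (simp only: integral_complex_of_real)
        moreover have x0: "?x \<ge> 0" by simp
        ultimately have "?x \<le> norm (T t) * norm h"
          using cinner_Cauchy_Schwarz[of "T t" h] by simp
        also have "\<dots> \<le> (K * sqrt ?x) * norm h"
          using K[OF t] by (intro mult_right_mono) (simp_all add: t_sq)
        finally have *: "sqrt ?x * sqrt ?x \<le> (K * norm h) * sqrt ?x" using x0 by (simp add: mult_ac)
        show ?thesis
        proof (cases "?x = 0")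
          case False
          then have "sqrt ?x > 0" using x0 by (simp add: less_le)
          then have "sqrt ?x \<le> K * norm h" by (rule mult_right_le_imp_le[OF *])
          then have "(sqrt ?x)\<^sup>2 \<le> (K * norm h)\<^sup>2" by (intro power_mono) simp_all
          then show ?thesis using x0 by simp
        next
          case True
          show ?thesis unfolding True by simp
        qed
      qed
    qed
    then show ?thesis by (simp add: L2_def)
  qed
  \<comment> \<open>The sum over the coordinates of \<open>\<phi>\<close> and the sum over the basis \<open>B\<close> of \<open>L\<^sup>2\<close> are exchanged on finite
    pieces, at the cost of \<open>\<delta>\<close> for each coordinate.\<close>
  let ?W = "infsum (\<lambda>e. (norm (T e))\<^sup>2) B"
  have total: "(\<Sum>h\<in>Q. LINT s|M. (cmod (g h s))\<^sup>2) \<le> ?W" if Q: "orthonormal Q" "finite Q" for Q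
  proof (rule field_le_epsilon)
    fix \<epsilon> :: real assume "\<epsilon> > 0"
    define \<delta> where "\<delta> = \<epsilon> / (real (card Q) + 1)"
    have "\<delta> > 0" using \<open>\<epsilon> > 0\<close> by (simp add: \<delta>_def)
    have card_\<delta>: "real (card Q) * \<delta> \<le> \<epsilon>" using \<open>\<epsilon> > 0\<close> by (simp add: \<delta>_def field_simps)
    have "\<exists>F. finite F \<and> F \<subseteq> B \<and> (LINT s|M. (cmod (g h s))\<^sup>2) \<le> (\<Sum>e\<in>F. (cmod (cinner (T e) h))\<^sup>2) + \<delta>" for h
    proof -
      obtain F where F: "finite F" "F \<subseteq> B"
        "(LINT s|M. (cmod (cnj (g h s)))\<^sup>2) \<le> (\<Sum>e\<in>F. (cmod (L2_inner M (\<lambda>s. cnj (g h s)) e))\<^sup>2) + \<delta>"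
        using L2_Parseval_approx[OF B L2_cnj[OF g_L2[of h]] \<open>\<delta> > 0\<close>] by blast
      have "cmod (L2_inner M (\<lambda>s. cnj (g h s)) e) = cmod (cinner (T e) h)" if "e \<in> F" for e
      proof -
        have "e \<in> L2 M" using that F B by (auto simp: L2_orthonormal_basis_def)
        then have "L2_inner M (\<lambda>s. cnj (g h s)) e = cnj (cinner (T e) h)"
          unfolding T_inner[OF \<open>e \<in> L2 M\<close>] L2_inner_def cinner_complex_def
            Bochner_Integration.integral_cnj[symmetric] complex_cnj_mult
          by (simp only: mult.commute)
        then show ?thesis by simp
      qed
      then show ?thesis using F by (intro exI[of _ F]) simp
    qed
    then obtain F where F: "\<And>h. finite (F h)" "\<And>h. F h \<subseteq> B"
      "\<And>h. (LINT s|M. (cmod (g h s))\<^sup>2) \<le> (\<Sum>e\<in>F h. (cmod (cinner (T e) h))\<^sup>2) + \<delta>" by metis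
    define U where "U = (\<Union>h\<in>Q. F h)"
    have U: "finite U" "U \<subseteq> B" using F Q by (auto simp: U_def)
    have "(\<Sum>h\<in>Q. LINT s|M. (cmod (g h s))\<^sup>2) \<le> (\<Sum>h\<in>Q. (\<Sum>e\<in>U. (cmod (cinner (T e) h))\<^sup>2) + \<delta>)"
    proof (rule sum_mono)
      fix h assume "h \<in> Q"
      then have "(\<Sum>e\<in>F h. (cmod (cinner (T e) h))\<^sup>2) \<le> (\<Sum>e\<in>U. (cmod (cinner (T e) h))\<^sup>2)"
        by (intro sum_mono2 U) (auto simp: U_def)
      then show "(LINT s|M. (cmod (g h s))\<^sup>2) \<le> (\<Sum>e\<in>U. (cmod (cinner (T e) h))\<^sup>2) + \<delta>"
        using F(3)[of h] by linarith
    qed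
    also have "\<dots> = (\<Sum>e\<in>U. \<Sum>h\<in>Q. (cmod (cinner (T e) h))\<^sup>2) + real (card Q) * \<delta>"
      unfolding sum.distrib by (subst sum.swap) simp
    also have "\<dots> \<le> (\<Sum>e\<in>U. (norm (T e))\<^sup>2) + \<epsilon>"
      by (intro add_mono sum_mono Bessel_inequality[OF Q] card_\<delta>)
    also have "(\<Sum>e\<in>U. (norm (T e))\<^sup>2) \<le> ?W"
      by (rule finite_sum_le_infsum[OF summable U]) simp
    finally show "(\<Sum>h\<in>Q. LINT s|M. (cmod (g h s))\<^sup>2) \<le> ?W + \<epsilon>" by simp
  qed
  obtain E :: "'h set" and G where "exhausted_basis E G"
    using orthonormal_basis_exists exhausted_basis_exists by blast
  then interpret exhausted_basis E G .
  show ?thesis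
  proof (rule integrable_incseq_limit(1))
    show "integrable M (\<lambda>s. \<Sum>h\<in>G n. (cmod (g h s))\<^sup>2)" for n
      by (intro Bochner_Integration.integrable_sum L2D(2) g_L2)
    show "mono (\<lambda>n. \<Sum>h\<in>G n. (cmod (g h s))\<^sup>2)" for s
      by (intro monoI sum_mono2 finite_G mono_G) auto
    show "(\<lambda>n. \<Sum>h\<in>G n. (cmod (g h s))\<^sup>2) \<longlonglongrightarrow> (norm (\<phi> s))\<^sup>2" for s
      unfolding g_def by (rule Parseval)
    show "(LINT s|M. (\<Sum>h\<in>G n. (cmod (g h s))\<^sup>2)) \<le> ?W" for n
      using total[OF orthonormal_G finite_G, of n]
      by (subst Bochner_Integration.integral_sum) (auto intro: L2D(2) g_L2)
  qed
qed

text \<open>On the half-line the sets \<open>(0, n)\<close> localise, where continuity suffices; the part of \<open>{x..}\<close> to the left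
  of \<open>0\<close> is compact.\<close>

lemma hilbert_schmidt_half_line:
  fixes \<phi> :: "real \<Rightarrow> 'h::{complex_hilbert, second_countable_topology}"
  assumes cont: "continuous_on UNIV \<phi>"
    and int: "\<And>f::real \<Rightarrow> complex. f \<in> L2 half_line \<Longrightarrow> integrable half_line (\<lambda>s. f s *\<^sub>C \<phi> s)"
    and HS: "hilbert_schmidt_L2 half_line (\<lambda>f::real \<Rightarrow> complex. LINT s|half_line. f s *\<^sub>C \<phi> s)"
  shows "(\<lambda>s. (norm (\<phi> s))\<^sup>2) integrable_on {x..}"
proof -
  have cont': "continuous_on S (\<lambda>s. (norm (\<phi> s))\<^sup>2)" for S
    by (intro continuous_intros continuous_on_subset[OF cont]) simp
  have meas: "\<phi> \<in> borel_measurable borel" by (rule borel_measurable_continuous_onI[OF cont])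
  have set_int: "set_integrable lborel {a..b} (\<lambda>s. (norm (\<phi> s))\<^sup>2)" for a b
    by (rule borel_integrable_atLeastAtMost'[OF cont'])
  have sets: "{0<..<real n} \<in> sets half_line" for n
    by (auto simp: sets_restrict_space intro!: image_eqI[of _ _ "{0<..<real n}"])
  have "integrable half_line (\<lambda>s. (norm (\<phi> s))\<^sup>2)"
  proof (rule hilbert_schmidt_square_integrable[where A = "\<lambda>n. {0<..<real n}", OF _ sets _ _ _ int HS])
    show "\<phi> \<in> borel_measurable half_line"
      using meas by (intro measurable_restrict_space1) simp
    show "incseq (\<lambda>n. {0<..<real n})" by (auto simp: incseq_def)
    show "space half_line \<subseteq> (\<Union>n. {0<..<real n})"
      using reals_Archimedean2 by (auto simp: space_restrict_space)
    show "integrable half_line (\<lambda>s. indicator {0<..<real n} s * (norm (\<phi> s))\<^sup>2)" for n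
    proof -
      have "set_integrable lborel {0<..<real n} (\<lambda>s. (norm (\<phi> s))\<^sup>2)"
        by (rule set_integrable_subset[OF set_int[of 0 "real n"]]) auto
      moreover have "indicator {0<..} s *\<^sub>R (indicator {0<..<real n} s * (norm (\<phi> s))\<^sup>2)
          = indicator {0<..<real n} s *\<^sub>R (norm (\<phi> s))\<^sup>2" for s :: real
        by (auto simp: indicator_def)
      ultimately have "integrable lborel (\<lambda>s. indicator {0<..} s *\<^sub>R (indicator {0<..<real n} s * (norm (\<phi> s))\<^sup>2))"
        unfolding set_integrable_def by presburger
      then show ?thesis
        by (subst integrable_restrict_space) auto
    qed
  qed
  then have "set_integrable lborel {0<..} (\<lambda>s. (norm (\<phi> s))\<^sup>2)"
    by (subst (asm) integrable_restrict_space) (auto simp: set_integrable_def)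
  then have "set_integrable lborel ({min x 0..0} \<union> {0<..}) (\<lambda>s. (norm (\<phi> s))\<^sup>2)"
    by (intro set_integrable_Un set_int) auto
  then have "set_integrable lborel {x..} (\<lambda>s. (norm (\<phi> s))\<^sup>2)"
    by (rule set_integrable_subset) auto
  then show ?thesis by (rule set_borel_integral_eq_integral(1))
qed

section \<open>Finite determinants\<close>

text \<open>Determinants of matrices whose rows and columns are indexed by a finite set of vectors.\<close>

definition fdet :: "'e set \<Rightarrow> ('e \<Rightarrow> 'e \<Rightarrow> complex) \<Rightarrow> complex"
  where "fdet G N = (\<Sum>p | p permutes G. of_int (sign p) * (\<Prod>e\<in>G. N (p e) e))"

lemma fdet_cong:
  assumes "\<And>a e. a \<in> G \<Longrightarrow> e \<in> G \<Longrightarrow> N a e = N' a e" shows "fdet G N = fdet G N'"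
  unfolding fdet_def
  by (intro sum.cong prod.cong arg_cong2[where f = "(*)"] refl) (auto simp: permutes_in_image assms)

text \<open>The cofactor of the entry \<open>(i, j)\<close>, as the determinant after replacing column \<open>j\<close> by the \<open>i\<close>-th
  unit vector; this avoids deleting rows and columns, and their signs.\<close>

definition cof :: "'e set \<Rightarrow> ('e \<Rightarrow> 'e \<Rightarrow> complex) \<Rightarrow> 'e \<Rightarrow> 'e \<Rightarrow> complex"
  where "cof G N i j = fdet G (\<lambda>a e. if e = j then (if a = i then 1 else 0) else N a e)"

text \<open>Removing the factor of column \<open>j\<close> from each product exhibits the linear dependence on that column.\<close>

lemma fdet_replace_column_sum:
  assumes G: "finite G" "j \<in> G"
  shows "fdet G (\<lambda>a e. if e = j then c a else N a e)
    = (\<Sum>p | p permutes G. of_int (sign p) * (c (p j) * (\<Prod>e\<in>G - {j}. N (p e) e)))"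
  unfolding fdet_def
proof (intro sum.cong refl arg_cong2[where f = "(*)"])
  fix p
  show "(\<Prod>e\<in>G. if e = j then c (p e) else N (p e) e) = c (p j) * (\<Prod>e\<in>G - {j}. N (p e) e)"
    using G by (subst prod.remove[of G j]) (auto intro!: arg_cong2[where f = "(*)"] prod.cong)
qed

lemma fdet_replace_column:
  assumes G: "finite G" "j \<in> G"
  shows "fdet G (\<lambda>a e. if e = j then c a else N a e) = (\<Sum>i\<in>G. c i * cof G N i j)"
proof -
  have "(\<Sum>i\<in>G. c i * cof G N i j) = (\<Sum>i\<in>G. \<Sum>p | p permutes G.
      of_int (sign p) * ((if p j = i then c i else 0) * (\<Prod>e\<in>G - {j}. N (p e) e)))"
    unfolding cof_def fdet_replace_column_sum[OF G] sum_distrib_left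
    by (intro sum.cong refl) auto
  also have "\<dots> = (\<Sum>p | p permutes G. \<Sum>i\<in>G.
      of_int (sign p) * ((if p j = i then c i else 0) * (\<Prod>e\<in>G - {j}. N (p e) e)))"
    by (rule sum.swap)
  also have "\<dots> = (\<Sum>p | p permutes G. of_int (sign p) * (c (p j) * (\<Prod>e\<in>G - {j}. N (p e) e)))"
  proof (intro sum.cong refl)
    fix p assume "p \<in> {p. p permutes G}"
    then have "p j \<in> G" using G(2) by (simp add: permutes_in_image)
    then have "(\<Sum>i\<in>G. if p j = i then c i else 0) = c (p j)" using G(1) by simp
    then show "(\<Sum>i\<in>G. of_int (sign p) * ((if p j = i then c i else 0) * (\<Prod>e\<in>G - {j}. N (p e) e)))
        = of_int (sign p) * (c (p j) * (\<Prod>e\<in>G - {j}. N (p e) e))"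
      by (simp only: sum_distrib_left[symmetric] sum_distrib_right[symmetric])
  qed
  finally show ?thesis unfolding fdet_replace_column_sum[OF G] by simp
qed

text \<open>Composing with the transposition of the two columns is a sign-reversing involution of the permutations.\<close>

lemma fdet_equal_columns:
  assumes G: "finite G" "j \<in> G" "k \<in> G" "j \<noteq> k" and eq: "\<And>a. N a j = N a k"
  shows "fdet G N = 0"
proof -
  let ?t = "Transposition.transpose j k"
  have t: "?t permutes G" using G by (intro permutes_swap_id)
  have "fdet G N = (\<Sum>p | p permutes G. of_int (sign (p \<circ> ?t)) * (\<Prod>e\<in>G. N ((p \<circ> ?t) e) e))"
    unfolding fdet_def by (rule sum_permutations_compose_right[OF t])
  also have "\<dots> = (\<Sum>p | p permutes G. - (of_int (sign p) * (\<Prod>e\<in>G. N (p e) e)))"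
  proof (intro sum.cong refl)
    fix p assume p: "p \<in> {p. p permutes G}"
    have "sign (p \<circ> ?t) = - sign p"
      using p t G by (subst sign_compose) (auto simp: sign_swap_id permutation_permutes permutation_swap_id)
    moreover have "(\<Prod>e\<in>G. N ((p \<circ> ?t) e) e) = (\<Prod>e\<in>G. N (p e) e)"
    proof -
      have "(\<Prod>e\<in>G. N (p e) e) = (\<Prod>e\<in>G. N (p (?t e)) (?t e))"
        using prod.permute[OF t, of "\<lambda>e. N (p e) e"] by (simp add: o_def)
      also have "\<dots> = (\<Prod>e\<in>G. N (p (?t e)) e)"
        by (intro prod.cong refl) (auto simp: Transposition.transpose_def eq)
      finally show ?thesis by simp
    qed
    ultimately show "of_int (sign (p \<circ> ?t)) * (\<Prod>e\<in>G. N ((p \<circ> ?t) e) e) = - (of_int (sign p) * (\<Prod>e\<in>G. N (p e) e))"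
      by simp
  qed
  also have "\<dots> = - fdet G N" by (simp add: fdet_def sum_negf)
  finally show ?thesis by simp
qed

text \<open>The sum is the determinant after column \<open>k\<close> has been copied to column \<open>j\<close>.\<close>

lemma cof_orthogonal:
  assumes G: "finite G" "j \<in> G" "k \<in> G"
  shows "(\<Sum>i\<in>G. N i k * cof G N i j) = (if k = j then fdet G N else 0)"
proof -
  have "(\<Sum>i\<in>G. N i k * cof G N i j) = fdet G (\<lambda>a e. if e = j then N a k else N a e)"
    by (rule fdet_replace_column[OF G(1,2), symmetric])
  also have "\<dots> = (if k = j then fdet G N else 0)"
  proof (cases "k = j")
    case True
    then show ?thesis by (auto intro!: fdet_cong)
  next
    case False
    then show ?thesis using fdet_equal_columns[OF G] by simp
  qed
  finally show ?thesis .
qed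

lemma fdet_Cramer:
  assumes G: "finite G" "j \<in> G" and a: "\<And>i. i \<in> G \<Longrightarrow> (\<Sum>k\<in>G. N i k * a k) = b i"
  shows "(\<Sum>i\<in>G. b i * cof G N i j) = fdet G N * a j"
proof -
  have "(\<Sum>i\<in>G. b i * cof G N i j) = (\<Sum>i\<in>G. \<Sum>k\<in>G. N i k * cof G N i j * a k)"
    by (intro sum.cong refl) (simp add: a[symmetric] sum_distrib_right, simp only: mult.assoc mult.left_commute mult.commute)
  also have "\<dots> = (\<Sum>k\<in>G. (\<Sum>i\<in>G. N i k * cof G N i j) * a k)"
    by (subst sum.swap) (simp add: sum_distrib_right)
  also have "\<dots> = (\<Sum>k\<in>G. if k = j then fdet G N * a k else 0)"
    by (intro sum.cong refl) (simp add: cof_orthogonal[OF G])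
  finally show ?thesis using G by simp
qed

lemma fdet_transpose:
  assumes G: "finite G" shows "fdet G (\<lambda>a e. N e a) = fdet G N"
proof -
  have "fdet G N = (\<Sum>p | p permutes G. of_int (sign (Hilbert_Choice.inv p)) * (\<Prod>e\<in>G. N (Hilbert_Choice.inv p e) e))"
    unfolding fdet_def by (rule sum_permutations_inverse)
  also have "\<dots> = (\<Sum>p | p permutes G. of_int (sign p) * (\<Prod>e\<in>G. N e (p e)))"
  proof (intro sum.cong refl)
    fix p assume "p \<in> {p. p permutes G}"
    then have p: "p permutes G" by simp
    have "sign (Hilbert_Choice.inv p) = sign p" using p G by (intro sign_inverse) (auto simp: permutation_permutes)
    moreover have "(\<Prod>e\<in>G. N (Hilbert_Choice.inv p e) e) = (\<Prod>e\<in>G. N (Hilbert_Choice.inv p (p e)) (p e))"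
      using prod.permute[OF p, of "\<lambda>e. N (Hilbert_Choice.inv p e) e"] by (simp add: o_def)
    ultimately show "of_int (sign (Hilbert_Choice.inv p)) * (\<Prod>e\<in>G. N (Hilbert_Choice.inv p e) e) = of_int (sign p) * (\<Prod>e\<in>G. N e (p e))"
      using p by (simp add: permutes_inverses)
  qed
  finally show ?thesis by (simp add: fdet_def)
qed

text \<open>Cramer's formula for the solution; the cofactors of the transpose are needed because the expansion above
  is along columns.\<close>

lemma fdet_solvable:
  assumes G: "finite G" and nz: "fdet G N \<noteq> 0"
  shows "\<exists>x. \<forall>i\<in>G. (\<Sum>k\<in>G. N i k * x k) = b i"
proof -
  let ?c = "\<lambda>i k. cof G (\<lambda>a e. N e a) k i"
  define x where "x k = (\<Sum>i\<in>G. b i * ?c i k) / fdet G N" for k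
  have "(\<Sum>k\<in>G. N l k * x k) = b l" if l: "l \<in> G" for l
  proof -
    have "(\<Sum>k\<in>G. N l k * (\<Sum>i\<in>G. b i * ?c i k)) = (\<Sum>k\<in>G. \<Sum>i\<in>G. b i * (N l k * ?c i k))"
      unfolding sum_distrib_left by (intro sum.cong refl mult.left_commute)
    also have "\<dots> = (\<Sum>i\<in>G. b i * (\<Sum>k\<in>G. N l k * ?c i k))"
      unfolding sum_distrib_left by (rule sum.swap)
    also have "\<dots> = (\<Sum>i\<in>G. if i = l then b i * fdet G N else 0)"
    proof (intro sum.cong refl)
      fix i assume "i \<in> G"
      from cof_orthogonal[OF G this l, of "\<lambda>a e. N e a"]
      have "(\<Sum>k\<in>G. N l k * ?c i k) = (if l = i then fdet G N else 0)"
        by (simp only: fdet_transpose[OF G, of N])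
      then show "b i * (\<Sum>k\<in>G. N l k * ?c i k) = (if i = l then b i * fdet G N else 0)" by auto
    qed
    also have "\<dots> = b l * fdet G N" using G l by simp
    finally show ?thesis
      using nz unfolding x_def times_divide_eq_right sum_divide_distrib[symmetric] by simp
  qed
  then show ?thesis by blast
qed

lemma fdet_has_derivative:
  assumes G: "finite G"
    and N: "\<And>i j. i \<in> G \<Longrightarrow> j \<in> G \<Longrightarrow> ((\<lambda>x. N x i j) has_derivative N' i j) (at x within S)"
  shows "((\<lambda>x. fdet G (N x)) has_derivative (\<lambda>h. \<Sum>i\<in>G. \<Sum>j\<in>G. N' i j h * cof G (N x) i j)) (at x within S)"
proof -
  have "((\<lambda>x. fdet G (N x)) has_derivative (\<lambda>h. \<Sum>p | p permutes G. of_int (sign p) *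
      (\<Sum>j\<in>G. N' (p j) j h * (\<Prod>e\<in>G - {j}. N x (p e) e)))) (at x within S)"
    unfolding fdet_def
  proof (intro has_derivative_sum has_derivative_mult_right has_derivative_prod N)
  qed (auto simp: permutes_in_image)
  moreover have "(\<Sum>p | p permutes G. of_int (sign p) * (\<Sum>j\<in>G. N' (p j) j h * (\<Prod>e\<in>G - {j}. N x (p e) e)))
      = (\<Sum>i\<in>G. \<Sum>j\<in>G. N' i j h * cof G (N x) i j)" for h
  proof -
    have "(\<Sum>p | p permutes G. of_int (sign p) * (\<Sum>j\<in>G. N' (p j) j h * (\<Prod>e\<in>G - {j}. N x (p e) e)))
        = (\<Sum>j\<in>G. \<Sum>p | p permutes G. of_int (sign p) * (N' (p j) j h * (\<Prod>e\<in>G - {j}. N x (p e) e)))"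
      unfolding sum_distrib_left by (rule sum.swap)
    also have "\<dots> = (\<Sum>j\<in>G. \<Sum>i\<in>G. N' i j h * cof G (N x) i j)"
      by (intro sum.cong refl, subst fdet_replace_column_sum[OF G, symmetric], assumption)
        (rule fdet_replace_column[OF G])
    finally show ?thesis by (subst (asm) sum.swap)
  qed
  ultimately show ?thesis by simp
qed

text \<open>Expanding every product over the diagonal terms, a permutation together with a set of fixed points of it
  is a permutation of the complementary set. This is what identifies the determinants of the compressions with
  partial sums of the Fredholm series.\<close>

lemma fdet_identity_plus:
  assumes G: "finite G"
  shows "fdet G (\<lambda>a e. (if a = e then 1 else 0) + M a e) = (\<Sum>F\<in>Pow G. fdet F M)"
proof -
  have "fdet G (\<lambda>a e. (if a = e then 1 else 0) + M a e)
      = (\<Sum>p | p permutes G. \<Sum>F\<in>Pow G. of_int (sign p) *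
          ((\<Prod>e\<in>F. M (p e) e) * (\<Prod>e\<in>G - F. if p e = e then 1 else 0)))"
    unfolding fdet_def add.commute[of "if _ then _ else _"] prod_add[OF G] sum_distrib_left ..
  also have "\<dots> = (\<Sum>F\<in>Pow G. \<Sum>p | p permutes G. of_int (sign p) *
          ((\<Prod>e\<in>F. M (p e) e) * (\<Prod>e\<in>G - F. if p e = e then 1 else 0)))"
    by (rule sum.swap)
  also have "\<dots> = (\<Sum>F\<in>Pow G. fdet F M)"
  proof (intro sum.cong refl)
    fix F assume F: "F \<in> Pow G"
    have sub: "{p. p permutes F} \<subseteq> {p. p permutes G}" using F permutes_subset by blast
    have "(\<Sum>p | p permutes G. of_int (sign p) * ((\<Prod>e\<in>F. M (p e) e) * (\<Prod>e\<in>G - F. if p e = e then 1 else 0)))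
        = (\<Sum>p | p permutes F. of_int (sign p) * ((\<Prod>e\<in>F. M (p e) e) * (\<Prod>e\<in>G - F. if p e = e then 1 else 0)))"
    proof (rule sum.mono_neutral_right[OF finite_permutations[OF G] sub], intro ballI)
      fix p assume p: "p \<in> {p. p permutes G} - {p. p permutes F}"
      have "\<exists>e\<in>G - F. p e \<noteq> e"
      proof (rule ccontr)
        assume "\<not> ?thesis"
        then have "p e = e" if "e \<notin> F" for e
          using that p permutes_not_in[of p G e] by auto
        then have "p permutes F" using p permutes_superset[of p G F] by auto
        then show False using p by simp
      qed
      then have "(\<Prod>e\<in>G - F. if p e = e then 1 else 0) = (0::complex)"
        using G by (intro prod_zero) auto
      then show "of_int (sign p) * ((\<Prod>e\<in>F. M (p e) e) * (\<Prod>e\<in>G - F. if p e = e then 1 else 0)) = 0"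
        by simp
    qed
    also have "\<dots> = fdet F M"
      unfolding fdet_def
    proof (intro sum.cong refl)
      fix p assume "p \<in> {p. p permutes F}"
      then have "(\<Prod>e\<in>G - F. if p e = e then 1 else 0) = (1::complex)"
        by (intro prod.neutral) (auto simp: permutes_not_in)
      then show "of_int (sign p) * ((\<Prod>e\<in>F. M (p e) e) * (\<Prod>e\<in>G - F. if p e = e then 1 else 0))
          = of_int (sign p) * (\<Prod>e\<in>F. M (p e) e)" by simp
    qed
    finally show "(\<Sum>p | p permutes G. of_int (sign p) * ((\<Prod>e\<in>F. M (p e) e) * (\<Prod>e\<in>G - F. if p e = e then 1 else 0)))
        = fdet F M" .
  qed
  finally show ?thesis .
qed

lemma fdet_scale:
  assumes G: "finite G"
  shows "fdet G (\<lambda>a e. d a * M a e * d e) = (\<Prod>e\<in>G. d e)\<^sup>2 * fdet G M"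
proof -
  have "(\<Prod>e\<in>G. d (p e) * M (p e) e * d e) = (\<Prod>e\<in>G. d e)\<^sup>2 * (\<Prod>e\<in>G. M (p e) e)" if "p permutes G" for p
  proof -
    have "(\<Prod>e\<in>G. d (p e)) = (\<Prod>e\<in>G. d e)"
      using prod.permute[OF that, of d] by (simp add: o_def)
    then show ?thesis by (simp add: prod.distrib power2_eq_square mult_ac)
  qed
  then show ?thesis
    unfolding fdet_def sum_distrib_left by (intro sum.cong refl) (simp add: mult_ac)
qed

section \<open>A determinant bound\<close>

lemma trace_mult_commute:
  fixes A B :: "complex mat"
  assumes "A \<in> carrier_mat n n" "B \<in> carrier_mat n n"
  shows "(\<Sum>i<n. (A * B) $$ (i, i)) = (\<Sum>i<n. (B * A) $$ (i, i))"
proof -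
  have entry: "(X * Y) $$ (i, i) = (\<Sum>k<n. X $$ (i, k) * Y $$ (k, i))"
    if "X \<in> carrier_mat n n" "Y \<in> carrier_mat n n" "i < n" for X Y :: "complex mat" and i
    using that by (simp add: scalar_prod_def lessThan_atLeast0)
  have "(\<Sum>i<n. (A * B) $$ (i, i)) = (\<Sum>i<n. \<Sum>k<n. A $$ (i, k) * B $$ (k, i))"
    by (intro sum.cong refl entry[OF assms]) simp
  also have "\<dots> = (\<Sum>k<n. \<Sum>i<n. B $$ (k, i) * A $$ (i, k))"
    by (subst sum.swap) (simp add: mult.commute)
  also have "\<dots> = (\<Sum>k<n. (B * A) $$ (k, k))"
    by (intro sum.cong refl entry[OF assms(2,1), symmetric]) simp
  finally show ?thesis .
qed

text \<open>A Schur triangulation has the eigenvalues on its diagonal.\<close>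

lemma eigenvalues_det_trace:
  fixes A :: "complex mat"
  assumes A: "A \<in> carrier_mat n n"
  shows "\<exists>es. length es = n \<and> det A = prod_list es \<and> (\<Sum>i<n. A $$ (i, i)) = sum_list es \<and>
    (\<forall>e\<in>set es. \<exists>v\<in>carrier_vec n. v \<noteq> 0\<^sub>v n \<and> A *\<^sub>v v = e \<cdot>\<^sub>v v)"
proof -
  obtain es where es: "char_poly A = (\<Prod>a\<leftarrow>es. [:- a, 1:])" "length es = n"
    using char_poly_factorized[OF A] by blast
  obtain B P Q where BPQ: "schur_decomposition A es = (B, P, Q)" by (cases "schur_decomposition A es") auto
  from schur_decomposition[OF A es(1) BPQ]
  have sim: "similar_mat_wit A B P Q" and ut: "upper_triangular B" and diag: "diag_mat B = es" by auto
  note w = similar_mat_witD2[OF A sim]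
  have "det A = det B" using sim by (intro det_similar) (auto simp: similar_mat_def)
  then have det: "det A = prod_list es"
    using det_upper_triangular[OF ut w(5)] diag by simp
  have "(\<Sum>i<n. A $$ (i, i)) = (\<Sum>i<n. (P * (B * Q)) $$ (i, i))"
    using w by (simp add: assoc_mult_mat[of P n n B n Q n])
  also have "\<dots> = (\<Sum>i<n. ((B * Q) * P) $$ (i, i))"
    by (rule trace_mult_commute) (use w in auto)
  also have "(B * Q) * P = B" using w by (simp add: assoc_mult_mat[of B n n Q n P n])
  also have "(\<Sum>i<n. B $$ (i, i)) = sum_list es"
    using w(5) unfolding diag[symmetric] diag_mat_def
    by (simp add: sum_list_distinct_conv_sum_set lessThan_atLeast0)
  finally have tr: "(\<Sum>i<n. A $$ (i, i)) = sum_list es" .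
  have "\<exists>v\<in>carrier_vec n. v \<noteq> 0\<^sub>v n \<and> A *\<^sub>v v = e \<cdot>\<^sub>v v" if "e \<in> set es" for e
  proof -
    have "poly (char_poly A) e = 0" unfolding es(1) using that
      by (auto simp: poly_prod_list prod_list_zero_iff o_def image_iff)
    then have "eigenvalue A e" using eigenvalue_root_char_poly[OF A] by simp
    then show ?thesis using A by (auto simp: eigenvalue_def eigenvector_def)
  qed
  with es(2) det tr show ?thesis by blast
qed

text \<open>If the numerical values of \<open>N\<close> are dominated by those of a positive definite \<open>S\<close>, then all eigenvalues
  of \<open>S\<^sup>-\<^sup>1 N\<close> lie in the unit disc, so \<open>\<bar>det N\<bar> \<le> det S\<close>; and \<open>det S\<close> is bounded through the trace
  by \<open>\<lambda> \<le> exp (\<lambda> - 1)\<close> for each eigenvalue \<open>\<lambda>\<close> of \<open>S\<close>.\<close>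

lemma det_dominated:
  fixes N S :: "complex mat"
  assumes N: "N \<in> carrier_mat n n" and S: "S \<in> carrier_mat n n"
    and dom: "\<And>v. v \<in> carrier_vec n \<Longrightarrow> v \<noteq> 0\<^sub>v n \<Longrightarrow>
      \<exists>r>0. (S *\<^sub>v v) \<bullet>c v = complex_of_real r \<and> cmod ((N *\<^sub>v v) \<bullet>c v) \<le> r"
  shows "cmod (det N) \<le> exp ((\<Sum>i<n. Re (S $$ (i, i))) - real n)"
proof -
  have vv: "\<exists>r>0. v \<bullet>c v = complex_of_real r" if v: "v \<in> carrier_vec n" "v \<noteq> 0\<^sub>v n" for v
  proof -
    have "v \<bullet>c v = (\<Sum>i<n. complex_of_real ((cmod (v $ i))\<^sup>2))"
      using v by (simp add: scalar_prod_def lessThan_atLeast0 mult_cnj_cmod del: of_real_power)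
    then have eq: "v \<bullet>c v = complex_of_real (\<Sum>i<n. (cmod (v $ i))\<^sup>2)" by simp
    moreover have "v \<bullet>c v \<noteq> 0" using v by simp
    ultimately have nz: "(\<Sum>i<n. (cmod (v $ i))\<^sup>2) \<noteq> 0" by (metis of_real_0)
    have ge: "(\<Sum>i<n. (cmod (v $ i))\<^sup>2) \<ge> 0" by (intro sum_nonneg) simp
    show ?thesis
    proof (intro exI conjI)
      show "0 < (\<Sum>i<n. (cmod (v $ i))\<^sup>2)" using nz ge by linarith
    qed (rule eq)
  qed
  have "det S \<noteq> 0"
  proof
    assume "det S = 0"
    then obtain v where v: "v \<in> carrier_vec n" "v \<noteq> 0\<^sub>v n" "S *\<^sub>v v = 0\<^sub>v n"
      unfolding det_0_iff_vec_prod_zero[OF S] by (elim exE conjE)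
    obtain r where r: "r > 0" "(S *\<^sub>v v) \<bullet>c v = complex_of_real r" using dom[OF v(1,2)] by blast
    have "(S *\<^sub>v v) \<bullet>c v = 0" unfolding v(3) using v(1) by simp
    then show False using r by simp
  qed
  obtain es where es: "length es = n" "det S = prod_list es" "(\<Sum>i<n. S $$ (i, i)) = sum_list es"
    and ev: "\<forall>e\<in>set es. \<exists>v\<in>carrier_vec n. v \<noteq> 0\<^sub>v n \<and> S *\<^sub>v v = e \<cdot>\<^sub>v v"
    using eigenvalues_det_trace[OF S] by (elim exE conjE)
  have pos: "\<exists>r>0. e = complex_of_real r" if e: "e \<in> set es" for e
  proof -
    obtain v where v: "v \<in> carrier_vec n" "v \<noteq> 0\<^sub>v n" "S *\<^sub>v v = e \<cdot>\<^sub>v v" using ev e by blast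
    obtain r where r: "r > 0" "(S *\<^sub>v v) \<bullet>c v = complex_of_real r" using dom[OF v(1,2)] by blast
    obtain q where q: "q > 0" "v \<bullet>c v = complex_of_real q" using vv[OF v(1,2)] by blast
    have "e * complex_of_real q = complex_of_real r"
      using r(2) q(2) v by simp
    then have "e = complex_of_real (r / q)" using q(1) by (simp add: field_simps)
    then show ?thesis using r(1) q(1) by (intro exI[of _ "r / q"]) simp
  qed
  \<comment> \<open>A determinant is bounded through the trace by \<open>r \<le> exp (r - 1)\<close>, applied to each eigenvalue.\<close>
  have bound: "cmod (prod_list xs) \<le> exp (Re (sum_list xs) - real (length xs))"
    if "\<And>e. e \<in> set xs \<Longrightarrow> \<exists>r>0. e = complex_of_real r" for xs
    using that
  proof (induction xs)
    case (Cons e xs)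
    obtain r where r: "r > 0" "e = complex_of_real r" using Cons.prems by auto
    have "cmod (prod_list (e # xs)) \<le> exp (r - 1) * exp (Re (sum_list xs) - real (length xs))"
      using r exp_ge_add_one_self[of "r - 1"] Cons
      by (simp add: norm_mult) (intro mult_mono, auto)
    then show ?case using r by (simp add: exp_add[symmetric] algebra_simps)
  qed simp
  have "(\<Sum>i<n. Re (S $$ (i, i))) = Re (sum_list es)"
    by (simp flip: es(3))
  then have det_S: "cmod (det S) \<le> exp ((\<Sum>i<n. Re (S $$ (i, i))) - real n)"
    using bound[OF pos, of es] es(1,2) by simp
  define Si where "Si = (1 / det S) \<cdot>\<^sub>m adj_mat S"
  note adj = adj_mat[OF S]
  have Si: "Si \<in> carrier_mat n n" using adj by (simp add: Si_def)
  have "S * Si = (1 / det S) \<cdot>\<^sub>m (S * adj_mat S)"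
    unfolding Si_def by (rule mult_smult_distrib[OF S adj(1)])
  also have "\<dots> = 1\<^sub>m n"
    unfolding adj(2) using \<open>det S \<noteq> 0\<close> by (intro eq_matI) auto
  finally have SSi: "S * Si = 1\<^sub>m n" .
  have SSiN: "S * (Si * N) = N"
    unfolding assoc_mult_mat[OF S Si N, symmetric] SSi by (rule left_mult_one_mat[OF N])
  have SiN: "Si * N \<in> carrier_mat n n" using Si N by (rule mult_carrier_mat)
  obtain fs where fs: "length fs = n" "det (Si * N) = prod_list fs"
      "(\<Sum>i<n. (Si * N) $$ (i, i)) = sum_list fs"
    and fev: "\<forall>e\<in>set fs. \<exists>v\<in>carrier_vec n. v \<noteq> 0\<^sub>v n \<and> (Si * N) *\<^sub>v v = e \<cdot>\<^sub>v v"
    using eigenvalues_det_trace[OF SiN] by (elim exE conjE)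
  have le1: "cmod e \<le> 1" if e: "e \<in> set fs" for e
  proof -
    obtain v where v: "v \<in> carrier_vec n" "v \<noteq> 0\<^sub>v n" "(Si * N) *\<^sub>v v = e \<cdot>\<^sub>v v" using fev e by blast
    have "N *\<^sub>v v = S *\<^sub>v ((Si * N) *\<^sub>v v)"
      by (subst assoc_mult_mat_vec[OF S SiN v(1), symmetric]) (simp only: SSiN)
    also have "\<dots> = e \<cdot>\<^sub>v (S *\<^sub>v v)" unfolding v(3) using S v(1) by (rule mult_mat_vec)
    finally have Nv: "N *\<^sub>v v = e \<cdot>\<^sub>v (S *\<^sub>v v)" .
    obtain r where r: "r > 0" "(S *\<^sub>v v) \<bullet>c v = complex_of_real r" "cmod ((N *\<^sub>v v) \<bullet>c v) \<le> r"
      using dom[OF v(1,2)] by blast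
    have "(N *\<^sub>v v) \<bullet>c v = e * complex_of_real r"
      unfolding Nv r(2)[symmetric] using S v(1) by simp
    then have "cmod e * r \<le> 1 * r" using r by (simp add: norm_mult)
    then show ?thesis using r(1) by (rule mult_right_le_imp_le)
  qed
  have "cmod (prod_list xs) \<le> 1" if "\<And>e. e \<in> set xs \<Longrightarrow> cmod e \<le> 1" for xs
    using that by (induction xs) (auto simp: norm_mult intro!: mult_le_one)
  then have det_M: "cmod (det (Si * N)) \<le> 1" using fs(2) le1 by simp
  have "det N = det S * det (Si * N)"
    using det_mult[OF S SiN] by (simp only: SSiN)
  then have "cmod (det N) \<le> cmod (det S) * 1"
    by (simp only: norm_mult) (intro mult_left_mono det_M, simp)
  then show ?thesis using det_S by simp
qed

text \<open>The same bound for index sets other than initial segments, by enumerating the set.\<close>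

lemma fdet_dominated:
  assumes G: "finite G"
    and dom: "\<And>q. \<exists>e\<in>G. q e \<noteq> 0 \<Longrightarrow>
      \<exists>r>0. (\<Sum>i\<in>G. \<Sum>j\<in>G. cnj (q i) * S i j * q j) = complex_of_real r \<and>
        cmod (\<Sum>i\<in>G. \<Sum>j\<in>G. cnj (q i) * N i j * q j) \<le> r"
  shows "cmod (fdet G N) \<le> exp ((\<Sum>e\<in>G. Re (S e e)) - real (card G))"
proof -
  define n where "n = card G"
  obtain g where g: "bij_betw g {0..<n} G" unfolding n_def using ex_bij_betw_nat_finite[OF G] by blast
  then have inj: "inj_on g {0..<n}" and im: "g ` {0..<n} = G" by (auto simp: bij_betw_def)
  define mat' where "mat' M = mat n n (\<lambda>(i, j). M (g i) (g j))" for M :: "'a \<Rightarrow> 'a \<Rightarrow> complex"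
  have carr: "mat' M \<in> carrier_mat n n" for M by (simp add: mat'_def)
  have reindex: "(\<Sum>e\<in>G. f e) = (\<Sum>i<n. f (g i))" for f :: "'a \<Rightarrow> 'b::comm_monoid_add"
    using sum.reindex_bij_betw[OF g, of f] by (simp add: lessThan_atLeast0)
  have form: "(mat' M *\<^sub>v v) \<bullet>c v = (\<Sum>i\<in>G. \<Sum>j\<in>G. cnj (q i) * M i j * q j)"
    if "v \<in> carrier_vec n" "\<And>i. i < n \<Longrightarrow> q (g i) = v $ i" for v :: "complex vec" and q M
    using that unfolding reindex
    by (simp add: mat'_def scalar_prod_def lessThan_atLeast0 sum_distrib_right sum_distrib_left mult_ac)
  have "fdet G N = det (mat' N)"
  proof -
    have bij: "bij_betw (map_permutation {0..<n} g) {p. p permutes {0..<n}} {p. p permutes G}"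
      using bij_betw_permutations[OF g] by (simp add: map_permutation_def[abs_def] restrict_id_def[abs_def] im)
    show ?thesis
      unfolding fdet_def det_col[OF carr[of N]]
    proof (rule sum.reindex_bij_betw[OF bij, symmetric, THEN trans], intro sum.cong refl)
      fix p assume "p \<in> {p. p permutes {0..<n}}"
      then have p: "p permutes {0..<n}" by simp
      have sgn: "sign (map_permutation {0..<n} g p) = sign p"
        by (rule sign_map_permutation[OF inj p]) simp
      have "(\<Prod>e\<in>G. N (map_permutation {0..<n} g p e) e)
          = (\<Prod>i\<in>{0..<n}. N (map_permutation {0..<n} g p (g i)) (g i))"
        by (rule prod.reindex_bij_betw[OF g, symmetric])
      also have "\<dots> = (\<Prod>j<n. mat' N $$ (p j, j))"
        unfolding lessThan_atLeast0
      proof (intro prod.cong refl)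
        fix i assume i: "i \<in> {0..<n}"
        then have "p i < n" using p permutes_in_image[OF p, of i] by simp
        then show "N (map_permutation {0..<n} g p (g i)) (g i) = mat' N $$ (p i, i)"
          using i map_permutation_apply[OF inj, of i p] by (simp add: mat'_def)
      qed
      finally show "of_int (sign (map_permutation {0..<n} g p)) * (\<Prod>e\<in>G. N (map_permutation {0..<n} g p e) e)
          = signof p * (\<Prod>j<n. mat' N $$ (p j, j))" by (simp add: sgn)
    qed
  qed
  moreover have "cmod (det (mat' N)) \<le> exp ((\<Sum>i<n. Re (mat' S $$ (i, i))) - real n)"
  proof (rule det_dominated[OF carr carr])
    fix v :: "complex vec" assume v: "v \<in> carrier_vec n" "v \<noteq> 0\<^sub>v n"
    define q where "q e = v $ (inv_into {0..<n} g e)" for e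
    have q: "q (g i) = v $ i" if "i < n" for i
      using that inj by (simp add: q_def inv_into_f_f)
    obtain i where i: "i < n" "v $ i \<noteq> 0"
    proof (rule ccontr)
      assume "\<not> thesis"
      then have "\<And>i. i < n \<Longrightarrow> v $ i = 0" using that by blast
      then have "v = 0\<^sub>v n" using v(1) by (intro eq_vecI) auto
      then show False using v(2) by simp
    qed
    then have "g i \<in> G" "q (g i) \<noteq> 0" using im q by auto
    then have "\<exists>e\<in>G. q e \<noteq> 0" by blast
    have form_v: "(mat' M *\<^sub>v v) \<bullet>c v = (\<Sum>i\<in>G. \<Sum>j\<in>G. cnj (q i) * M i j * q j)" for M
      by (rule form[OF v(1)]) (rule q)
    from dom[OF \<open>\<exists>e\<in>G. q e \<noteq> 0\<close>] show "\<exists>r>0. (mat' S *\<^sub>v v) \<bullet>c v = complex_of_real r \<and> cmod ((mat' N *\<^sub>v v) \<bullet>c v) \<le> r"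
      unfolding form_v .
  qed
  ultimately show ?thesis unfolding reindex by (simp add: mat'_def n_def)
qed

section \<open>Inverses of bounded operators\<close>

definition op_inverses :: "('a::real_normed_vector \<Rightarrow>\<^sub>L 'a) \<Rightarrow> ('a \<Rightarrow>\<^sub>L 'a) \<Rightarrow> bool"
  where "op_inverses A B \<longleftrightarrow> A o\<^sub>L B = id_blinfun \<and> B o\<^sub>L A = id_blinfun"

lemma op_inverses_unique: "op_inverses A B \<Longrightarrow> op_inverses A B' \<Longrightarrow> B = B'"
  unfolding op_inverses_def by (metis comp_assoc comp_id)

lemma op_inverses_apply:
  assumes "op_inverses A B" shows "A (B x) = x" "B (A x) = x"
  using assms unfolding op_inverses_def
  by (metis blinfun_apply_blinfun_compose blinfun_apply_id_blinfun)+

lemma clinear_op_inverse: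
  assumes "op_inverses A B" "clinear_op A" shows "clinear_op B"
  unfolding clinear_op_def
proof (intro allI)
  fix c x
  have "B (c *\<^sub>C x) = B (A (c *\<^sub>C B x))"
    by (simp add: clinear_opD[OF assms(2)] op_inverses_apply[OF assms(1)])
  then show "B (c *\<^sub>C x) = c *\<^sub>C B x" by (simp add: op_inverses_apply[OF assms(1)])
qed

lemma bounded_below_surj_inverse:
  assumes below: "\<And>x. norm x \<le> c * norm (blinfun_apply A x)" and surj: "\<And>y. \<exists>x. blinfun_apply A x = y"
    and c: "c \<ge> 0"
  shows "\<exists>B. op_inverses A B \<and> norm B \<le> c"
proof -
  obtain b where b: "\<And>y. A (b y) = y" using surj by metis
  have inj: "x = y" if "A x = A y" for x y
    using below[of "x - y"] that by (simp add: blinfun.diff_right)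
  have "bounded_linear b"
  proof (rule bounded_linear_intro)
    show "b (x + y) = b x + b y" for x y by (rule inj) (simp add: b blinfun.add_right)
    show "b (r *\<^sub>R x) = r *\<^sub>R b x" for r x by (rule inj) (simp add: b blinfun.scaleR_right)
    show "norm (b x) \<le> norm x * c" for x using below[of "b x"] by (simp add: b mult.commute)
  qed
  then have B: "blinfun_apply (Blinfun b) = b" by (rule bounded_linear_Blinfun_apply)
  have "op_inverses A (Blinfun b)"
    unfolding op_inverses_def
  proof (intro conjI blinfun_eqI)
    show "(A o\<^sub>L Blinfun b) x = id_blinfun x" for x by (simp add: B b)
    show "(Blinfun b o\<^sub>L A) x = id_blinfun x" for x by (rule inj) (simp add: B b)
  qed
  moreover have "norm (Blinfun b) \<le> c"
    by (rule norm_blinfun_bound[OF c]) (use below[of "b x" for x] in \<open>simp add: B b\<close>)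
  ultimately show ?thesis by blast
qed

text \<open>The contraction \<open>x \<mapsto> y - X x\<close> has a fixed point for every \<open>y\<close>, and \<open>I + X\<close> is bounded below by \<open>1/2\<close>.\<close>

lemma op_inverse_near_id:
  fixes X :: "'a::banach \<Rightarrow>\<^sub>L 'a"
  assumes X: "norm X \<le> 1 / 2"
  shows "\<exists>B. op_inverses (id_blinfun + X) B \<and> norm B \<le> 2"
proof (rule bounded_below_surj_inverse)
  fix x
  have "norm x \<le> norm (x + X x) + norm (X x)"
    using norm_triangle_ineq4[of "x + X x" "X x"] by simp
  also have "norm (X x) \<le> 1 / 2 * norm x"
    using norm_blinfun[of X x] mult_right_mono[OF X, of "norm x"] by simp
  finally show "norm x \<le> 2 * norm ((id_blinfun + X) x)" by (simp add: blinfun.add_left)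
next
  fix y
  have "\<exists>!x. y - X x = x"
  proof (rule banach_fix_type[of "1 / 2"])
    show "\<forall>x z. dist (y - X x) (y - X z) \<le> 1 / 2 * dist x z"
    proof (intro allI)
      fix x z
      have "dist (y - X x) (y - X z) = norm (X (x - z))"
        by (simp add: dist_norm blinfun.diff_right norm_minus_commute)
      also have "\<dots> \<le> 1 / 2 * norm (x - z)"
        using norm_blinfun[of X "x - z"] mult_right_mono[OF X, of "norm (x - z)"] by simp
      finally show "dist (y - X x) (y - X z) \<le> 1 / 2 * dist x z" by (simp add: dist_norm)
    qed
  qed auto
  then obtain x where "y - X x = x" by blast
  then have "(id_blinfun + X) x = y" by (simp add: blinfun.add_left algebra_simps)
  then show "\<exists>x. (id_blinfun + X) x = y" by blast
qed simp

lemma op_inverse_perturb: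
  fixes A :: "'a::banach \<Rightarrow>\<^sub>L 'a"
  assumes AB: "op_inverses A B" and near: "norm B * norm (A' - A) \<le> 1 / 2"
  shows "\<exists>B'. op_inverses A' B' \<and> norm B' \<le> 2 * norm B \<and> norm (B' - B) \<le> 2 * (norm B)\<^sup>2 * norm (A' - A)"
proof -
  note ab = AB[unfolded op_inverses_def]
  define X where "X = B o\<^sub>L (A' - A)"
  have "norm X \<le> 1 / 2" using order_trans[OF norm_blinfun_compose near] by (simp add: X_def)
  then obtain C where C: "op_inverses (id_blinfun + X) C" "norm C \<le> 2" using op_inverse_near_id by blast
  note c = C(1)[unfolded op_inverses_def]
  define B' where "B' = C o\<^sub>L B"
  \<comment> \<open>Perturbations of \<open>A\<close> factor as \<open>A\<close> times a perturbation of the identity.\<close>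
  have fact: "A' = A o\<^sub>L (id_blinfun + X)"
  proof -
    have "A o\<^sub>L X = A' - A" unfolding X_def by (simp add: ab flip: comp_assoc)
    then show ?thesis by (simp add: comp_linear)
  qed
  have "A' o\<^sub>L B' = A o\<^sub>L (((id_blinfun + X) o\<^sub>L C) o\<^sub>L B)" by (simp only: fact B'_def comp_assoc)
  then have 1: "A' o\<^sub>L B' = id_blinfun" by (simp only: c comp_id ab)
  have "B' o\<^sub>L A' = C o\<^sub>L ((B o\<^sub>L A) o\<^sub>L (id_blinfun + X))" by (simp only: fact B'_def comp_assoc)
  then have 2: "B' o\<^sub>L A' = id_blinfun" by (simp only: c comp_id ab)
  have nB': "norm B' \<le> 2 * norm B"
    unfolding B'_def by (rule order_trans[OF norm_blinfun_compose mult_right_mono[OF C(2)]]) simp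
  have "B' - B = - (B' o\<^sub>L ((A' - A) o\<^sub>L B))"
  proof -
    have "B' o\<^sub>L ((A' - A) o\<^sub>L B) = ((B' o\<^sub>L A') o\<^sub>L B) - (B' o\<^sub>L (A o\<^sub>L B))"
      by (simp only: comp_linear comp_assoc)
    also have "\<dots> = B - B'" by (simp only: 2 ab comp_id)
    finally show ?thesis by simp
  qed
  then have "norm (B' - B) \<le> norm B' * (norm (A' - A) * norm B)"
    using order_trans[OF norm_blinfun_compose mult_left_mono[OF norm_blinfun_compose]] by simp
  also have "\<dots> \<le> (2 * norm B) * (norm (A' - A) * norm B)"
    by (intro mult_right_mono nB') simp
  finally show ?thesis
    using 1 2 nB' by (intro exI[of _ B']) (simp add: op_inverses_def power2_eq_square mult_ac)
qed

lemma op_inverse_tendsto: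
  fixes A :: "'s \<Rightarrow> ('a::banach \<Rightarrow>\<^sub>L 'a)"
  assumes A: "(A \<longlongrightarrow> A0) F" and inv0: "op_inverses A0 B0" and inv: "\<forall>\<^sub>F s in F. op_inverses (A s) (B s)"
  shows "(B \<longlongrightarrow> B0) F"
proof -
  have A0: "((\<lambda>s. norm (A s - A0)) \<longlongrightarrow> 0) F" using A by (simp add: LIM_zero_iff tendsto_norm_zero_iff)
  have "((\<lambda>s. norm B0 * norm (A s - A0)) \<longlongrightarrow> norm B0 * 0) F" by (intro tendsto_intros A0)
  then have "\<forall>\<^sub>F s in F. norm B0 * norm (A s - A0) < 1 / 2" by (rule order_tendstoD) simp
  with inv have "\<forall>\<^sub>F s in F. norm (B s - B0) \<le> 2 * (norm B0)\<^sup>2 * norm (A s - A0)"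
  proof eventually_elim
    case (elim s)
    then obtain B' where "op_inverses (A s) B'" "norm (B' - B0) \<le> 2 * (norm B0)\<^sup>2 * norm (A s - A0)"
      using op_inverse_perturb[OF inv0, of "A s"] by auto
    then show ?case using op_inverses_unique[OF elim(1)] by blast
  qed
  moreover have "((\<lambda>s. 2 * (norm B0)\<^sup>2 * norm (A s - A0)) \<longlongrightarrow> 2 * (norm B0)\<^sup>2 * 0) F"
    by (intro tendsto_intros A0)
  ultimately have "((\<lambda>s. B s - B0) \<longlongrightarrow> 0) F"
    by (intro Lim_null_comparison[of "\<lambda>s. B s - B0"]) auto
  then show ?thesis by (simp add: LIM_zero_iff)
qed

lemma has_vector_derivative_iff_quotient:
  "(f has_vector_derivative f') (at s) \<longleftrightarrow> ((\<lambda>r. (f r - f s) /\<^sub>R (r - s)) \<longlongrightarrow> f') (at s)"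
proof -
  have "((\<lambda>r. ((f r - f s) - (r - s) *\<^sub>R f') /\<^sub>R norm (r - s)) \<longlongrightarrow> 0) (at s)
      \<longleftrightarrow> ((\<lambda>r. (f r - f s) /\<^sub>R (r - s) - f') \<longlongrightarrow> 0) (at s)"
  proof (subst (1 2) tendsto_norm_zero_iff[symmetric], rule filterlim_cong[OF refl refl])
    have "norm (((f r - f s) - (r - s) *\<^sub>R f') /\<^sub>R norm (r - s)) = norm ((f r - f s) /\<^sub>R (r - s) - f')"
      if "r \<noteq> s" for r
    proof -
      have "(f r - f s) - (r - s) *\<^sub>R f' = (r - s) *\<^sub>R ((f r - f s) /\<^sub>R (r - s) - f')"
        using that by (simp add: scaleR_diff_right)
      moreover have "\<bar>inverse \<bar>r - s\<bar> * (r - s)\<bar> = 1"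
        using that by (simp add: abs_mult)
      ultimately show ?thesis by simp
    qed
    then show "\<forall>\<^sub>F r in at s. norm (((f r - f s) - (r - s) *\<^sub>R f') /\<^sub>R norm (r - s))
        = norm ((f r - f s) /\<^sub>R (r - s) - f')"
      by (auto simp: eventually_at_filter)
  qed
  then show ?thesis
    unfolding has_vector_derivative_def has_derivative_at_within
    by (simp add: bounded_linear_scaleR_left LIM_zero_iff)
qed

text \<open>The difference quotients of the inverse are \<open>- B r (A r - A s) B s / (r - s)\<close>.\<close>

lemma op_inverse_has_vector_derivative:
  fixes A :: "real \<Rightarrow> ('a::banach \<Rightarrow>\<^sub>L 'a)"
  assumes A: "(A has_vector_derivative A') (at s)" and inv: "\<forall>\<^sub>F r in nhds s. op_inverses (A r) (B r)"
  shows "(B has_vector_derivative - (B s o\<^sub>L (A' o\<^sub>L B s))) (at s)"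
proof -
  have invs: "op_inverses (A s) (B s)" using inv by (rule eventually_nhds_x_imp_x)
  have inv_at: "\<forall>\<^sub>F r in at s. op_inverses (A r) (B r)" using inv by (simp add: eventually_at_filter eventually_mono)
  have contA: "(A \<longlongrightarrow> A s) (at s)"
    using has_vector_derivative_continuous[OF A] by (simp add: continuous_within)
  have B: "(B \<longlongrightarrow> B s) (at s)" by (rule op_inverse_tendsto[OF contA invs inv_at])
  have q: "((\<lambda>r. (A r - A s) /\<^sub>R (r - s)) \<longlongrightarrow> A') (at s)"
    using A by (simp only: has_vector_derivative_iff_quotient)
  have "((\<lambda>r. - (B r o\<^sub>L (((A r - A s) /\<^sub>R (r - s)) o\<^sub>L B s))) \<longlongrightarrow> - (B s o\<^sub>L (A' o\<^sub>L B s))) (at s)"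
    by (intro tendsto_minus bounded_bilinear.tendsto[OF bounded_bilinear_blinfun_compose] B q tendsto_const)
  moreover have "\<forall>\<^sub>F r in at s. - (B r o\<^sub>L (((A r - A s) /\<^sub>R (r - s)) o\<^sub>L B s)) = (B r - B s) /\<^sub>R (r - s)"
    using inv_at
  proof eventually_elim
    case (elim r)
    have "B r o\<^sub>L ((A r - A s) o\<^sub>L B s) = ((B r o\<^sub>L A r) o\<^sub>L B s) - (B r o\<^sub>L (A s o\<^sub>L B s))"
      by (simp only: comp_linear comp_assoc)
    also have "\<dots> = B s - B r"
      using elim invs by (simp add: op_inverses_def)
    finally show ?case
      by (simp add: comp_linear flip: scaleR_minus_right)
  qed
  ultimately show ?thesis
    unfolding has_vector_derivative_iff_quotient by (rule Lim_transform_eventually)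
qed

section \<open>Fredholm determinants along an exhausted basis\<close>

lemma cinner_op_sum:
  assumes "clinear_op T"
  shows "cinner (T (\<Sum>j\<in>F. c j *\<^sub>C j)) (\<Sum>i\<in>F. c i *\<^sub>C i)
    = (\<Sum>i\<in>F. \<Sum>j\<in>F. cnj (c i) * cinner (T j) i * c j)"
proof -
  have "cinner (T (\<Sum>j\<in>F. c j *\<^sub>C j)) (\<Sum>i\<in>F. c i *\<^sub>C i)
      = (\<Sum>i\<in>F. cnj (c i) * (\<Sum>j\<in>F. c j * cinner (T j) i))"
    by (simp only: blinfun.sum_right clinear_opD[OF assms] cinner_sum_left cinner_sum_right
        cinner_scaleC_left cinner_scaleC_right)
  then show ?thesis by (simp add: sum_distrib_left mult_ac)
qed

lemma principal_minor_eq_fdet: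
  assumes "finite F" shows "principal_minor T F = fdet F (\<lambda>a e. cinner (T e) a)"
  using fdet_transpose[OF assms, of "\<lambda>a e. cinner (T a) e"]
  by (simp add: principal_minor_def fdet_def)

lemma norm_op_le_cinner:
  fixes X :: "'h::complex_hilbert \<Rightarrow>\<^sub>L 'h"
  assumes "\<And>h k. norm h \<le> 1 \<Longrightarrow> norm k \<le> 1 \<Longrightarrow> cmod (cinner (X h) k) \<le> c" and "c \<ge> 0"
  shows "norm X \<le> c"
proof (rule norm_blinfun_bound[OF \<open>c \<ge> 0\<close>])
  fix x
  show "norm (X x) \<le> c * norm x"
  proof (cases "x = 0 \<or> X x = 0")
    case False
    define h where "h = x /\<^sub>R norm x"
    define k where "k = X x /\<^sub>R norm (X x)"
    have "cmod (cinner (X h) k) \<le> c" by (rule assms(1)) (use False in \<open>simp_all add: h_def k_def\<close>)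
    moreover have "cinner (X h) k = complex_of_real (norm (X x) / norm x)"
      using False by (simp add: h_def k_def blinfun.scaleR_right cinner_scaleR_left cinner_scaleR_right
          cinner_self power2_eq_square scaleR_conv_of_real field_simps)
    ultimately have "\<bar>norm (X x) / norm x\<bar> \<le> c" by (simp only: norm_of_real)
    then have "norm (X x) / norm x \<le> c" by simp
    then show ?thesis using False by (simp add: field_simps)
  qed (use assms(2) in auto)
qed

context exhausted_basis
begin

text \<open>A quadratic-form version of the trace class: the numerical values of \<open>T\<close> are dominated by those of
  a positive operator \<open>S\<close> of finite trace \<open>K\<close>. It is checked directly for integrals of rank-one operators,
  and passes to the compressions to finite-dimensional subspaces.\<close>

definition dominated :: "('h \<Rightarrow>\<^sub>L 'h) \<Rightarrow> ('h \<Rightarrow>\<^sub>L 'h) \<Rightarrow> real \<Rightarrow> bool"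
  where "dominated T S K \<longleftrightarrow> clinear_op T \<and> clinear_op S \<and>
    (\<forall>h. cinner (S h) h = complex_of_real (Re (cinner (S h) h)) \<and> cmod (cinner (T h) h) \<le> Re (cinner (S h) h)) \<and>
    (\<forall>F. finite F \<longrightarrow> orthonormal F \<longrightarrow> (\<Sum>e\<in>F. Re (cinner (S e) e)) \<le> K) \<and>
    (\<lambda>n. \<Sum>e\<in>G n. Re (cinner (S e) e)) \<longlonglongrightarrow> K"

lemma dominatedD:
  assumes "dominated T S K"
  shows "clinear_op T" "clinear_op S"
    "cinner (S h) h = complex_of_real (Re (cinner (S h) h))" "cmod (cinner (T h) h) \<le> Re (cinner (S h) h)"
    "finite F \<Longrightarrow> orthonormal F \<Longrightarrow> (\<Sum>e\<in>F. Re (cinner (S e) e)) \<le> K"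
    "(\<lambda>n. \<Sum>e\<in>G n. Re (cinner (S e) e)) \<longlonglongrightarrow> K"
    "0 \<le> Re (cinner (S h) h)"
  using assms order_trans[OF norm_ge_zero, of "cinner (T h) h" "Re (cinner (S h) h)"]
  unfolding dominated_def by blast+

text \<open>Scaling rows and columns by \<open>1 / sqrt (\<langle>S e, e\<rangle> + \<delta>)\<close> reduces the bound to a form of trace \<open>card F\<close>, for which the
  exponential is \<open>1\<close>. The shift by \<open>\<delta>\<close>, which tends to \<open>0\<close> at the end, makes \<open>S\<close> positive definite.\<close>

lemma principal_minor_bound:
  assumes dom: "dominated T S K" and F: "finite F" "orthonormal F"
  shows "cmod (principal_minor T F) \<le> (\<Prod>e\<in>F. Re (cinner (S e) e))"
proof -
  define s where "s e = Re (cinner (S e) e)" for e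
  have s0: "s e \<ge> 0" for e using dominatedD(7)[OF dom] by (simp add: s_def)
  have bound: "cmod (principal_minor T F) \<le> (\<Prod>e\<in>F. s e + \<delta>)" if "\<delta> > 0" for \<delta> :: real
  proof -
    define r where "r e = 1 / sqrt (s e + \<delta>)" for e
    define d where "d e = complex_of_real (r e)" for e
    have pos: "s e + \<delta> > 0" for e using s0[of e] that by simp
    have r2: "(r e)\<^sup>2 * (s e + \<delta>) = 1" for e
      using pos[of e] by (simp add: r_def power_divide)
    have r0: "r e > 0" for e using pos[of e] by (simp add: r_def)
    define N where "N i j = d i * cinner (T j) i * d j" for i j
    define S' where "S' i j = d i * (cinner (S j) i + (if i = j then complex_of_real \<delta> else 0)) * d j" for i j
    have "cmod (fdet F N) \<le> exp ((\<Sum>e\<in>F. Re (S' e e)) - real (card F))"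
    proof (rule fdet_dominated[where S = S' and N = N, OF F(1)])
      fix q :: "'h \<Rightarrow> complex" assume "\<exists>e\<in>F. q e \<noteq> 0"
      then obtain e0 where e0: "e0 \<in> F" "q e0 \<noteq> 0" by blast
      define h where "h = (\<Sum>j\<in>F. (q j * d j) *\<^sub>C j)"
      have form: "(\<Sum>i\<in>F. \<Sum>j\<in>F. cnj (q i) * (d i * cinner (A j) i * d j) * q j) = cinner (A h) h"
        if "clinear_op A" for A :: "'h \<Rightarrow>\<^sub>L 'h"
        unfolding h_def cinner_op_sum[OF that] by (intro sum.cong refl) (simp add: d_def)
      let ?D = "\<Sum>i\<in>F. (cmod (q i))\<^sup>2 * (r i)\<^sup>2 * \<delta>"
      have "(\<Sum>i\<in>F. \<Sum>j\<in>F. cnj (q i) * S' i j * q j)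
          = (\<Sum>i\<in>F. \<Sum>j\<in>F. cnj (q i) * (d i * cinner (S j) i * d j) * q j
              + (if i = j then cnj (q i) * q i * (d i)\<^sup>2 * complex_of_real \<delta> else 0))"
        by (intro sum.cong refl) (simp add: S'_def algebra_simps power2_eq_square)
      also have "\<dots> = cinner (S h) h + (\<Sum>i\<in>F. cnj (q i) * q i * (d i)\<^sup>2 * complex_of_real \<delta>)"
        unfolding sum.distrib form[OF dominatedD(2)[OF dom]] using F(1) by simp
      also have "(\<Sum>i\<in>F. cnj (q i) * q i * (d i)\<^sup>2 * complex_of_real \<delta>) = complex_of_real ?D"
        by (simp add: mult_cnj_cmod d_def)
      finally have 1: "(\<Sum>i\<in>F. \<Sum>j\<in>F. cnj (q i) * S' i j * q j) = complex_of_real (Re (cinner (S h) h) + ?D)"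
        using dominatedD(3)[OF dom, of h] by simp
      have "?D > 0"
      proof (rule sum_pos2[OF F(1) e0(1)])
        show "0 < (cmod (q e0))\<^sup>2 * (r e0)\<^sup>2 * \<delta>" using e0 r0[of e0] \<open>\<delta> > 0\<close> by simp
        show "0 \<le> (cmod (q i))\<^sup>2 * (r i)\<^sup>2 * \<delta>" for i using \<open>\<delta> > 0\<close> by simp
      qed
      moreover have "(\<Sum>i\<in>F. \<Sum>j\<in>F. cnj (q i) * N i j * q j) = cinner (T h) h"
        unfolding N_def by (rule form[OF dominatedD(1)[OF dom]])
      ultimately show "\<exists>r>0. (\<Sum>i\<in>F. \<Sum>j\<in>F. cnj (q i) * S' i j * q j) = complex_of_real r \<and>
          cmod (\<Sum>i\<in>F. \<Sum>j\<in>F. cnj (q i) * N i j * q j) \<le> r"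
        using 1 dominatedD(4,7)[OF dom, of h]
        by (intro exI[of _ "Re (cinner (S h) h) + ?D"]) auto
    qed
    also have "(\<Sum>e\<in>F. Re (S' e e)) = real (card F)"
    proof -
      have "Re (S' e e) = 1" for e
      proof -
        have "S' e e = complex_of_real ((r e)\<^sup>2 * (s e + \<delta>))"
          using dominatedD(3)[OF dom, of e]
          by (simp add: S'_def d_def s_def power2_eq_square algebra_simps)
        then show ?thesis unfolding r2 by simp
      qed
      then show ?thesis by simp
    qed
    finally have "cmod (fdet F N) \<le> 1" by simp
    moreover have "fdet F N = (\<Prod>e\<in>F. d e)\<^sup>2 * principal_minor T F"
      unfolding N_def principal_minor_eq_fdet[OF F(1)] by (rule fdet_scale[OF F(1)])
    ultimately have "(\<Prod>e\<in>F. r e)\<^sup>2 * cmod (principal_minor T F) \<le> 1"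
      using r0 by (simp add: norm_mult norm_power prod_norm[symmetric] d_def less_imp_le)
    then have "(\<Prod>e\<in>F. s e + \<delta>) * ((\<Prod>e\<in>F. r e)\<^sup>2 * cmod (principal_minor T F)) \<le> (\<Prod>e\<in>F. s e + \<delta>) * 1"
      using pos by (intro mult_left_mono prod_nonneg) (auto simp: less_imp_le)
    moreover have "(\<Prod>e\<in>F. s e + \<delta>) * (\<Prod>e\<in>F. r e)\<^sup>2 = 1"
      unfolding prod_power_distrib prod.distrib[symmetric] using r2 by (simp add: mult.commute)
    ultimately show ?thesis by (simp add: mult.assoc[symmetric])
  qed
  have "((\<lambda>\<delta>. \<Prod>e\<in>F. s e + \<delta>) \<longlongrightarrow> (\<Prod>e\<in>F. s e + 0)) (at_right 0)"
    by (intro tendsto_intros)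
  moreover have "\<forall>\<^sub>F \<delta> in at_right 0. cmod (principal_minor T F) \<le> (\<Prod>e\<in>F. s e + \<delta>)"
    using bound by (auto simp: eventually_at_right_field intro!: exI[of _ 1])
  ultimately have "cmod (principal_minor T F) \<le> (\<Prod>e\<in>F. s e + 0)"
    by (intro tendsto_lowerbound) auto
  then show ?thesis by (simp add: s_def)
qed

text \<open>The bounds by products of the diagonal of \<open>S\<close> are the terms in the expansion of
  \<open>\<Prod>(1 + \<langle>S e, e\<rangle>) \<le> exp K\<close>.\<close>

lemma principal_minor_summable:
  assumes dom: "dominated T S K"
  shows "principal_minor T summable_on {F. finite F \<and> F \<subseteq> E}"
proof (rule abs_summable_summable, rule nonneg_bdd_above_summable_on)
  define s where "s e = Re (cinner (S e) e)" for e
  have s0: "s e \<ge> 0" for e using dominatedD(7)[OF dom] by (simp add: s_def)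
  show "bdd_above (sum (\<lambda>F. norm (principal_minor T F)) ` {X. X \<subseteq> {F. finite F \<and> F \<subseteq> E} \<and> finite X})"
  proof (rule bdd_aboveI2)
    fix X assume X: "X \<in> {X. X \<subseteq> {F. finite F \<and> F \<subseteq> E} \<and> finite X}"
    define U where "U = \<Union>X"
    have U: "finite U" "U \<subseteq> E" using X by (auto simp: U_def)
    have on: "orthonormal F" if "F \<subseteq> E" for F using orthonormal_E that orthonormal_subset by blast
    have "(\<Sum>F\<in>X. norm (principal_minor T F)) \<le> (\<Sum>F\<in>X. \<Prod>e\<in>F. s e)"
      using X unfolding s_def by (intro sum_mono principal_minor_bound[OF dom] on) auto
    also have "\<dots> \<le> (\<Sum>F\<in>Pow U. \<Prod>e\<in>F. s e)"
      using U s0 by (intro sum_mono2) (auto simp: U_def intro!: prod_nonneg)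
    also have "\<dots> = (\<Prod>e\<in>U. s e + 1)"
      using prod_add[OF U(1), of s "\<lambda>_. 1"] by simp
    also have "\<dots> \<le> (\<Prod>e\<in>U. exp (s e))"
    proof (rule prod_mono)
      show "0 \<le> s e + 1 \<and> s e + 1 \<le> exp (s e)" for e
        using s0[of e] exp_ge_add_one_self[of "s e"] by linarith
    qed
    also have "\<dots> = exp (\<Sum>e\<in>U. s e)" using exp_sum[OF U(1), of s] by simp
    also have "\<dots> \<le> exp K" using dominatedD(5)[OF dom U(1) on[OF U(2)]] by (simp add: s_def)
    finally show "(\<Sum>F\<in>X. norm (principal_minor T F)) \<le> exp K" .
  qed
qed simp

lemma finite_subset_G:
  assumes "finite U" "U \<subseteq> E" shows "\<exists>m. U \<subseteq> G m"
  using assms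
proof (induction U rule: finite_induct)
  case (insert e U)
  then obtain m k where "U \<subseteq> G m" "e \<in> G k" using Union_G by blast
  then have "insert e U \<subseteq> G (max m k)"
    using mono_G[of m "max m k"] mono_G[of k "max m k"] by auto
  then show ?case by blast
qed simp

text \<open>The matrix of the compression of \<open>I + T\<close>, acting on coordinate columns.\<close>

definition mat_plus_id :: "('h \<Rightarrow>\<^sub>L 'h) \<Rightarrow> 'h \<Rightarrow> 'h \<Rightarrow> complex"
  where "mat_plus_id T a e = (if a = e then 1 else 0) + cinner (T e) a"

definition detn :: "nat \<Rightarrow> ('h \<Rightarrow>\<^sub>L 'h) \<Rightarrow> complex"
  where "detn n T = fdet (G n) (mat_plus_id T)"

text \<open>\<open>detn n T\<close> is the partial sum of the Fredholm series over the subsets of \<open>G n\<close>, and every finite subset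
  of \<open>E\<close> is eventually contained in \<open>G n\<close>.\<close>

lemma detn_tendsto_infsum:
  assumes dom: "dominated T S K"
  shows "(\<lambda>n. detn n T) \<longlonglongrightarrow> infsum (principal_minor T) {F. finite F \<and> F \<subseteq> E}"
proof -
  let ?A = "{F. finite F \<and> F \<subseteq> E}"
  have "(principal_minor T has_sum infsum (principal_minor T) ?A) ?A"
    using principal_minor_summable[OF dom] by (rule has_sum_infsum)
  then have lim: "(sum (principal_minor T) \<longlongrightarrow> infsum (principal_minor T) ?A) (finite_subsets_at_top ?A)"
    by (simp add: has_sum_def)
  have "filterlim (\<lambda>n. Pow (G n)) (finite_subsets_at_top ?A) sequentially"
    unfolding filterlim_iff
  proof (intro allI impI)
    fix P assume "\<forall>\<^sub>F X in finite_subsets_at_top ?A. P X"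
    then obtain X where X: "finite X" "X \<subseteq> ?A" "\<forall>Y. finite Y \<and> X \<subseteq> Y \<and> Y \<subseteq> ?A \<longrightarrow> P Y"
      unfolding eventually_finite_subsets_at_top by (elim exE conjE)
    have "finite (\<Union>X)" "\<Union>X \<subseteq> E" using X by auto
    then obtain m where m: "\<Union>X \<subseteq> G m" using finite_subset_G by blast
    have "P (Pow (G n))" if "n \<ge> m" for n
    proof (rule X(3)[rule_format], intro conjI)
      show "finite (Pow (G n))" using finite_G by simp
      show "X \<subseteq> Pow (G n)" using m mono_G[OF that] by blast
      show "Pow (G n) \<subseteq> ?A" using finite_G G_subset finite_subset by blast
    qed
    then show "\<forall>\<^sub>F n in sequentially. P (Pow (G n))" by (auto simp: eventually_sequentially)
  qed
  from filterlim_compose[OF lim this]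
  have "(\<lambda>n. \<Sum>F\<in>Pow (G n). principal_minor T F) \<longlonglongrightarrow> infsum (principal_minor T) ?A" .
  moreover have "(\<Sum>F\<in>Pow (G n). principal_minor T F) = detn n T" for n
  proof -
    have "(\<Sum>F\<in>Pow (G n). principal_minor T F) = (\<Sum>F\<in>Pow (G n). fdet F (\<lambda>a e. cinner (T e) a))"
      using finite_G finite_subset by (intro sum.cong refl principal_minor_eq_fdet) blast
    also have "\<dots> = detn n T"
      unfolding detn_def mat_plus_id_def[abs_def] by (rule fdet_identity_plus[OF finite_G, symmetric])
    finally show ?thesis .
  qed
  ultimately show ?thesis by simp
qed

text \<open>The numerical values of \<open>I + T\<close> are dominated by those of \<open>I + S\<close>, whose compressed trace exceeds the
  dimension by at most \<open>K\<close>.\<close>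

lemma detn_bound:
  assumes dom: "dominated T S K"
  shows "cmod (detn n T) \<le> exp K"
proof -
  have "cmod (detn n T) \<le> exp ((\<Sum>e\<in>G n. Re (mat_plus_id S e e)) - real (card (G n)))"
    unfolding detn_def
  proof (rule fdet_dominated[where S = "mat_plus_id S" and N = "mat_plus_id T", OF finite_G])
    fix q :: "'h \<Rightarrow> complex" assume "\<exists>e\<in>G n. q e \<noteq> 0"
    then obtain e0 where e0: "e0 \<in> G n" "q e0 \<noteq> 0" by blast
    define h where "h = (\<Sum>j\<in>G n. q j *\<^sub>C j)"
    let ?D = "\<Sum>i\<in>G n. (cmod (q i))\<^sup>2"
    have form: "(\<Sum>i\<in>G n. \<Sum>j\<in>G n. cnj (q i) * mat_plus_id A i j * q j) = complex_of_real ?D + cinner (A h) h"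
      if "clinear_op A" for A :: "'h \<Rightarrow>\<^sub>L 'h"
    proof -
      have "(\<Sum>i\<in>G n. \<Sum>j\<in>G n. cnj (q i) * mat_plus_id A i j * q j)
          = (\<Sum>i\<in>G n. \<Sum>j\<in>G n. (if i = j then cnj (q i) * q i else 0) + cnj (q i) * cinner (A j) i * q j)"
        by (intro sum.cong refl) (auto simp: mat_plus_id_def algebra_simps)
      also have "\<dots> = (\<Sum>i\<in>G n. cnj (q i) * q i) + cinner (A h) h"
        unfolding sum.distrib h_def cinner_op_sum[OF that] using finite_G by simp
      finally show ?thesis by (simp add: mult_cnj_cmod)
    qed
    have "?D > 0" by (rule sum_pos2[OF finite_G e0(1)]) (use e0 in auto)
    have 1: "(\<Sum>i\<in>G n. \<Sum>j\<in>G n. cnj (q i) * mat_plus_id S i j * q j) = complex_of_real (?D + Re (cinner (S h) h))"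
      unfolding form[OF dominatedD(2)[OF dom]] of_real_add by (subst dominatedD(3)[OF dom]) simp
    have "cmod (complex_of_real ?D + cinner (T h) h) \<le> \<bar>?D\<bar> + Re (cinner (S h) h)"
      using norm_triangle_ineq[of "complex_of_real ?D" "cinner (T h) h"] dominatedD(4)[OF dom, of h]
      unfolding norm_of_real by linarith
    then have 2: "cmod (\<Sum>i\<in>G n. \<Sum>j\<in>G n. cnj (q i) * mat_plus_id T i j * q j) \<le> ?D + Re (cinner (S h) h)"
      unfolding form[OF dominatedD(1)[OF dom]] using \<open>?D > 0\<close> by linarith
    have "?D + Re (cinner (S h) h) > 0" using \<open>?D > 0\<close> dominatedD(7)[OF dom, of h] by linarith
    with 1 2 show "\<exists>r>0. (\<Sum>i\<in>G n. \<Sum>j\<in>G n. cnj (q i) * mat_plus_id S i j * q j) = complex_of_real r \<and>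
        cmod (\<Sum>i\<in>G n. \<Sum>j\<in>G n. cnj (q i) * mat_plus_id T i j * q j) \<le> r" by blast
  qed
  also have "(\<Sum>e\<in>G n. Re (mat_plus_id S e e)) - real (card (G n)) = (\<Sum>e\<in>G n. Re (cinner (S e) e))"
    by (simp add: mat_plus_id_def sum.distrib)
  also have "\<dots> \<le> K" by (rule dominatedD(5)[OF dom finite_G orthonormal_G])
  finally show ?thesis by simp
qed

text \<open>Perturbing by a rank-one operator adds half the squared norms of its factors to the trace.\<close>

lemma dominated_add_rank1:
  assumes dom: "dominated T S K" and z: "cmod z \<le> 1"
  shows "dominated (T + z *\<^sub>C rank1 x y) (S + (1 / 2) *\<^sub>R (rank1 x x + rank1 y y)) (K + ((norm x)\<^sup>2 + (norm y)\<^sup>2) / 2)"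
    (is "dominated ?T ?S ?K")
proof -
  have rank1_self: "cinner (rank1 v v h) h = complex_of_real ((cmod (cinner h v))\<^sup>2)" for v h :: 'h
    by (simp add: rank1_apply cinner_scaleC_left mult_cnj_cmod cinner_commute[of v h])
  have S': "cinner (?S h) h = cinner (S h) h + complex_of_real (((cmod (cinner h x))\<^sup>2 + (cmod (cinner h y))\<^sup>2) / 2)" for h
    by (simp add: blinfun.add_left blinfun.scaleR_left cinner_add_left cinner_scaleR_left rank1_self scaleR_conv_of_real)
  have Re_S': "Re (cinner (?S h) h) = Re (cinner (S h) h) + ((cmod (cinner h x))\<^sup>2 + (cmod (cinner h y))\<^sup>2) / 2" for h
    by (simp add: S')
  have cmod_T': "cmod (cinner (?T h) h) \<le> Re (cinner (?S h) h)" for h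
  proof -
    have "cinner (?T h) h = cinner (T h) h + z * (cinner h y * cinner x h)"
      by (simp add: blinfun.add_left scaleC_blinfun.rep_eq cinner_add_left cinner_scaleC_left rank1_apply)
    then have "cmod (cinner (?T h) h) \<le> cmod (cinner (T h) h) + cmod (z * (cinner h y * cinner x h))"
      by (simp add: norm_triangle_ineq)
    also have "cmod (z * (cinner h y * cinner x h)) \<le> 1 * (cmod (cinner h y) * cmod (cinner h x))"
      unfolding norm_mult using z by (intro mult_mono) (simp_all add: cmod_cinner_commute[of x h])
    also have "1 * (cmod (cinner h y) * cmod (cinner h x)) \<le> ((cmod (cinner h x))\<^sup>2 + (cmod (cinner h y))\<^sup>2) / 2"
      using sum_squares_bound[of "cmod (cinner h x)" "cmod (cinner h y)"] by (simp add: mult_ac)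
    finally show ?thesis unfolding Re_S' using dominatedD(4)[OF dom, of h] by linarith
  qed
  show ?thesis
    unfolding dominated_def
  proof (intro conjI allI impI)
    show "clinear_op ?T" by (intro clinear_add clinear_scaleC clinear_rank1 dominatedD(1)[OF dom])
    show "clinear_op ?S" by (intro clinear_add clinear_scaleR clinear_rank1 dominatedD(2)[OF dom])
    show "cinner (?S h) h = complex_of_real (Re (cinner (?S h) h))" for h
      unfolding Re_S' unfolding S' of_real_add using dominatedD(3)[OF dom, of h] by simp
    show "cmod (cinner (?T h) h) \<le> Re (cinner (?S h) h)" for h by (rule cmod_T')
    have sum_eq: "(\<Sum>e\<in>F. Re (cinner (?S e) e)) = (\<Sum>e\<in>F. Re (cinner (S e) e))
        + ((\<Sum>e\<in>F. (cmod (cinner x e))\<^sup>2) + (\<Sum>e\<in>F. (cmod (cinner y e))\<^sup>2)) / 2" for F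
      unfolding Re_S' sum.distrib sum_divide_distrib[symmetric]
      by (simp only: cmod_cinner_commute[of _ x] cmod_cinner_commute[of _ y])
    show "(\<Sum>e\<in>F. Re (cinner (?S e) e)) \<le> ?K" if "finite F" "orthonormal F" for F
      unfolding sum_eq
      using dominatedD(5)[OF dom that] Bessel_inequality[OF that(2,1), of x] Bessel_inequality[OF that(2,1), of y]
      by argo
    show "(\<lambda>n. \<Sum>e\<in>G n. Re (cinner (?S e) e)) \<longlonglongrightarrow> ?K"
      unfolding sum_eq by (intro tendsto_intros dominatedD(6)[OF dom] Parseval) simp
  qed
qed

end

context exhausted_basis
begin

section \<open>Compressions converge in norm\<close>

definition proj :: "nat \<Rightarrow> ('h \<Rightarrow>\<^sub>L 'h)"
  where "proj n = (\<Sum>e\<in>G n. rank1 e e)"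

lemma proj_apply: "proj n x = (\<Sum>e\<in>G n. cinner x e *\<^sub>C e)"
  by (simp add: proj_def blinfun.sum_left rank1_apply)

lemma cinner_proj: "e \<in> G n \<Longrightarrow> cinner (proj n x) e = cinner x e"
  unfolding proj_apply by (rule cinner_orthonormal_sum[OF orthonormal_G finite_G])

lemma proj_selfadjoint: "cinner (proj n x) y = cinner x (proj n y)"
  unfolding proj_apply cinner_sum_left cinner_sum_right cinner_scaleC_left cinner_scaleC_right
  by (intro sum.cong refl) (metis cinner_commute mult.commute)

lemma proj_orthogonal: "e \<in> G n \<Longrightarrow> cinner (x - proj n x) e = 0"
  by (simp add: cinner_diff_left cinner_proj)

lemma proj_span: "proj n (\<Sum>e\<in>G n. a e *\<^sub>C e) = (\<Sum>e\<in>G n. a e *\<^sub>C e)"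
  unfolding proj_apply by (intro sum.cong refl) (simp add: cinner_orthonormal_sum orthonormal_G finite_G)

lemma proj_proj [simp]: "proj n (proj n x) = proj n x"
  using proj_span[of n "cinner x"] by (simp only: proj_apply)

lemma norm_minus_proj_le: "norm (x - proj n x) \<le> norm x"
proof (rule power2_le_imp_le)
  show "(norm (x - proj n x))\<^sup>2 \<le> (norm x)\<^sup>2"
    unfolding proj_apply norm_minus_projection[OF orthonormal_G finite_G] by (simp add: sum_nonneg)
qed simp

lemma norm_proj_le: "norm (proj n x) \<le> norm x"
proof (rule power2_le_imp_le)
  show "(norm (proj n x))\<^sup>2 \<le> (norm x)\<^sup>2"
    unfolding proj_apply norm_orthonormal_sum[OF orthonormal_G finite_G]
    by (rule Bessel_inequality[OF orthonormal_G finite_G])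
qed simp

lemma proj_tendsto: "(\<lambda>n. proj n x) \<longlonglongrightarrow> x"
  unfolding proj_apply by (rule Fourier_expansion)

definition compress :: "nat \<Rightarrow> ('h \<Rightarrow>\<^sub>L 'h) \<Rightarrow> ('h \<Rightarrow>\<^sub>L 'h)"
  where "compress n T = proj n o\<^sub>L (T o\<^sub>L proj n)"

text \<open>Polarisation, with the quadratic form of \<open>S\<close> being subject to the parallelogram law.\<close>

lemma dominated_sesquilinear:
  assumes dom: "dominated T S K"
  shows "cmod (cinner (T h) k) \<le> Re (cinner (S h) h) + Re (cinner (S k) k)"
proof -
  let ?q = "\<lambda>A c. cinner (A (h + c *\<^sub>C k)) (h + c *\<^sub>C k)"
  have expand: "?q A c = cinner (A h) h + cnj c * cinner (A h) k + c * cinner (A k) h + (c * cnj c) * cinner (A k) k"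
    if "clinear_op A" for A :: "'h \<Rightarrow>\<^sub>L 'h" and c
    by (simp add: blinfun.add_right clinear_opD[OF that] cinner_add_left cinner_add_right
        cinner_scaleC_left cinner_scaleC_right algebra_simps)
  note T = expand[OF dominatedD(1)[OF dom]] and S = expand[OF dominatedD(2)[OF dom]]
  have "4 * cinner (T h) k = ?q T 1 - ?q T (-1) + \<i> * ?q T \<i> - \<i> * ?q T (- \<i>)"
    unfolding T by (simp add: algebra_simps)
  then have "4 * cmod (cinner (T h) k) = cmod (?q T 1 - ?q T (-1) + \<i> * ?q T \<i> - \<i> * ?q T (- \<i>))"
    by (metis norm_mult norm_numeral)
  also have "\<dots> \<le> cmod (?q T 1) + cmod (?q T (-1)) + cmod (\<i> * ?q T \<i>) + cmod (\<i> * ?q T (- \<i>))"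
    by (intro order_trans[OF norm_triangle_ineq4] add_mono order_trans[OF norm_triangle_ineq] order_refl)
  also have "\<dots> = cmod (?q T 1) + cmod (?q T (-1)) + cmod (?q T \<i>) + cmod (?q T (- \<i>))"
    by (simp add: norm_mult)
  also have "\<dots> \<le> Re (?q S 1) + Re (?q S (-1)) + Re (?q S \<i>) + Re (?q S (- \<i>))"
    by (intro add_mono dominatedD(4)[OF dom])
  also have "\<dots> = 4 * Re (cinner (S h) h) + 4 * Re (cinner (S k) k)"
    unfolding S by simp
  finally show ?thesis by simp
qed

text \<open>Replacing \<open>h\<close> and \<open>k\<close> by \<open>t h\<close> and \<open>k / t\<close> lets one of the two forms be small without the other being so.\<close>

lemma dominated_sesquilinear_scaled:
  assumes dom: "dominated T S K" and "t > 0"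
  shows "cmod (cinner (T h) k) \<le> t\<^sup>2 * Re (cinner (S h) h) + Re (cinner (S k) k) / t\<^sup>2"
proof -
  have "cinner (T (t *\<^sub>R h)) (k /\<^sub>R t) = cinner (T h) k"
    using \<open>t > 0\<close> by (simp add: blinfun.scaleR_right cinner_scaleR_left cinner_scaleR_right)
  moreover have "cinner (S (r *\<^sub>R v)) (r *\<^sub>R v) = r\<^sup>2 *\<^sub>R cinner (S v) v" for r v
    by (simp add: blinfun.scaleR_right cinner_scaleR_left cinner_scaleR_right power2_eq_square)
  ultimately show ?thesis
    using dominated_sesquilinear[OF dom, of "t *\<^sub>R h" "k /\<^sub>R t"] \<open>t > 0\<close>
    by (simp add: power_inverse divide_inverse mult.commute)
qed

text \<open>A unit vector orthogonal to \<open>G n\<close> extends \<open>G n\<close> to an orthonormal set, so that its quadratic form is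
  at most the part of the trace that \<open>G n\<close> leaves over.\<close>

lemma dominated_tail:
  assumes dom: "dominated T S K" and orth: "\<And>e. e \<in> G n \<Longrightarrow> cinner h e = 0" and h: "norm h \<le> 1"
  shows "Re (cinner (S h) h) \<le> K - (\<Sum>e\<in>G n. Re (cinner (S e) e))"
proof (cases "h = 0")
  case True
  then show ?thesis using dominatedD(5)[OF dom finite_G orthonormal_G] by simp
next
  case False
  define u where "u = h /\<^sub>R norm h"
  have uu: "cinner u u = 1" using False by (simp add: u_def cinner_self)
  have ue: "cinner u e = 0" "cinner e u = 0" if "e \<in> G n" for e
    using orth[OF that] cinner_commute[of e h] by (auto simp: u_def cinner_scaleR_left cinner_scaleR_right)
  have "u \<notin> G n" using ue uu by fastforce
  have "orthonormal (insert u (G n))"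
    using orthonormal_G[of n] ue uu unfolding orthonormal_def by auto
  from dominatedD(5)[OF dom _ this]
  have "Re (cinner (S u) u) \<le> K - (\<Sum>e\<in>G n. Re (cinner (S e) e))"
    using finite_G \<open>u \<notin> G n\<close> by simp
  moreover have "Re (cinner (S h) h) = (norm h)\<^sup>2 * Re (cinner (S u) u)"
  proof -
    have "norm h *\<^sub>R u = h" using False by (simp add: u_def)
    moreover have "Re (cinner (S (norm h *\<^sub>R u)) (norm h *\<^sub>R u)) = (norm h)\<^sup>2 * Re (cinner (S u) u)"
      by (simp add: blinfun.scaleR_right cinner_scaleR_left cinner_scaleR_right power2_eq_square)
    ultimately show ?thesis by simp
  qed
  moreover have "(norm h)\<^sup>2 * Re (cinner (S u) u) \<le> 1 * Re (cinner (S u) u)"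
    using h dominatedD(7)[OF dom, of u] by (intro mult_right_mono) (simp_all add: power_le_one)
  ultimately show ?thesis by linarith
qed

text \<open>With \<open>P = proj n\<close>, in \<open>T - P T P = T (1 - P) + (1 - P) T P\<close> one argument of each sesquilinear form is orthogonal to \<open>G n\<close>,
  so its quadratic form is a small tail of the trace; the scaling parameter \<open>t\<close> balances this against the other
  argument, which is only bounded.\<close>

lemma compress_tendsto:
  assumes dom: "dominated T S K"
  shows "(\<lambda>n. compress n T) \<longlonglongrightarrow> T"
proof -
  define \<epsilon> where "\<epsilon> n = K - (\<Sum>e\<in>G n. Re (cinner (S e) e))" for n
  have \<epsilon>0: "\<epsilon> n \<ge> 0" for n using dominatedD(5)[OF dom finite_G orthonormal_G] by (simp add: \<epsilon>_def)
  have \<epsilon>: "\<epsilon> \<longlonglongrightarrow> 0"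
    using tendsto_diff[OF tendsto_const dominatedD(6)[OF dom], of K] by (simp add: \<epsilon>_def[abs_def])
  define L where "L = norm S + 1"
  have "L > 0" by (simp add: L_def add_nonneg_pos)
  have S_le: "Re (cinner (S k) k) \<le> L" if "norm k \<le> 1" for k
  proof -
    have "Re (cinner (S k) k) \<le> norm (S k) * norm k"
      using complex_Re_le_cmod cinner_Cauchy_Schwarz order_trans by blast
    also have "\<dots> \<le> (norm S * 1) * 1"
      using that by (intro mult_mono order_trans[OF norm_blinfun]) (auto intro: mult_left_mono)
    finally show ?thesis by (simp add: L_def)
  qed
  have tail: "Re (cinner (S (h - proj n h)) (h - proj n h)) \<le> \<epsilon> n" if "norm h \<le> 1" for h n
    unfolding \<epsilon>_def using that
    by (intro dominated_tail[OF dom] proj_orthogonal order_trans[OF norm_minus_proj_le])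
  have bound: "norm (T - compress n T) \<le> 2 * (t\<^sup>2 * \<epsilon> n + L / t\<^sup>2)" if "t > 0" for t n
  proof (rule norm_op_le_cinner)
    fix h k :: 'h assume h: "norm h \<le> 1" and k: "norm k \<le> 1"
    let ?h' = "h - proj n h" and ?k' = "k - proj n k"
    have "cinner ((T - compress n T) h) k = cinner (T ?h') k + cinner (T (proj n h)) ?k'"
      by (simp add: compress_def blinfun.diff_left blinfun.diff_right cinner_diff_left cinner_diff_right proj_selfadjoint)
    then have 1: "cmod (cinner ((T - compress n T) h) k) \<le> cmod (cinner (T ?h') k) + cmod (cinner (T (proj n h)) ?k')"
      by (simp add: norm_triangle_ineq)
    have 2: "cmod (cinner (T ?h') k) \<le> t\<^sup>2 * \<epsilon> n + L / t\<^sup>2"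
      by (rule order_trans[OF dominated_sesquilinear_scaled[OF dom \<open>t > 0\<close>]])
        (intro add_mono mult_left_mono divide_right_mono tail S_le h k; simp)
    have 3: "cmod (cinner (T (proj n h)) ?k') \<le> t\<^sup>2 * \<epsilon> n + L / t\<^sup>2"
    proof -
      have "1 / t > 0" using \<open>t > 0\<close> by simp
      have "cmod (cinner (T (proj n h)) ?k') \<le> (1 / t)\<^sup>2 * L + \<epsilon> n / (1 / t)\<^sup>2"
        by (rule order_trans[OF dominated_sesquilinear_scaled[OF dom \<open>1 / t > 0\<close>]])
          (intro add_mono mult_left_mono divide_right_mono tail S_le k order_trans[OF norm_proj_le h]; simp)
      then show ?thesis by (simp add: power_divide field_simps)
    qed
    show "cmod (cinner ((T - compress n T) h) k) \<le> 2 * (t\<^sup>2 * \<epsilon> n + L / t\<^sup>2)"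
      unfolding mult_2 by (rule order_trans[OF 1 add_mono[OF 2 3]])
  qed (use \<epsilon>0 \<open>L > 0\<close> in \<open>simp add: less_imp_le\<close>)
  show ?thesis
  proof (rule LIMSEQ_I)
    fix r :: real assume "r > 0"
    define t where "t = sqrt (8 * L / r)"
    have "t > 0" using \<open>L > 0\<close> \<open>r > 0\<close> by (simp add: t_def)
    have t2: "t\<^sup>2 = 8 * L / r" using \<open>L > 0\<close> \<open>r > 0\<close> by (simp add: t_def)
    have "(\<lambda>n. t\<^sup>2 * \<epsilon> n) \<longlonglongrightarrow> t\<^sup>2 * 0" by (intro tendsto_intros \<epsilon>)
    then have "\<forall>\<^sub>F n in sequentially. t\<^sup>2 * \<epsilon> n < r / 8" by (rule order_tendstoD) (use \<open>r > 0\<close> in simp)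
    then obtain N where N: "\<And>n. n \<ge> N \<Longrightarrow> t\<^sup>2 * \<epsilon> n < r / 8" by (auto simp: eventually_sequentially)
    have "L / t\<^sup>2 = r / 8" using \<open>L > 0\<close> \<open>r > 0\<close> by (simp add: t2)
    then have "norm (compress n T - T) < r" if "n \<ge> N" for n
      using bound[OF \<open>t > 0\<close>, of n] N[OF that] \<open>r > 0\<close> by (simp add: norm_minus_commute)
    then show "\<exists>N. \<forall>n\<ge>N. norm (compress n T - T) < r" by blast
  qed
qed

section \<open>Derivatives of the compressed determinants\<close>

text \<open>The derivative of \<open>detn n\<close> at \<open>T\<close> in the direction of the rank-one operator \<open>rank1 x y\<close>.\<close>

definition rank1_derivative :: "nat \<Rightarrow> ('h \<Rightarrow>\<^sub>L 'h) \<Rightarrow> 'h \<Rightarrow> 'h \<Rightarrow> complex"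
  where "rank1_derivative n T x y =
    (\<Sum>i\<in>G n. \<Sum>j\<in>G n. cinner (rank1 x y j) i * cof (G n) (mat_plus_id T) i j)"

lemma rank1_derivative_scaleR:
  "rank1_derivative n T (a *\<^sub>R x) (b *\<^sub>R y) = (a * b) *\<^sub>R rank1_derivative n T x y"
  by (simp add: rank1_derivative_def rank1_apply cinner_scaleC_left cinner_scaleR_left cinner_scaleR_right
      scaleR_sum_right mult_ac)

lemma detn_has_derivative:
  assumes T: "(T has_vector_derivative (\<Sum>k\<in>I. rank1 (x k) (y k))) (at s within U)"
  shows "((\<lambda>s. detn n (T s)) has_vector_derivative (\<Sum>k\<in>I. rank1_derivative n (T s) (x k) (y k))) (at s within U)"
proof -
  let ?T' = "\<Sum>k\<in>I. rank1 (x k) (y k)"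
  have entry: "((\<lambda>s. mat_plus_id (T s) i j) has_derivative (\<lambda>h. h *\<^sub>R cinner (?T' j) i)) (at s within U)" for i j
  proof -
    have bl: "bounded_linear (\<lambda>T. cinner (blinfun_apply T j) i)"
      by (rule bounded_linear_compose[OF bounded_linear_cinner_left blinfun.bounded_linear_left])
    have "((\<lambda>s. cinner (T s j) i) has_vector_derivative cinner (?T' j) i) (at s within U)"
      by (rule bounded_linear.has_vector_derivative[OF bl T])
    then have "((\<lambda>s. (if i = j then 1 else 0) + cinner (T s j) i) has_vector_derivative 0 + cinner (?T' j) i) (at s within U)"
      by (intro has_vector_derivative_add has_vector_derivative_const)
    then show ?thesis by (simp add: mat_plus_id_def has_vector_derivative_def)
  qed
  have "((\<lambda>s. detn n (T s)) has_derivative (\<lambda>h. \<Sum>i\<in>G n. \<Sum>j\<in>G n.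
      (h *\<^sub>R cinner (?T' j) i) * cof (G n) (mat_plus_id (T s)) i j)) (at s within U)"
    unfolding detn_def by (rule fdet_has_derivative[OF finite_G entry])
  moreover have "(\<Sum>i\<in>G n. \<Sum>j\<in>G n. (h *\<^sub>R cinner (?T' j) i) * cof (G n) (mat_plus_id (T s)) i j)
      = h *\<^sub>R (\<Sum>k\<in>I. rank1_derivative n (T s) (x k) (y k))" for h
  proof -
    have "(\<Sum>k\<in>I. rank1_derivative n (T s) (x k) (y k))
        = (\<Sum>i\<in>G n. \<Sum>j\<in>G n. \<Sum>k\<in>I. cinner (rank1 (x k) (y k) j) i * cof (G n) (mat_plus_id (T s)) i j)"
      unfolding rank1_derivative_def sum.swap[of _ I] ..
    also have "\<dots> = (\<Sum>i\<in>G n. \<Sum>j\<in>G n. cinner (?T' j) i * cof (G n) (mat_plus_id (T s)) i j)"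
      by (simp add: blinfun.sum_left cinner_sum_left sum_distrib_right)
    finally show ?thesis by (simp add: scaleR_sum_right)
  qed
  ultimately show ?thesis by (simp add: has_vector_derivative_def)
qed

text \<open>\<open>z \<mapsto> detn n (T + z rank1 x y)\<close> is entire and bounded by \<open>exp (K + 1)\<close> on the unit circle, since a
  rank-one term costs at most \<open>1\<close> in the trace. Cauchy's inequality bounds its derivative at \<open>0\<close>. The bound is
  uniform in \<open>n\<close>, although the cofactors themselves are not controlled one by one.\<close>

lemma rank1_derivative_bound_unit:
  assumes dom: "dominated T S K" and x: "norm x \<le> 1" and y: "norm y \<le> 1"
  shows "cmod (rank1_derivative n T x y) \<le> exp (K + 1)"
proof -
  define f where "f z = detn n (T + z *\<^sub>C rank1 x y)" for z
  have deriv: "(f has_field_derivative (\<Sum>i\<in>G n. \<Sum>j\<in>G n. cinner (rank1 x y j) i *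
      cof (G n) (mat_plus_id (T + z *\<^sub>C rank1 x y)) i j)) (at z)" for z
  proof -
    have "((\<lambda>z. mat_plus_id (T + z *\<^sub>C rank1 x y) i j) has_derivative (\<lambda>h. h * cinner (rank1 x y j) i)) (at z)" for i j
      unfolding mat_plus_id_def blinfun.add_left scaleC_blinfun.rep_eq cinner_add_left cinner_scaleC_left
      by (auto intro!: derivative_eq_intros)
    from fdet_has_derivative[OF finite_G this]
    have "(f has_derivative (\<lambda>h. \<Sum>i\<in>G n. \<Sum>j\<in>G n. h * cinner (rank1 x y j) i *
        cof (G n) (mat_plus_id (T + z *\<^sub>C rank1 x y)) i j)) (at z)"
      by (simp add: f_def[abs_def] detn_def)
    then show ?thesis
      unfolding has_field_derivative_def
      by (rule has_derivative_eq_rhs) (simp add: fun_eq_iff sum_distrib_left sum_distrib_right mult_ac)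
  qed
  then have hol: "f holomorphic_on UNIV"
    unfolding holomorphic_on_open[OF open_UNIV] by blast
  have bound: "norm (f z) \<le> exp (K + 1)" if "norm (0 - z) = 1" for z
  proof -
    have "cmod (f z) \<le> exp (K + ((norm x)\<^sup>2 + (norm y)\<^sup>2) / 2)"
      unfolding f_def by (rule detn_bound[OF dominated_add_rank1[OF dom]]) (use that in simp)
    also have "\<dots> \<le> exp (K + 1)"
      using power_mono[OF x, of 2] power_mono[OF y, of 2] by simp
    finally show ?thesis .
  qed
  have "norm ((deriv ^^ 1) f 0) \<le> fact 1 * exp (K + 1) / 1 ^ 1"
    by (rule Cauchy_inequality[OF holomorphic_on_subset[OF hol] continuous_on_subset[OF holomorphic_on_imp_continuous_on[OF hol]]])
      (use bound in auto)
  moreover have "deriv f 0 = rank1_derivative n T x y"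
    using DERIV_imp_deriv[OF deriv[of 0]] by (simp add: rank1_derivative_def)
  ultimately show ?thesis by simp
qed

lemma rank1_derivative_bound:
  assumes dom: "dominated T S K"
  shows "cmod (rank1_derivative n T x y) \<le> exp (K + 1) * (norm x * norm y)"
proof -
  define u where "u = x /\<^sub>R norm x"
  define v where "v = y /\<^sub>R norm y"
  have uv: "norm u \<le> 1" "norm v \<le> 1" "x = norm x *\<^sub>R u" "y = norm y *\<^sub>R v"
    by (cases "x = 0"; cases "y = 0"; auto simp: u_def v_def)+
  have "rank1_derivative n T x y = (norm x * norm y) *\<^sub>R rank1_derivative n T u v"
    by (subst uv(3), subst uv(4), rule rank1_derivative_scaleR)
  then have "cmod (rank1_derivative n T x y) = (norm x * norm y) * cmod (rank1_derivative n T u v)" by simp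
  also have "\<dots> \<le> (norm x * norm y) * exp (K + 1)"
    by (intro mult_left_mono rank1_derivative_bound_unit[OF dom] uv) simp
  finally show ?thesis by (simp add: mult.commute)
qed

text \<open>Cramer's rule: on the range of the projection, the solution operator of the compressed equation is
  \<open>rank1_derivative\<close> divided by the determinant.\<close>

lemma compress_Cramer:
  assumes T: "clinear_op T" and v: "proj n v = v" and eq: "v + proj n (T v) = proj n x"
  shows "rank1_derivative n T x y = detn n T * cinner v y"
proof -
  define a where "a e = cinner v e" for e
  have v_eq: "v = (\<Sum>e\<in>G n. a e *\<^sub>C e)" using v by (simp add: proj_apply a_def)
  have Na: "(\<Sum>k\<in>G n. mat_plus_id T i k * a k) = cinner x i" if i: "i \<in> G n" for i
  proof -
    have "cinner x i = cinner (v + proj n (T v)) i" unfolding eq using i by (simp add: cinner_proj)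
    also have "\<dots> = a i + cinner (T v) i" using i by (simp add: cinner_add_left cinner_proj a_def)
    also have "cinner (T v) i = (\<Sum>k\<in>G n. cinner (T k) i * a k)"
      by (subst v_eq) (simp add: blinfun.sum_right clinear_opD[OF T] cinner_sum_left cinner_scaleC_left mult.commute)
    also have "a i + (\<Sum>k\<in>G n. cinner (T k) i * a k) = (\<Sum>k\<in>G n. mat_plus_id T i k * a k)"
      using i finite_G by (simp add: mat_plus_id_def distrib_right sum.distrib if_distrib[where f = "\<lambda>c. c * _"] cong: if_cong)
    finally show ?thesis by simp
  qed
  have "rank1_derivative n T x y = (\<Sum>j\<in>G n. cinner j y * (\<Sum>i\<in>G n. cinner x i * cof (G n) (mat_plus_id T) i j))"
    unfolding rank1_derivative_def rank1_apply cinner_scaleC_left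
    by (subst sum.swap) (simp add: sum_distrib_left mult_ac)
  also have "\<dots> = (\<Sum>j\<in>G n. cinner j y * (detn n T * a j))"
    unfolding detn_def by (intro sum.cong refl arg_cong2[where f = "(*)"] fdet_Cramer[OF finite_G _ Na])
  also have "\<dots> = detn n T * cinner v y"
    by (subst v_eq) (simp add: cinner_sum_left cinner_scaleC_left sum_distrib_left mult_ac)
  finally show ?thesis .
qed

text \<open>Where the compressed determinant does not vanish, the compressed operator is invertible, and the bound
  on \<open>rank1_derivative\<close> controls its inverse uniformly.\<close>

lemma compress_inverse_bound:
  assumes dom: "dominated T S K" and nz: "detn n T \<noteq> 0"
  shows "\<exists>B. op_inverses (id_blinfun + compress n T) B \<and> norm B \<le> exp (K + 1) / cmod (detn n T) + 1"
proof (rule bounded_below_surj_inverse)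
  let ?A = "id_blinfun + compress n T" and ?c = "exp (K + 1) / cmod (detn n T)"
  note T = dominatedD(1)[OF dom]
  show "norm x \<le> (?c + 1) * norm (?A x)" for x
  proof -
    define y where "y = ?A x"
    define v where "v = proj n x"
    have y: "y = x + proj n (T v)" by (simp add: y_def v_def compress_def blinfun.add_left)
    have v: "proj n v = v" by (simp add: v_def)
    have eq: "v + proj n (T v) = proj n y" by (simp add: y v_def blinfun.add_right)
    have "cmod (detn n T) * (norm v)\<^sup>2 = cmod (rank1_derivative n T y v)"
      unfolding compress_Cramer[OF T v eq] by (simp add: norm_mult cinner_self norm_power)
    also have "\<dots> \<le> exp (K + 1) * (norm y * norm v)" by (rule rank1_derivative_bound[OF dom])
    finally have "norm v * (cmod (detn n T) * norm v) \<le> norm v * (exp (K + 1) * norm y)"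
      by (simp add: power2_eq_square mult_ac)
    then have "norm v \<le> ?c * norm y"
      using nz by (cases "norm v = 0") (auto simp: field_simps)
    moreover have "norm (x - v) \<le> norm y"
    proof -
      have "x - v = y - proj n y" by (simp add: y v_def blinfun.add_right)
      then show ?thesis by (simp add: norm_minus_proj_le)
    qed
    moreover have "norm x \<le> norm v + norm (x - v)" using norm_triangle_ineq[of v "x - v"] by simp
    ultimately show ?thesis by (simp add: y_def algebra_simps)
  qed
  show "\<exists>x. ?A x = y" for y
  proof -
    obtain a where a: "\<And>i. i \<in> G n \<Longrightarrow> (\<Sum>k\<in>G n. mat_plus_id T i k * a k) = cinner y i"
      using fdet_solvable[OF finite_G nz[unfolded detn_def], of "cinner y"] by blast
    define v where "v = (\<Sum>e\<in>G n. a e *\<^sub>C e)"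
    have v: "proj n v = v" unfolding v_def by (rule proj_span)
    have "cinner (v + T v) i = cinner y i" if i: "i \<in> G n" for i
    proof -
      have "cinner v i = a i"
        unfolding v_def by (rule cinner_orthonormal_sum[OF orthonormal_G finite_G i])
      moreover have "cinner (T v) i = (\<Sum>k\<in>G n. cinner (T k) i * a k)"
        unfolding v_def
        by (simp add: blinfun.sum_right clinear_opD[OF T] cinner_sum_left cinner_scaleC_left mult.commute)
      ultimately have "cinner (v + T v) i = a i + (\<Sum>k\<in>G n. cinner (T k) i * a k)"
        by (simp add: cinner_add_left)
      also have "\<dots> = (\<Sum>k\<in>G n. mat_plus_id T i k * a k)"
        using i finite_G by (simp add: mat_plus_id_def distrib_right sum.distrib if_distrib[where f = "\<lambda>c. c * _"] cong: if_cong)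
      finally show ?thesis using a[OF i] by simp
    qed
    then have "proj n (v + T v) = proj n y" unfolding proj_apply by (intro sum.cong refl) simp
    then have "v + proj n (T v) = proj n y" by (simp add: blinfun.add_right v)
    then have "?A (v + (y - proj n y)) = y"
      by (simp add: compress_def blinfun.add_left blinfun.add_right blinfun.diff_right v)
    then show ?thesis by blast
  qed
qed (use nz in simp)

text \<open>The compressions converge to \<open>T\<close> in norm and their inverses stay bounded, so that \<open>I + T\<close> is a small
  perturbation of an invertible operator.\<close>

lemma invertible_if_limit_nonzero:
  assumes dom: "dominated T S K" and lim: "(\<lambda>n. detn n T) \<longlonglongrightarrow> d" and "d \<noteq> 0"
  shows "\<exists>B. op_inverses (id_blinfun + T) B"
proof -
  define c where "c = exp (K + 1) / (cmod d / 2) + 1"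
  have "c > 0" using \<open>d \<noteq> 0\<close> by (simp add: c_def add_pos_pos)
  have "\<forall>\<^sub>F n in sequentially. cmod d / 2 < cmod (detn n T)"
    by (rule order_tendstoD(1)[OF tendsto_norm[OF lim]]) (use \<open>d \<noteq> 0\<close> in simp)
  moreover have "\<forall>\<^sub>F n in sequentially. dist (compress n T) T < 1 / (2 * c)"
    by (rule tendstoD[OF compress_tendsto[OF dom]]) (use \<open>c > 0\<close> in simp)
  ultimately have "\<forall>\<^sub>F n in sequentially. cmod d / 2 < cmod (detn n T) \<and> dist (compress n T) T < 1 / (2 * c)"
    by eventually_elim simp
  then obtain n where n: "cmod d / 2 < cmod (detn n T)" "dist (compress n T) T < 1 / (2 * c)"
    by (auto simp: eventually_sequentially)
  have pos: "cmod d / 2 > 0" using \<open>d \<noteq> 0\<close> by simp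
  then have "detn n T \<noteq> 0" using n(1) by auto
  then obtain B where B: "op_inverses (id_blinfun + compress n T) B"
    "norm B \<le> exp (K + 1) / cmod (detn n T) + 1"
    using compress_inverse_bound[OF dom] by blast
  have "exp (K + 1) / cmod (detn n T) \<le> exp (K + 1) / (cmod d / 2)"
    using n(1) pos by (intro divide_left_mono mult_pos_pos) auto
  then have "norm B \<le> c" using B(2) by (simp add: c_def)
  have "norm B * norm ((id_blinfun + T) - (id_blinfun + compress n T)) \<le> c * (1 / (2 * c))"
    using \<open>norm B \<le> c\<close> n(2) \<open>c > 0\<close> by (intro mult_mono) (auto simp: dist_norm norm_minus_commute)
  then have "norm B * norm ((id_blinfun + T) - (id_blinfun + compress n T)) \<le> 1 / 2"
    using \<open>c > 0\<close> by simp
  from op_inverse_perturb[OF B(1) this] show ?thesis by blast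
qed

text \<open>By Cramer's rule the derivative is the determinant times a matrix entry of the inverse of the compressed
  operator, and these inverses converge.\<close>

lemma rank1_derivative_tendsto:
  assumes dom: "dominated T S K" and lim: "(\<lambda>n. detn n T) \<longlonglongrightarrow> d" and B: "op_inverses (id_blinfun + T) B"
  shows "(\<lambda>n. rank1_derivative n T x y) \<longlonglongrightarrow> d * cinner (B x) y"
proof -
  define A where "A n = id_blinfun + compress n T" for n
  have A: "A \<longlonglongrightarrow> id_blinfun + T"
    unfolding A_def by (intro tendsto_intros compress_tendsto[OF dom])
  have "(\<lambda>n. norm B * norm (A n - (id_blinfun + T))) \<longlonglongrightarrow> norm B * 0"
    by (intro tendsto_intros) (use A in \<open>simp add: LIM_zero_iff tendsto_norm_zero_iff\<close>)
  then have "\<forall>\<^sub>F n in sequentially. norm B * norm (A n - (id_blinfun + T)) < 1 / 2"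
    by (rule order_tendstoD) simp
  then have ex: "\<forall>\<^sub>F n in sequentially. \<exists>C. op_inverses (A n) C"
  proof eventually_elim
    case (elim n)
    then show ?case using op_inverse_perturb[OF B, of "A n"] by auto
  qed
  define C where "C n = (SOME C. op_inverses (A n) C)" for n
  have C: "\<forall>\<^sub>F n in sequentially. op_inverses (A n) (C n)"
    using ex by eventually_elim (auto simp: C_def intro: someI)
  have "(\<lambda>n. cinner (C n (proj n x)) y) \<longlonglongrightarrow> cinner (B x) y"
    by (intro tendsto_cinner blinfun.tendsto tendsto_const proj_tendsto op_inverse_tendsto[OF A B C])
  then have "(\<lambda>n. detn n T * cinner (C n (proj n x)) y) \<longlonglongrightarrow> d * cinner (B x) y"
    by (intro tendsto_mult lim)
  moreover have "\<forall>\<^sub>F n in sequentially. detn n T * cinner (C n (proj n x)) y = rank1_derivative n T x y"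
    using C
  proof eventually_elim
    case (elim n)
    define v where "v = C n (proj n x)"
    have eq: "v + proj n (T (proj n v)) = proj n x"
      using op_inverses_apply(1)[OF elim, of "proj n x"]
      by (simp add: v_def A_def compress_def blinfun.add_left)
    have "v = proj n (x - T (proj n v))" using eq by (simp add: blinfun.diff_right algebra_simps)
    then have v: "proj n v = v" by (metis proj_proj)
    have "v + proj n (T v) = proj n x" using eq by (simp only: v)
    from compress_Cramer[OF dominatedD(1)[OF dom] v this]
    show ?case by (simp only: v_def)
  qed
  ultimately show ?thesis by (rule Lim_transform_eventually)
qed

end

context exhausted_basis
begin

section \<open>Determinants along a path of operators\<close>

text \<open>All the compressed determinants are Lipschitz with the same constant, hence so is their limit; where
  the limit does not vanish, their derivatives converge boundedly.\<close>

context
  fixes T S :: "real \<Rightarrow> 'h \<Rightarrow>\<^sub>L 'h" and K c :: real and I :: "'i set"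
    and x y :: "'i \<Rightarrow> real \<Rightarrow> 'h" and d :: "real \<Rightarrow> complex" and a b :: real
  assumes I: "finite I"
    and deriv: "\<And>s. s \<in> {a..b} \<Longrightarrow> (T has_vector_derivative (\<Sum>k\<in>I. rank1 (x k s) (y k s))) (at s)"
    and dom: "\<And>s. s \<in> {a..b} \<Longrightarrow> \<exists>K'\<le>K. dominated (T s) (S s) K'"
    and bound: "\<And>s k. s \<in> {a..b} \<Longrightarrow> k \<in> I \<Longrightarrow> norm (x k s) * norm (y k s) \<le> c"
    and lim: "\<And>s. s \<in> {a..b} \<Longrightarrow> (\<lambda>n. detn n (T s)) \<longlonglongrightarrow> d s"
begin

private definition "w n s = (\<Sum>k\<in>I. rank1_derivative n (T s) (x k s) (y k s))"

private definition "L = real (card I) * (exp (K + 1) * c)"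

private lemma w_bound: "s \<in> {a..b} \<Longrightarrow> norm (w n s) \<le> L"
proof -
  assume s: "s \<in> {a..b}"
  obtain K' where K': "K' \<le> K" "dominated (T s) (S s) K'" using dom[OF s] by blast
  have "norm (w n s) \<le> (\<Sum>k\<in>I. exp (K + 1) * c)"
    unfolding w_def
  proof (rule order_trans[OF norm_sum sum_mono])
    fix k assume k: "k \<in> I"
    have "cmod (rank1_derivative n (T s) (x k s) (y k s)) \<le> exp (K' + 1) * (norm (x k s) * norm (y k s))"
      by (rule rank1_derivative_bound[OF K'(2)])
    also have "\<dots> \<le> exp (K + 1) * c"
      using K'(1) bound[OF s k] by (intro mult_mono) auto
    finally show "cmod (rank1_derivative n (T s) (x k s) (y k s)) \<le> exp (K + 1) * c" .
  qed
  then show ?thesis by (simp add: L_def)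
qed

private lemma detn_deriv: "s \<in> {a..b} \<Longrightarrow> ((\<lambda>s. detn n (T s)) has_vector_derivative w n s) (at s within U)"
  unfolding w_def by (rule detn_has_derivative[OF has_vector_derivative_at_within[OF deriv]])

private lemma d_Lipschitz:
  assumes "r \<in> {a..b}" "s \<in> {a..b}" shows "norm (d r - d s) \<le> L * \<bar>r - s\<bar>"
proof (rule LIMSEQ_le_const2[OF tendsto_norm[OF tendsto_diff[OF lim lim]]])
  show "\<exists>N. \<forall>n\<ge>N. norm (detn n (T r) - detn n (T s)) \<le> L * \<bar>r - s\<bar>"
  proof (intro exI allI impI)
    fix n
    have "norm (detn n (T r) - detn n (T s)) \<le> L * norm (r - s)"
    proof (rule differentiable_bound[where S = "{a..b}" and f' = "\<lambda>s h. h *\<^sub>R w n s"])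
      show "((\<lambda>s. detn n (T s)) has_derivative (\<lambda>h. h *\<^sub>R w n s)) (at s within {a..b})" if "s \<in> {a..b}" for s
        using detn_deriv[OF that] by (simp add: has_vector_derivative_def)
      show "onorm (\<lambda>h. h *\<^sub>R w n s) \<le> L" if "s \<in> {a..b}" for s
      proof (rule onorm_le)
        show "norm (h *\<^sub>R w n s) \<le> L * norm h" for h
          using mult_left_mono[OF w_bound[OF that, of n], of "\<bar>h\<bar>"] by (simp add: mult.commute)
      qed
    qed (use assms in auto)
    then show "norm (detn n (T r) - detn n (T s)) \<le> L * \<bar>r - s\<bar>" by simp
  qed
qed (use assms in auto)

lemma determinant_path_continuous: "continuous_on {a..b} d"
proof (cases "a \<le> b")
  case True
  then have "L \<ge> 0" using order_trans[OF norm_ge_zero w_bound, of a] by simp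
  have "L-lipschitz_on {a..b} d"
    by (rule lipschitz_onI) (use d_Lipschitz \<open>L \<ge> 0\<close> in \<open>auto simp: dist_norm\<close>)
  then show ?thesis by (rule lipschitz_on_continuous_on)
qed simp

lemma determinant_path_derivative:
  assumes inv: "\<And>s. s \<in> {a..b} \<Longrightarrow> op_inverses (id_blinfun + T s) (B s)"
    and cont: "\<And>k. k \<in> I \<Longrightarrow> continuous_on {a..b} (x k)" "\<And>k. k \<in> I \<Longrightarrow> continuous_on {a..b} (y k)"
    and s: "s \<in> {a<..<b}"
  shows "(d has_vector_derivative d s * (\<Sum>k\<in>I. cinner (B s (x k s)) (y k s))) (at s)"
proof -
  define g where "g s = d s * (\<Sum>k\<in>I. cinner (B s (x k s)) (y k s))" for s
  have contT: "continuous_on {a..b} T"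
    using deriv by (intro continuous_at_imp_continuous_on ballI has_vector_derivative_continuous) auto
  have contB: "continuous_on {a..b} B"
    unfolding continuous_on_def
  proof (intro ballI op_inverse_tendsto[OF _ inv])
    fix r assume r: "r \<in> {a..b}"
    show "((\<lambda>r. id_blinfun + T r) \<longlongrightarrow> id_blinfun + T r) (at r within {a..b})"
      using contT r by (intro tendsto_intros) (auto simp: continuous_on_def)
    show "\<forall>\<^sub>F r in at r within {a..b}. op_inverses (id_blinfun + T r) (B r)"
      using inv by (auto simp: eventually_at_filter)
  qed
  have contg: "continuous_on {a..b} g"
    unfolding g_def
    by (intro continuous_intros determinant_path_continuous bounded_bilinear.continuous_on[OF bounded_bilinear_cinner]
        bounded_bilinear.continuous_on[OF bounded_bilinear_blinfun_apply] contB cont)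
  have FTC: "d r - d a = integral {a..r} g" if r: "r \<in> {a..b}" for r
  proof -
    have w_int: "(w n has_integral (detn n (T r) - detn n (T a))) {a..r}" for n
      using r by (intro fundamental_theorem_of_calculus detn_deriv) auto
    have "(\<lambda>n. integral {a..r} (w n)) \<longlonglongrightarrow> integral {a..r} g"
    proof (rule dominated_convergence(2))
      show "w n integrable_on {a..r}" for n using w_int by blast
      show "(\<lambda>s. L) integrable_on {a..r}" by (rule integrable_const_ivl)
      show "norm (w n s) \<le> L" if "s \<in> {a..r}" for n s using w_bound[of s n] that r by auto
      show "(\<lambda>n. w n s) \<longlonglongrightarrow> g s" if "s \<in> {a..r}" for s
      proof -
        have s: "s \<in> {a..b}" using that r by auto
        obtain K' where "dominated (T s) (S s) K'" using dom[OF s] by blast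
        from rank1_derivative_tendsto[OF this lim[OF s] inv[OF s]]
        show ?thesis unfolding w_def g_def sum_distrib_left by (intro tendsto_sum)
      qed
    qed
    moreover have "(\<lambda>n. integral {a..r} (w n)) \<longlonglongrightarrow> d r - d a"
      unfolding integral_unique[OF w_int] by (rule tendsto_diff[OF lim lim]) (use r in auto)
    ultimately show ?thesis by (rule LIMSEQ_unique[symmetric])
  qed
  have "((\<lambda>r. integral {a..r} g) has_vector_derivative g s) (at s within {a..b})"
    using s by (intro integral_has_vector_derivative[OF contg]) auto
  then have "((\<lambda>r. integral {a..r} g) has_vector_derivative g s) (at s)"
    using s at_within_interior[of s "{a..b}"] by (simp add: interior_atLeastAtMost_real)
  from has_vector_derivative_add[OF has_vector_derivative_const[of "d a"] this]
  have int: "((\<lambda>r. d a + integral {a..r} g) has_vector_derivative 0 + g s) (at s)" .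
  have "(d has_vector_derivative 0 + g s) (at s)"
  proof (rule has_vector_derivative_transform_within_open[OF int open_greaterThanLessThan s])
    show "d a + integral {a..r} g = d r" if "r \<in> {a<..<b}" for r
    proof -
      have "integral {a..r} g = d r - d a" using FTC[of r] that by simp
      then show ?thesis by simp
    qed
  qed
  then show ?thesis by (simp add: g_def)
qed

end

end

section \<open>Integrals over unbounded intervals\<close>

text \<open>For continuous integrands with values in a Banach space the gauge integral over \<open>{x..}\<close> is the limit
  of the integrals over bounded intervals.\<close>

lemma Ici_not_cbox: "\<nexists>a b. {x::real..} = cbox a b"
proof
  assume "\<exists>a b. {x..} = cbox a b"
  then obtain a b where "{x..} = {a..b}" by auto
  moreover have "max x b + 1 \<in> {x..}" by simp
  ultimately have "max x b + 1 \<le> b" by auto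
  then show False by simp
qed

lemma has_integral_Ici_iff:
  fixes f :: "real \<Rightarrow> 'a::banach"
  assumes cont: "continuous_on UNIV f"
  shows "(f has_integral l) {x..} \<longleftrightarrow> ((\<lambda>M. integral {x..M} f) \<longlongrightarrow> l) at_top"
proof -
  have box: "((\<lambda>s. if s \<in> {x..} then f s else 0) has_integral integral {x..b} f) {a..b}" if "a \<le> x" "x \<le> b" for a b
  proof -
    have "(f has_integral integral {x..b} f) {x..b}"
      by (intro integrable_integral integrable_continuous_real continuous_on_subset[OF cont]) simp
    then have "((\<lambda>s. if s \<in> {x..b} then f s else 0) has_integral integral {x..b} f) {a..b}"
      using that by (subst has_integral_restrict) auto
    then show ?thesis by (rule has_integral_eq[rotated]) auto
  qed
  show ?thesis
  proof
    assume int: "(f has_integral l) {x..}"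
    show "((\<lambda>M. integral {x..M} f) \<longlongrightarrow> l) at_top"
    proof (rule tendstoI)
      fix e :: real assume "e > 0"
      obtain B where B: "B > 0"
        "\<forall>a b. ball 0 B \<subseteq> cbox a b \<longrightarrow> (\<exists>z. ((\<lambda>s. if s \<in> {x..} then f s else 0) has_integral z) (cbox a b) \<and> norm (z - l) < e)"
        by (rule has_integral_altD[OF int Ici_not_cbox \<open>e > 0\<close>])
      have "dist (integral {x..M} f) l < e" if M: "M \<ge> max B \<bar>x\<bar>" for M
      proof -
        have "ball 0 B \<subseteq> cbox (- M) M" using M by (auto simp: dist_real_def)
        from B(2)[rule_format, OF this]
        obtain z where z: "((\<lambda>s. if s \<in> {x..} then f s else 0) has_integral z) (cbox (- M) M)" "norm (z - l) < e"
          by (elim exE conjE)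
        have "- M \<le> x" "x \<le> M" using M by auto
        then have "z = integral {x..M} f"
          using has_integral_unique[OF z(1)[unfolded cbox_interval] box] by blast
        then show ?thesis using z(2) by (simp add: dist_norm)
      qed
      then show "\<forall>\<^sub>F M in at_top. dist (integral {x..M} f) l < e"
        by (rule eventually_at_top_linorderI)
    qed
  next
    assume lim: "((\<lambda>M. integral {x..M} f) \<longlongrightarrow> l) at_top"
    show "(f has_integral l) {x..}"
    proof (subst has_integral_alt, subst if_not_P[OF Ici_not_cbox], intro allI impI)
      fix e :: real assume "e > 0"
      with lim have "\<forall>\<^sub>F M in at_top. dist (integral {x..M} f) l < e" by (rule tendstoD)
      then obtain N where N: "\<And>M. M \<ge> N \<Longrightarrow> dist (integral {x..M} f) l < e"
        by (auto simp: eventually_at_top_linorder)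
      define B where "B = max \<bar>N\<bar> \<bar>x\<bar> + 1"
      have "\<exists>z. ((\<lambda>s. if s \<in> {x..} then f s else 0) has_integral z) (cbox a b) \<and> norm (z - l) < e"
        if sub: "ball 0 B \<subseteq> cbox a b" for a b
      proof -
        have "- (max \<bar>N\<bar> \<bar>x\<bar>) \<in> ball 0 B" "max \<bar>N\<bar> \<bar>x\<bar> \<in> ball 0 B" by (auto simp: B_def dist_real_def)
        from this[THEN subsetD[OF sub]]
        have "a \<le> - (max \<bar>N\<bar> \<bar>x\<bar>)" "max \<bar>N\<bar> \<bar>x\<bar> \<le> b"
          unfolding cbox_interval atLeastAtMost_iff by blast+
        then have "a \<le> x" "x \<le> b" "N \<le> b" by linarith+
        from box[OF this(1,2)] N[OF this(3)] show ?thesis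
          unfolding dist_norm cbox_interval by (intro exI conjI)
      qed
      moreover have "B > 0" by (simp add: B_def)
      ultimately show "\<exists>B>0. \<forall>a b. ball 0 B \<subseteq> cbox a b \<longrightarrow>
          (\<exists>z. ((\<lambda>s. if s \<in> {x..} then f s else 0) has_integral z) (cbox a b) \<and> norm (z - l) < e)" by blast
    qed
  qed
qed

text \<open>The integrals over \<open>{x..M}\<close> are Cauchy as \<open>M\<close> grows because those of the majorant are.\<close>

lemma dominated_integral_Ici:
  fixes f :: "real \<Rightarrow> 'a::banach" and h :: "real \<Rightarrow> real"
  assumes f: "continuous_on UNIV f" and h: "continuous_on UNIV h" and le: "\<And>s. norm (f s) \<le> h s"
    and int: "h integrable_on {x..}"
  shows "f integrable_on {x..}" "norm (integral {x..} f) \<le> integral {x..} h"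
proof -
  let ?F = "\<lambda>M. integral {x..M} f" and ?H = "\<lambda>M. integral {x..M} h" and ?I = "integral {x..} h"
  have limH: "(?H \<longlongrightarrow> ?I) at_top"
    using int has_integral_Ici_iff[OF h] by (simp add: has_integral_integral)
  have f_int: "f integrable_on {a..b}" and h_int: "h integrable_on {a..b}" for a b
    by (auto intro!: integrable_continuous_real continuous_on_subset[OF f] continuous_on_subset[OF h])
  have h0: "h s \<ge> 0" for s using le[of s] norm_ge_zero order_trans by blast
  have step: "norm (?F M - ?F N) \<le> ?H M - ?H N" if "x \<le> N" "N \<le> M" for M N
  proof -
    have "?F M - ?F N = integral {N..M} f" "?H M - ?H N = integral {N..M} h"
      using Henstock_Kurzweil_Integration.integral_combine[OF that f_int] Henstock_Kurzweil_Integration.integral_combine[OF that h_int]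
      by (simp_all add: algebra_simps)
    then show ?thesis using integral_norm_bound_integral[OF f_int h_int le] by metis
  qed
  have HI: "?H M \<le> ?I" if "x \<le> M" for M
  proof (rule tendsto_lowerbound[OF limH])
    show "\<forall>\<^sub>F N in at_top. ?H M \<le> ?H N"
      using eventually_ge_at_top[of M] by eventually_elim (use step[OF that] norm_ge_zero order_trans in \<open>smt (verit)\<close>)
  qed simp
  have seq: "(\<lambda>n. ?H (x + real n)) \<longlonglongrightarrow> ?I"
    by (rule filterlim_compose[OF limH]) (rule filterlim_tendsto_add_at_top[OF tendsto_const filterlim_real_sequentially])
  have "Cauchy (\<lambda>n. ?F (x + real n))"
  proof (rule CauchyI')
    fix e :: real assume "e > 0"
    then have "\<forall>\<^sub>F n in sequentially. ?I - e < ?H (x + real n)" by (intro order_tendstoD(1)[OF seq]) simp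
    then obtain N where N: "\<And>n. n \<ge> N \<Longrightarrow> ?I - e < ?H (x + real n)" by (auto simp: eventually_sequentially)
    have "dist (?F (x + real m)) (?F (x + real n)) < e" if "m \<ge> N" "n > m" for m n
    proof -
      have "norm (?F (x + real n) - ?F (x + real m)) \<le> ?H (x + real n) - ?H (x + real m)"
        using that by (intro step) auto
      also have "\<dots> < e" using N[OF that(1)] HI[of "x + real n"] by simp
      finally show ?thesis by (simp add: dist_norm norm_minus_commute)
    qed
    then show "\<exists>M. \<forall>m\<ge>M. \<forall>n>m. dist (?F (x + real m)) (?F (x + real n)) < e" by blast
  qed
  then obtain l where l: "(\<lambda>n. ?F (x + real n)) \<longlonglongrightarrow> l" using Cauchy_convergent_iff convergent_def by blast
  have close: "norm (l - ?F M) \<le> ?I - ?H M" if "x \<le> M" for M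
  proof (rule LIMSEQ_le[OF tendsto_norm[OF tendsto_diff[OF l tendsto_const]] tendsto_diff[OF seq tendsto_const]])
    obtain N where "M \<le> x + real N" by (metis diff_le_eq add.commute real_arch_simple)
    then show "\<exists>N. \<forall>n\<ge>N. norm (?F (x + real n) - ?F M) \<le> ?H (x + real n) - ?H M"
      using that by (intro exI[of _ N] allI impI step) auto
  qed
  have "((\<lambda>M. ?F M - l) \<longlongrightarrow> 0) at_top"
  proof (rule Lim_null_comparison)
    show "\<forall>\<^sub>F M in at_top. norm (?F M - l) \<le> ?I - ?H M"
      using eventually_ge_at_top[of x] by eventually_elim (use close in \<open>simp add: norm_minus_commute\<close>)
    show "((\<lambda>M. ?I - ?H M) \<longlongrightarrow> 0) at_top" using tendsto_diff[OF tendsto_const limH, of ?I] by simp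
  qed
  then have "(f has_integral l) {x..}" unfolding has_integral_Ici_iff[OF f] by (simp add: LIM_zero_iff)
  then have int_f: "f integrable_on {x..}" "integral {x..} f = l" by (auto intro: integral_unique)
  then show "f integrable_on {x..}" by simp
  show "norm (integral {x..} f) \<le> integral {x..} h" using close[of x] int_f by simp
qed

lemma integral_Ici_split:
  fixes f :: "real \<Rightarrow> 'a::banach"
  assumes f: "continuous_on UNIV f" and int: "\<And>x. f integrable_on {x..}" and "a \<le> r"
  shows "integral {r..} f = integral {a..} f - integral {a..r} f"
proof (rule tendsto_unique[of at_top])
  have lim: "((\<lambda>M. integral {x..M} f) \<longlongrightarrow> integral {x..} f) at_top" for x
    using int has_integral_Ici_iff[OF f] by (simp add: has_integral_integral)
  show "((\<lambda>M. integral {r..M} f) \<longlongrightarrow> integral {r..} f) at_top" by (rule lim)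
  have "((\<lambda>M. integral {a..M} f - integral {a..r} f) \<longlongrightarrow> integral {a..} f - integral {a..r} f) at_top"
    by (intro tendsto_diff lim tendsto_const)
  moreover have "\<forall>\<^sub>F M in at_top. integral {a..M} f - integral {a..r} f = integral {r..M} f"
    using eventually_ge_at_top[of r]
  proof eventually_elim
    case (elim M)
    have "f integrable_on {a..M}"
      by (intro integrable_continuous_real continuous_on_subset[OF f]) simp
    from Henstock_Kurzweil_Integration.integral_combine[OF \<open>a \<le> r\<close> elim this] show ?case by (simp add: algebra_simps)
  qed
  ultimately show "((\<lambda>M. integral {r..M} f) \<longlongrightarrow> integral {a..} f - integral {a..r} f) at_top"
    by (rule Lim_transform_eventually)
qed simp

lemma integral_Ici_has_vector_derivative:
  fixes f :: "real \<Rightarrow> 'a::banach"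
  assumes f: "continuous_on UNIV f" and int: "\<And>x. f integrable_on {x..}"
  shows "((\<lambda>x. integral {x..} f) has_vector_derivative - f x) (at x)"
proof -
  have "((\<lambda>r. integral {x - 1..r} f) has_vector_derivative f x) (at x within {x - 1..x + 1})"
    by (intro integral_has_vector_derivative continuous_on_subset[OF f]) auto
  then have "((\<lambda>r. integral {x - 1..r} f) has_vector_derivative f x) (at x)"
    using at_within_interior[of x "{x - 1..x + 1}"] by (simp add: interior_atLeastAtMost_real)
  from has_vector_derivative_diff[OF has_vector_derivative_const[of "integral {x - 1..} f"] this]
  have "((\<lambda>r. integral {x - 1..} f - integral {x - 1..r} f) has_vector_derivative 0 - f x) (at x)" .
  then have "((\<lambda>x. integral {x..} f) has_vector_derivative 0 - f x) (at x)"
  proof (rule has_vector_derivative_transform_within_open[OF _ open_greaterThanLessThan])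
    show "x \<in> {x - 1<..<x + 1}" by simp
    show "integral {x - 1..} f - integral {x - 1..r} f = integral {r..} f" if "r \<in> {x - 1<..<x + 1}" for r
      using that by (intro integral_Ici_split[OF f int, symmetric]) simp
  qed
  then show ?thesis by simp
qed

lemma integral_Ici_tendsto_0:
  fixes f :: "real \<Rightarrow> 'a::banach"
  assumes f: "continuous_on UNIV f" and int: "\<And>x. f integrable_on {x..}"
  shows "((\<lambda>x. integral {x..} f) \<longlongrightarrow> 0) at_top"
proof -
  have "((\<lambda>M. integral {0..M} f) \<longlongrightarrow> integral {0..} f) at_top"
    using int has_integral_Ici_iff[OF f] by (simp add: has_integral_integral)
  then have "((\<lambda>r. integral {0..} f - integral {0..r} f) \<longlongrightarrow> integral {0..} f - integral {0..} f) at_top"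
    by (intro tendsto_diff tendsto_const)
  moreover have "\<forall>\<^sub>F r in at_top. integral {0..} f - integral {0..r} f = integral {r..} f"
    using eventually_ge_at_top[of 0] by eventually_elim (rule integral_Ici_split[OF f int, symmetric])
  ultimately show ?thesis by (simp add: Lim_transform_eventually)
qed

text \<open>Integrals over unit intervals far out tend both to the limit of the function and to \<open>0\<close>.\<close>

lemma integrable_limit_zero:
  fixes f :: "real \<Rightarrow> 'a::banach"
  assumes f: "continuous_on UNIV f" and int: "\<And>x. f integrable_on {x..}" and lim: "(f \<longlongrightarrow> l) at_top"
  shows "l = 0"
proof -
  let ?J = "\<lambda>M. integral {M..M + 1} f"
  have "(?J \<longlongrightarrow> l) at_top"
  proof (rule tendstoI)
    fix e :: real assume "e > 0"
    then have "\<forall>\<^sub>F s in at_top. dist (f s) l < e / 2" by (intro tendstoD[OF lim]) simp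
    then obtain N where N: "\<And>s. s \<ge> N \<Longrightarrow> dist (f s) l < e / 2" by (auto simp: eventually_at_top_linorder)
    have "dist (?J M) l < e" if "M \<ge> N" for M
    proof -
      have int': "f integrable_on {M..M + 1}"
        by (intro integrable_continuous_real continuous_on_subset[OF f]) simp
      have "norm (integral {M..M + 1} (\<lambda>s. f s - l)) \<le> e / 2 * (M + 1 - M)"
        using N that by (intro integral_bound continuous_intros continuous_on_subset[OF f])
          (auto simp: dist_norm intro!: less_imp_le)
      then show ?thesis using \<open>e > 0\<close> by (simp add: dist_norm integral_diff[OF int' integrable_const_ivl])
    qed
    then show "\<forall>\<^sub>F M in at_top. dist (?J M) l < e" by (rule eventually_at_top_linorderI)
  qed
  moreover have "(?J \<longlongrightarrow> 0 - 0) at_top"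
  proof -
    have J: "?J M = integral {M..} f - integral {M + 1..} f" for M
      using integral_Ici_split[OF f int, of M "M + 1"] by simp
    have "filterlim (\<lambda>M::real. M + 1) at_top at_top"
      by (rule filterlim_tendsto_add_at_top[OF tendsto_const filterlim_ident, of 1, simplified add.commute])
    from filterlim_compose[OF integral_Ici_tendsto_0[OF f int] this]
    show ?thesis unfolding J by (intro tendsto_diff integral_Ici_tendsto_0[OF f int])
  qed
  ultimately show ?thesis by (simp add: tendsto_unique[OF trivial_limit_at_top_linorder])
qed

section \<open>Integrals of rank-one operators\<close>

lemma continuous_on_rank1:
  assumes "continuous_on U b" "continuous_on U c"
  shows "continuous_on U (\<lambda>s. rank1 (b s) (c s))"
  by (rule bounded_bilinear.continuous_on[OF bounded_bilinear_rank1 assms])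

lemma mult_norms_le: "norm x * norm y \<le> ((norm x)\<^sup>2 + (norm y)\<^sup>2) / 2"
  using sum_squares_bound[of "norm x" "norm y"] by simp

lemma cinner_integral:
  fixes f :: "real \<Rightarrow> 'a::real_normed_vector \<Rightarrow>\<^sub>L 'h::complex_hilbert"
  assumes "f integrable_on {x..}"
  shows "((\<lambda>s. cinner (blinfun_apply (f s) u) v) has_integral cinner (integral {x..} f u) v) {x..}"
proof -
  have "bounded_linear (\<lambda>T. cinner (blinfun_apply T u) v)"
    by (rule bounded_linear_compose[OF bounded_linear_cinner_left blinfun.bounded_linear_left])
  from has_integral_linear[OF integrable_integral[OF assms] this] show ?thesis by (simp add: o_def)
qed

lemma clinear_integral:
  fixes f :: "real \<Rightarrow> 'a::complex_hilbert \<Rightarrow>\<^sub>L 'h::complex_hilbert"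
  assumes int: "f integrable_on {x..}" and cl: "\<And>s. clinear_op (f s)"
  shows "clinear_op (integral {x..} f)"
  unfolding clinear_op_def
proof (intro allI)
  fix z u
  have app: "((\<lambda>s. blinfun_apply (f s) u) has_integral integral {x..} f u) {x..}" for u
    using has_integral_linear[OF integrable_integral[OF int] blinfun.bounded_linear_left] by (simp add: o_def)
  have "((\<lambda>s. z *\<^sub>C f s u) has_integral z *\<^sub>C integral {x..} f u) {x..}"
    using has_integral_linear[OF app bounded_linear_scaleC] by (simp add: o_def)
  then have "((\<lambda>s. f s (z *\<^sub>C u)) has_integral z *\<^sub>C integral {x..} f u) {x..}"
    by (simp add: clinear_opD[OF cl])
  from has_integral_unique[OF app this] show "integral {x..} f (z *\<^sub>C u) = z *\<^sub>C integral {x..} f u" .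
qed

context
  fixes b c :: "real \<Rightarrow> 'h::complex_hilbert"
  assumes b: "continuous_on UNIV b" and c: "continuous_on UNIV c"
    and b_int: "\<And>x. (\<lambda>s. (norm (b s))\<^sup>2) integrable_on {x..}"
    and c_int: "\<And>x. (\<lambda>s. (norm (c s))\<^sup>2) integrable_on {x..}"
begin

private definition "h s = ((norm (b s))\<^sup>2 + (norm (c s))\<^sup>2) / 2"

private lemma h_cont: "continuous_on UNIV h"
  unfolding h_def by (intro continuous_intros b c) simp

private lemma h_int: "h integrable_on {x..}"
  unfolding h_def divide_inverse by (intro integrable_on_mult_left integrable_add b_int c_int)

lemma rank1_integrable: "(\<lambda>s. rank1 (b s) (c s)) integrable_on {x..}"
  by (rule dominated_integral_Ici(1)[OF continuous_on_rank1[OF b c] h_cont _ h_int])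
    (unfold h_def, rule order_trans[OF norm_rank1_le mult_norms_le])

private definition "\<Sigma> s = (1 / 2) *\<^sub>R (rank1 (b s) (b s) + rank1 (c s) (c s))"

private lemma \<Sigma>_cont: "continuous_on UNIV \<Sigma>"
  unfolding \<Sigma>_def by (intro continuous_intros continuous_on_rank1 b c)

private lemma \<Sigma>_int: "\<Sigma> integrable_on {x..}"
proof (rule dominated_integral_Ici(1)[OF \<Sigma>_cont h_cont _ h_int])
  fix s
  have "norm (rank1 (b s) (b s) + rank1 (c s) (c s)) \<le> norm (b s) * norm (b s) + norm (c s) * norm (c s)"
    by (intro order_trans[OF norm_triangle_ineq] add_mono norm_rank1_le)
  then show "norm (\<Sigma> s) \<le> h s" by (simp add: \<Sigma>_def h_def power2_eq_square)
qed

private lemma \<Sigma>_form: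
  "((\<lambda>s. ((cmod (cinner (b s) u))\<^sup>2 + (cmod (cinner (c s) u))\<^sup>2) / 2) has_integral Re (cinner (integral {x..} \<Sigma> u) u)) {x..}"
  "cinner (integral {x..} \<Sigma> u) u = complex_of_real (Re (cinner (integral {x..} \<Sigma> u) u))"
proof -
  let ?g = "\<lambda>s. ((cmod (cinner (b s) u))\<^sup>2 + (cmod (cinner (c s) u))\<^sup>2) / 2"
  have self: "cinner (rank1 v v u) u = complex_of_real ((cmod (cinner v u))\<^sup>2)" for v
    by (subst cmod_cinner_commute) (simp add: rank1_apply cinner_scaleC_left mult_cnj_cmod cinner_commute[of v u])
  have eq: "cinner (\<Sigma> s u) u = complex_of_real (?g s)" for s
    by (simp add: \<Sigma>_def blinfun.scaleR_left blinfun.add_left cinner_scaleR_left cinner_add_left self scaleR_conv_of_real)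
  have int: "((\<lambda>s. complex_of_real (?g s)) has_integral cinner (integral {x..} \<Sigma> u) u) {x..}"
    using cinner_integral[OF \<Sigma>_int, of u u] unfolding eq .
  show "(?g has_integral Re (cinner (integral {x..} \<Sigma> u) u)) {x..}"
    using has_integral_linear[OF int bounded_linear_Re] by (simp add: o_def)
  from has_integral_linear[OF this bounded_linear_of_real[where 'a = complex]]
  have "((\<lambda>s. complex_of_real (?g s)) has_integral complex_of_real (Re (cinner (integral {x..} \<Sigma> u) u))) {x..}"
    unfolding o_def .
  from has_integral_unique[OF int this]
  show "cinner (integral {x..} \<Sigma> u) u = complex_of_real (Re (cinner (integral {x..} \<Sigma> u) u))" .
qed

text \<open>The dominating operator is the integral of \<open>(b \<otimes> b + c \<otimes> c) / 2\<close>: pointwise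
  \<open>\<bar>\<langle>b, u\<rangle> \<langle>u, c\<rangle>\<bar> \<le> (\<bar>\<langle>b, u\<rangle>\<bar>\<^sup>2 + \<bar>\<langle>c, u\<rangle>\<bar>\<^sup>2) / 2\<close>, and by Parseval the trace of the integrand is
  \<open>(norm b\<^sup>2 + norm c\<^sup>2) / 2\<close>.\<close>

lemma dominated_integral_rank1:
  assumes "exhausted_basis E G"
  shows "\<exists>S. exhausted_basis.dominated G (integral {x..} (\<lambda>s. rank1 (b s) (c s))) S
    (integral {x..} (\<lambda>s. ((norm (b s))\<^sup>2 + (norm (c s))\<^sup>2) / 2))"
proof -
  interpret exhausted_basis E G by fact
  let ?S = "integral {x..} \<Sigma>" and ?T = "integral {x..} (\<lambda>s. rank1 (b s) (c s))"
  let ?g = "\<lambda>u s. ((cmod (cinner (b s) u))\<^sup>2 + (cmod (cinner (c s) u))\<^sup>2) / 2"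
  have sum_form: "((\<lambda>s. \<Sum>e\<in>F. ?g e s) has_integral (\<Sum>e\<in>F. Re (cinner (?S e) e))) {x..}" if "finite F" for F
    by (intro has_integral_sum that \<Sigma>_form(1))
  have sum_g: "(\<Sum>e\<in>F. ?g e s) = ((\<Sum>e\<in>F. (cmod (cinner (b s) e))\<^sup>2) + (\<Sum>e\<in>F. (cmod (cinner (c s) e))\<^sup>2)) / 2" for F s
    by (simp add: sum.distrib flip: sum_divide_distrib)
  have le_h: "(\<Sum>e\<in>F. ?g e s) \<le> h s" if "finite F" "orthonormal F" for F s
    unfolding sum_g h_def by (intro divide_right_mono add_mono Bessel_inequality that) simp
  have "dominated ?T ?S (integral {x..} h)"
    unfolding dominated_def
  proof (intro conjI allI impI)
    show "clinear_op ?T" by (intro clinear_integral rank1_integrable clinear_rank1)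
    show "clinear_op ?S"
      by (intro clinear_integral \<Sigma>_int) (simp add: \<Sigma>_def clinear_scaleR clinear_add clinear_rank1)
    show "cinner (?S u) u = complex_of_real (Re (cinner (?S u) u))" for u by (rule \<Sigma>_form(2))
    show "cmod (cinner (?T u) u) \<le> Re (cinner (?S u) u)" for u
    proof -
      have T: "((\<lambda>s. cinner (rank1 (b s) (c s) u) u) has_integral cinner (?T u) u) {x..}"
        by (rule cinner_integral[OF rank1_integrable])
      have "norm (integral {x..} (\<lambda>s. cinner (rank1 (b s) (c s) u) u)) \<le> integral {x..} (?g u)"
      proof (rule integral_norm_bound_integral)
        show "(\<lambda>s. cinner (rank1 (b s) (c s) u) u) integrable_on {x..}" using T by blast
        show "?g u integrable_on {x..}" using \<Sigma>_form(1) by blast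
        fix s
        have "norm (cinner (rank1 (b s) (c s) u) u) = cmod (cinner (b s) u) * cmod (cinner (c s) u)"
          by (simp add: rank1_apply cinner_scaleC_left norm_mult cmod_cinner_commute[of u] mult.commute)
        then show "norm (cinner (rank1 (b s) (c s) u) u) \<le> ?g u s"
          using sum_squares_bound[of "cmod (cinner (b s) u)" "cmod (cinner (c s) u)"] by simp
      qed
      then show ?thesis unfolding integral_unique[OF T] integral_unique[OF \<Sigma>_form(1)] .
    qed
    show "(\<Sum>e\<in>F. Re (cinner (?S e) e)) \<le> integral {x..} h" if "finite F" "orthonormal F" for F
      by (rule has_integral_le[OF sum_form[OF that(1)] integrable_integral[OF h_int] le_h[OF that]])
    show "(\<lambda>n. \<Sum>e\<in>G n. Re (cinner (?S e) e)) \<longlonglongrightarrow> integral {x..} h"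
      unfolding integral_unique[OF sum_form[OF finite_G], symmetric]
    proof (rule dominated_convergence(2))
      show "(\<lambda>s. \<Sum>e\<in>G n. ?g e s) integrable_on {x..}" for n using sum_form[OF finite_G] by blast
      show "norm (\<Sum>e\<in>G n. ?g e s) \<le> h s" for n s
        using le_h[OF finite_G orthonormal_G] by (simp add: sum_nonneg)
      show "(\<lambda>n. \<Sum>e\<in>G n. ?g e s) \<longlonglongrightarrow> h s" for s
        unfolding sum_g h_def by (intro tendsto_intros Parseval) simp
    qed (rule h_int)
  qed
  then show ?thesis unfolding h_def[abs_def] by blast
qed

end

section \<open>Rank-one operators from vectors and functionals\<close>

text \<open>\<open>outer b f\<close> is the operator \<open>h \<mapsto> f h b\<close>, through the vector that represents \<open>f\<close>.\<close>

definition outer :: "'h::{complex_hilbert, second_countable_topology} \<Rightarrow> ('h \<Rightarrow>\<^sub>L complex) \<Rightarrow> ('h \<Rightarrow>\<^sub>L 'h)"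
  where "outer b f = rank1 b (cadj f 1)"

lemma cinner_cadj_1: "clinear_op f \<Longrightarrow> cinner h (cadj f 1) = f h"
  for f :: "'h::{complex_hilbert, second_countable_topology} \<Rightarrow>\<^sub>L complex"
  by (simp add: cinner_complex_def flip: cinner_cadj)

lemma outer_apply: "clinear_op f \<Longrightarrow> outer b f h = f h *\<^sub>C b"
  by (simp add: outer_def rank1_apply cinner_cadj_1)

lemma norm_cadj_1_le:
  fixes f :: "'h::{complex_hilbert, second_countable_topology} \<Rightarrow>\<^sub>L complex"
  assumes "clinear_op f" shows "norm (cadj f 1) \<le> norm f"
proof -
  let ?v = "cadj f 1"
  have "(norm ?v)\<^sup>2 = cmod (f ?v)"
    using cinner_self[of ?v] by (simp add: cinner_cadj_1[OF assms] norm_power)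
  also have "\<dots> \<le> norm f * norm ?v" by (rule norm_blinfun)
  finally show ?thesis by (cases "norm ?v = 0") (auto simp: power2_eq_square)
qed

lemma cadj_1_diff:
  fixes f g :: "'h::{complex_hilbert, second_countable_topology} \<Rightarrow>\<^sub>L complex"
  assumes "clinear_op f" "clinear_op g"
  shows "cadj (f - g) 1 = cadj f 1 - cadj g 1"
  by (rule cinner_right_eqI)
    (simp add: cinner_diff_right cinner_cadj_1 assms clinear_diff blinfun.diff_left)

lemma continuous_on_cadj_1:
  fixes f :: "real \<Rightarrow> 'h::{complex_hilbert, second_countable_topology} \<Rightarrow>\<^sub>L complex"
  assumes f: "continuous_on U f" and cl: "\<And>s. clinear_op (f s)"
  shows "continuous_on U (\<lambda>s. cadj (f s) 1)"
  unfolding continuous_on_def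
proof
  fix s assume "s \<in> U"
  then have "((\<lambda>r. f r - f s) \<longlongrightarrow> 0) (at s within U)" using f by (simp add: continuous_on_def LIM_zero_iff)
  then have "((\<lambda>r. cadj (f r) 1 - cadj (f s) 1) \<longlongrightarrow> 0) (at s within U)"
    by (rule Lim_transform_bound[rotated])
      (simp add: norm_cadj_1_le clinear_diff cl flip: cadj_1_diff[OF cl cl])
  then show "((\<lambda>s. cadj (f s) 1) \<longlongrightarrow> cadj (f s) 1) (at s within U)" by (simp add: LIM_zero_iff)
qed

lemma outer_linear:
  fixes f :: "'h::{complex_hilbert, second_countable_topology} \<Rightarrow>\<^sub>L complex"
  shows "outer 0 f = 0" "outer (- b) f = - outer b f"
  by (auto intro!: blinfun_eqI simp: outer_def rank1_apply blinfun.minus_left scaleC_minus_right scaleC_zero_right)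

lemma norm_cadj_le:
  fixes T :: "'h::{complex_hilbert, second_countable_topology} \<Rightarrow>\<^sub>L 'h"
  assumes "clinear_op T" shows "norm (cadj T v) \<le> norm T * norm v"
proof -
  let ?w = "cadj T v"
  have "(norm ?w)\<^sup>2 = cmod (cinner (T ?w) v)"
    using cinner_self[of ?w] by (simp add: cinner_cadj[OF assms] norm_power)
  also have "\<dots> \<le> norm (T ?w) * norm v" by (rule cinner_Cauchy_Schwarz)
  also have "\<dots> \<le> (norm T * norm ?w) * norm v" by (intro mult_right_mono norm_blinfun) simp
  finally have "norm ?w * norm ?w \<le> norm ?w * (norm T * norm v)" by (simp add: power2_eq_square mult_ac)
  then show ?thesis by (cases "norm ?w = 0") auto
qed

section \<open>Exponentials of three commuting operators\<close>

definition flow :: "('a::banach \<Rightarrow>\<^sub>L 'a) \<Rightarrow> ('a \<Rightarrow>\<^sub>L 'a) \<Rightarrow> ('a \<Rightarrow>\<^sub>L 'a) \<Rightarrow> real \<Rightarrow> real \<Rightarrow> real \<Rightarrow> ('a \<Rightarrow>\<^sub>L 'a)"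
  where "flow X Y T x y t = op_exp (x *\<^sub>R X + y *\<^sub>R Y + t *\<^sub>R T)"

lemma flow_0 [simp]: "flow X Y T 0 0 0 = id_blinfun"
  by (simp add: flow_def op_exp_0)

lemma clinear_flow: "clinear_op X \<Longrightarrow> clinear_op Y \<Longrightarrow> clinear_op T \<Longrightarrow> clinear_op (flow X Y T x y t)"
  unfolding flow_def by (intro clinear_op_exp clinear_add clinear_scaleR)

context
  fixes X Y T :: "'a::banach \<Rightarrow>\<^sub>L 'a"
  assumes comm: "X o\<^sub>L Y = Y o\<^sub>L X" "X o\<^sub>L T = T o\<^sub>L X" "Y o\<^sub>L T = T o\<^sub>L Y"
begin

lemma flow_commute:
  "X o\<^sub>L flow X Y T x y t = flow X Y T x y t o\<^sub>L X"
  "Y o\<^sub>L flow X Y T x y t = flow X Y T x y t o\<^sub>L Y"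
  "T o\<^sub>L flow X Y T x y t = flow X Y T x y t o\<^sub>L T"
  unfolding flow_def by (rule op_exp_commute; simp add: comp_linear comm)+

lemma flow_split:
  "flow X Y T x y t = flow X Y T 0 y t o\<^sub>L op_exp (x *\<^sub>R X)"
  "flow X Y T x y t = op_exp (x *\<^sub>R X) o\<^sub>L flow X Y T 0 y t"
proof -
  have c: "(x *\<^sub>R X) o\<^sub>L (y *\<^sub>R Y + t *\<^sub>R T) = (y *\<^sub>R Y + t *\<^sub>R T) o\<^sub>L (x *\<^sub>R X)"
    by (simp add: comp_linear comm mult.commute scaleR_add_right)
  show "flow X Y T x y t = op_exp (x *\<^sub>R X) o\<^sub>L flow X Y T 0 y t"
    using op_exp_add[OF c] by (simp add: flow_def add.assoc)
  show "flow X Y T x y t = flow X Y T 0 y t o\<^sub>L op_exp (x *\<^sub>R X)"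
    using op_exp_add[OF c[symmetric]] by (simp add: flow_def add_ac)
qed

lemma flow_deriv:
  "((\<lambda>x. flow X Y T x y t) has_vector_derivative X o\<^sub>L flow X Y T x y t) (at x)"
  "((\<lambda>y. flow X Y T x y t) has_vector_derivative Y o\<^sub>L flow X Y T x y t) (at y)"
  "((\<lambda>t. flow X Y T x y t) has_vector_derivative T o\<^sub>L flow X Y T x y t) (at t)"
proof -
  have eq: "flow X Y T x y t = op_exp ((y *\<^sub>R Y + t *\<^sub>R T) + x *\<^sub>R X)"
    "flow X Y T x y t = op_exp ((x *\<^sub>R X + t *\<^sub>R T) + y *\<^sub>R Y)" for x y t
    by (simp_all add: flow_def add_ac)
  show "((\<lambda>x. flow X Y T x y t) has_vector_derivative X o\<^sub>L flow X Y T x y t) (at x)"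
    unfolding eq(1) by (rule op_exp_derivative) (simp add: comp_linear comm)
  show "((\<lambda>y. flow X Y T x y t) has_vector_derivative Y o\<^sub>L flow X Y T x y t) (at y)"
    unfolding eq(2) by (rule op_exp_derivative) (simp add: comp_linear comm)
  show "((\<lambda>t. flow X Y T x y t) has_vector_derivative T o\<^sub>L flow X Y T x y t) (at t)"
    unfolding flow_def by (rule op_exp_derivative) (simp add: comp_linear comm)
qed

end

lemma op_pow_numeral: "op_pow A (Suc 0) = A" "op_pow A 2 = A o\<^sub>L A" "op_pow A 3 = A o\<^sub>L (A o\<^sub>L A)"
  by (simp_all add: numeral_2_eq_2 numeral_3_eq_3 op_pow_Suc)

lemma op_pow_apply_add: "op_pow A j (op_pow A k v) = op_pow A (j + k) v"
  by (induction j) (simp_all add: op_pow_Suc)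

section \<open>The linear systems\<close>

locale kp_system =
  fixes \<alpha> \<beta> lam :: complex
    and A1 A2 :: "'h::{complex_hilbert, second_countable_topology} \<Rightarrow>\<^sub>L 'h"
    and B0 :: "complex \<Rightarrow>\<^sub>L 'h" and C0 :: "'h \<Rightarrow>\<^sub>L complex"
  assumes \<alpha>: "\<alpha> \<noteq> 0" and \<beta>: "\<beta> \<noteq> 0"
    and sys1: "linear_system A1 B0 C0" and adm1: "admissible_2_2 A1 B0 C0"
    and sys2: "linear_system A2 B0 C0" and adm2: "admissible_2_2 A2 B0 C0"
begin

lemma clinear [simp]: "clinear_op A1" "clinear_op A2" "clinear_op B0" "clinear_op C0"
  using sys1 sys2 by (auto simp: linear_system_def)

text \<open>The generators of the evolutions in \<open>y\<close> and \<open>t\<close>.\<close>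

definition "My1 = - ((1 / \<beta>) *\<^sub>C op_pow A1 2)"
definition "My2 = (1 / \<beta>) *\<^sub>C op_pow A2 2"
definition "Mt1 = (1 / \<alpha>) *\<^sub>C (op_pow A1 3 + lam *\<^sub>C A1)"
definition "Mt2 = (1 / \<alpha>) *\<^sub>C (op_pow A2 3 + lam *\<^sub>C A2)"

lemma clinear_minus: "clinear_op A \<Longrightarrow> clinear_op (- A)"
  for A :: "'h \<Rightarrow>\<^sub>L 'h"
  using clinear_scaleR[of A "- 1"] by simp

lemma clinear_M [simp]:
  "clinear_op My1" "clinear_op My2" "clinear_op Mt1" "clinear_op Mt2"
  unfolding My1_def My2_def Mt1_def Mt2_def
  by (intro clinear_minus clinear_add clinear_scaleC clinear_op_pow clinear)+

lemma comm1: "- A1 o\<^sub>L My1 = My1 o\<^sub>L - A1" "- A1 o\<^sub>L Mt1 = Mt1 o\<^sub>L - A1" "My1 o\<^sub>L Mt1 = Mt1 o\<^sub>L My1"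
  by (simp_all add: op_pow_numeral My1_def Mt1_def comp_linear comp_scaleC_left comp_scaleC_right comp_assoc clinear_comp
      clinear_add clinear_scaleC scaleC_add_right scaleC_scaleC scaleC_minus_right mult_ac)

lemma comm2: "- A2 o\<^sub>L My2 = My2 o\<^sub>L - A2" "- A2 o\<^sub>L Mt2 = Mt2 o\<^sub>L - A2" "My2 o\<^sub>L Mt2 = Mt2 o\<^sub>L My2"
  by (simp_all add: op_pow_numeral My2_def Mt2_def comp_linear comp_scaleC_left comp_scaleC_right comp_assoc clinear_comp
      clinear_add clinear_scaleC scaleC_add_right scaleC_scaleC scaleC_minus_right mult_ac)

definition "U1 = flow (- A1) My1 Mt1"
definition "U2 = flow (- A2) My2 Mt2"

lemma clinear_U [simp]: "clinear_op (U1 x y t)" "clinear_op (U2 x y t)"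
  unfolding U1_def U2_def by (simp_all add: clinear_flow clinear_minus)

lemma U_0 [simp]: "U1 0 0 0 = id_blinfun" "U2 0 0 0 = id_blinfun"
  by (simp_all add: U1_def U2_def)

lemma U_split:
  "U1 x y t = U1 0 y t o\<^sub>L op_exp (- x *\<^sub>R A1)" "U1 x y t = op_exp (- x *\<^sub>R A1) o\<^sub>L U1 0 y t"
  "U2 x y t = U2 0 y t o\<^sub>L op_exp (- x *\<^sub>R A2)" "U2 x y t = op_exp (- x *\<^sub>R A2) o\<^sub>L U2 0 y t"
  unfolding U1_def U2_def using flow_split[OF comm1, of x y t] flow_split[OF comm2, of x y t] by simp_all

lemmas U1_deriv = flow_deriv[OF comm1, folded U1_def, unfolded flow_commute[OF comm1, folded U1_def]]
lemmas U2_deriv = flow_deriv[OF comm2, folded U2_def]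

lemma U_at_0: "op_exp ((of_real t / \<alpha>) *\<^sub>C (op_pow A1 3 + lam *\<^sub>C A1) - (of_real y / \<beta>) *\<^sub>C op_pow A1 2) = U1 0 y t"
  "op_exp ((of_real t / \<alpha>) *\<^sub>C (op_pow A2 3 + lam *\<^sub>C A2) + (of_real y / \<beta>) *\<^sub>C op_pow A2 2) = U2 0 y t"
  by (simp_all add: U1_def U2_def flow_def My1_def My2_def Mt1_def Mt2_def scaleR_scaleC scaleC_scaleC scaleC_minus_right add.commute)

text \<open>With \<open>b = bv x y t\<close> and \<open>c = cv x y t\<close>, the integrand of \<open>R\<close> is the rank-one operator \<open>b \<otimes> c\<close>; the
  vector \<open>cw x y t\<close> represents the functional \<open>c\<close>.\<close>

definition "bv x y t = U2 x y t (B0 1)"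
definition "cv x y t = C0 o\<^sub>L U1 x y t"
definition "cw x y t = cadj (cv x y t) 1"
definition "integrand x y t = U2 x y t o\<^sub>L (outer (B0 1) C0 o\<^sub>L U1 x y t)"
definition "R = R_op \<alpha> \<beta> lam A1 A2 B0 C0"

lemma clinear_cv [simp]: "clinear_op (cv x y t)"
  by (simp add: cv_def clinear_comp)

lemma integrand_outer: "integrand x y t = outer (bv x y t) (cv x y t)"
  by (rule blinfun_eqI) (simp add: integrand_def outer_apply bv_def clinear_opD, simp add: cv_def)

lemma integrand_rank1: "integrand x y t = rank1 (bv x y t) (cw x y t)"
  by (simp add: integrand_outer outer_def cw_def)

lemma R_eq: "R x y t = integral {x..} (\<lambda>s. integrand s y t)"
proof -
  have "(op_exp (- s *\<^sub>R A2) o\<^sub>L B_op \<alpha> \<beta> lam A2 B0 y t o\<^sub>L C_op \<alpha> \<beta> lam A1 C0 y t o\<^sub>L op_exp (- s *\<^sub>R A1))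
      = integrand s y t" for s
  proof (rule blinfun_eqI)
    fix h
    have B0: "B0 z = z *\<^sub>C B0 1" for z
      using clinear_opD[OF clinear(3), of z 1] by (simp add: scaleC_complex_def)
    let ?z = "C0 (U1 0 y t (op_exp (- s *\<^sub>R A1) h))"
    have "op_exp (- s *\<^sub>R A2) (U2 0 y t (B0 ?z)) = U2 s y t (?z *\<^sub>C B0 1)"
      by (subst B0, subst U_split(4)[of s]) simp
    then show "(op_exp (- s *\<^sub>R A2) o\<^sub>L B_op \<alpha> \<beta> lam A2 B0 y t o\<^sub>L C_op \<alpha> \<beta> lam A1 C0 y t o\<^sub>L op_exp (- s *\<^sub>R A1)) h
        = integrand s y t h"
      unfolding B_op_def C_op_def U_at_0 integrand_def blinfun_apply_blinfun_compose outer_apply[OF clinear(4)] U_split(1)[of s] .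
  qed
  then show ?thesis by (simp add: R_def R_op_def)
qed

lemma integrand_split: "integrand s y t = U2 0 y t o\<^sub>L (integrand s 0 0 o\<^sub>L U1 0 y t)"
  unfolding integrand_def U_split(2)[of s] U_split(3)[of s] by (simp add: comp_assoc)

lemma bv_split: "bv s y t = U2 0 y t (bv s 0 0)"
  unfolding bv_def U_split(3)[of s] by simp

lemma cw_split: "cw s y t = cadj (U1 0 y t) (cw s 0 0)"
proof (rule cinner_right_eqI)
  fix h
  have "cinner h (cw s y t) = cv s 0 0 (U1 0 y t h)"
    by (simp add: cw_def cinner_cadj_1) (simp add: cv_def U_split(2)[of s])
  also have "\<dots> = cinner (U1 0 y t h) (cw s 0 0)" by (simp add: cw_def cinner_cadj_1)
  also have "\<dots> = cinner h (cadj (U1 0 y t) (cw s 0 0))" by (rule cinner_cadj) simp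
  finally show "cinner h (cw s y t) = cinner h (cadj (U1 0 y t) (cw s 0 0))" .
qed

lemma bv_deriv:
  "((\<lambda>x. bv x y t) has_vector_derivative (- A2) (bv x y t)) (at x)"
  "((\<lambda>y. bv x y t) has_vector_derivative My2 (bv x y t)) (at y)"
  "((\<lambda>t. bv x y t) has_vector_derivative Mt2 (bv x y t)) (at t)"
  using U2_deriv[THEN bounded_linear.has_vector_derivative[OF blinfun.bounded_linear_left, of _ _ _ "B0 1"]]
  by (simp_all add: bv_def)

lemma cv_deriv:
  "((\<lambda>x. cv x y t) has_vector_derivative cv x y t o\<^sub>L - A1) (at x)"
  "((\<lambda>y. cv x y t) has_vector_derivative cv x y t o\<^sub>L My1) (at y)"
  "((\<lambda>t. cv x y t) has_vector_derivative cv x y t o\<^sub>L Mt1) (at t)"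
  using U1_deriv[THEN bounded_linear.has_vector_derivative[OF
      bounded_bilinear.bounded_linear_right[OF bounded_bilinear_blinfun_compose], of _ _ _ C0]]
  by (simp_all add: cv_def comp_assoc)

text \<open>As \<open>\<partial>\<^sub>x b = - A2 b\<close> and \<open>\<partial>\<^sub>x c = - c A1\<close>, the derivative of \<open>b \<otimes> c\<close> is a Sylvester expression.\<close>

lemma integrand_deriv: "((\<lambda>x. integrand x y t) has_vector_derivative - ((A2 o\<^sub>L integrand x y t) + (integrand x y t o\<^sub>L A1))) (at x)"
  using comp_has_vector_derivative[OF U2_deriv(1)[of y t x] bounded_linear.has_vector_derivative[OF
      bounded_bilinear.bounded_linear_right[OF bounded_bilinear_blinfun_compose] U1_deriv(1)[of y t x], of "outer (B0 1) C0"]]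
  by (simp add: integrand_def comp_linear comp_assoc algebra_simps)

lemma continuous_UNIV: "(\<And>s. (f has_vector_derivative f' s) (at s)) \<Longrightarrow> continuous_on UNIV f"
  for f :: "real \<Rightarrow> 'b::real_normed_vector"
  by (auto intro!: continuous_at_imp_continuous_on has_vector_derivative_continuous)

lemmas continuous_bv = bv_deriv[THEN continuous_UNIV]
lemmas continuous_cv = cv_deriv[THEN continuous_UNIV]
lemmas continuous_U1 = U1_deriv[THEN continuous_UNIV]
lemmas continuous_U2 = U2_deriv[THEN continuous_UNIV]
lemmas continuous_integrand = integrand_deriv[THEN continuous_UNIV]
lemmas continuous_cw = continuous_cv[THEN continuous_on_cadj_1, OF clinear_cv, folded cw_def]

text \<open>Admissibility gives square integrability at \<open>y = t = 0\<close>; bounded operators carry it elsewhere.\<close>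

lemma square_integrable_0:
  "(\<lambda>s. (norm (op_exp (- s *\<^sub>R A2) (B0 1)))\<^sup>2) integrable_on {x..}"
  "(\<lambda>s. (norm (op_exp (- s *\<^sub>R cadj A1) (cadj C0 1)))\<^sup>2) integrable_on {x..}"
proof -
  have cont: "continuous_on UNIV (\<lambda>s. op_exp (- s *\<^sub>R A) v)" for A :: "'h \<Rightarrow>\<^sub>L 'h" and v
  proof (intro continuous_at_imp_continuous_on ballI has_vector_derivative_continuous)
    show "((\<lambda>s. op_exp (- s *\<^sub>R A) v) has_vector_derivative (- A o\<^sub>L op_exp (s *\<^sub>R - A)) v) (at s)" for s
      using bounded_linear.has_vector_derivative[OF blinfun.bounded_linear_left op_exp_scaleR_derivative[of "- A" s], of v]
      by simp
  qed
  have lin: "op_exp (- s *\<^sub>R A) (B z) = z *\<^sub>C op_exp (- s *\<^sub>R A) (B 1)"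
    if "clinear_op A" "clinear_op B" for A :: "'h \<Rightarrow>\<^sub>L 'h" and B :: "complex \<Rightarrow>\<^sub>L 'h" and s z
  proof -
    have "B z = z *\<^sub>C B 1" using clinear_opD[OF that(2), of z 1] by (simp add: scaleC_complex_def)
    then show ?thesis by (simp only: clinear_opD[OF clinear_op_exp[OF clinear_scaleR[OF that(1)]]])
  qed
  have Xi: "Xi_integrand A2 B0 f = (\<lambda>s. f s *\<^sub>C op_exp (- s *\<^sub>R A2) (B0 1))" for f
    by (rule ext) (unfold Xi_integrand_def, rule lin[OF clinear(2,3)])
  have Theta: "Theta_integrand A1 C0 f = (\<lambda>s. f s *\<^sub>C op_exp (- s *\<^sub>R cadj A1) (cadj C0 1))" for f
    by (rule ext) (unfold Theta_integrand_def, rule lin[OF clinear_cadj[OF clinear(1)] clinear_cadj[OF clinear(4)]])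
  show "(\<lambda>s. (norm (op_exp (- s *\<^sub>R A2) (B0 1)))\<^sup>2) integrable_on {x..}"
    by (rule hilbert_schmidt_half_line[OF cont]) (use adm2 in \<open>auto simp: admissible_2_2_def Xi\<close>)
  show "(\<lambda>s. (norm (op_exp (- s *\<^sub>R cadj A1) (cadj C0 1)))\<^sup>2) integrable_on {x..}"
    by (rule hilbert_schmidt_half_line[OF cont]) (use adm1 in \<open>auto simp: admissible_2_2_def Theta\<close>)
qed

lemma bv_0: "bv s 0 0 = op_exp (- s *\<^sub>R A2) (B0 1)"
  unfolding bv_def U_split(3)[of s] by simp

lemma cw_0: "cw s 0 0 = op_exp (- s *\<^sub>R cadj A1) (cadj C0 1)"
proof (rule cinner_right_eqI)
  fix h
  have adj: "cadj (- s *\<^sub>R A1) = - s *\<^sub>R cadj A1"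
    by (rule cadj_unique)
      (simp add: blinfun.scaleR_left blinfun.minus_left cinner_minus_left cinner_minus_right
        cinner_scaleR_left cinner_scaleR_right cinner_cadj)
  have "cinner h (cw s 0 0) = C0 (op_exp (- s *\<^sub>R A1) h)"
    by (simp add: cw_def cinner_cadj_1) (simp add: cv_def U_split(2)[of s])
  also have "\<dots> = cinner (op_exp (- s *\<^sub>R A1) h) (cadj C0 1)"
    by (simp add: cinner_cadj_1)
  also have "\<dots> = cinner h (op_exp (- s *\<^sub>R cadj A1) (cadj C0 1))"
    using cinner_op_exp[OF clinear_scaleR[OF clinear(1), of "- s"]] unfolding adj .
  finally show "cinner h (cw s 0 0) = cinner h (op_exp (- s *\<^sub>R cadj A1) (cadj C0 1))" .
qed

lemma square_integrable_dominated:
  fixes f :: "real \<Rightarrow> 'b::real_normed_vector"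
  assumes f: "continuous_on UNIV f" and g: "g integrable_on {x..}" "continuous_on UNIV g" and le: "\<And>s. (norm (f s))\<^sup>2 \<le> k * g s"
  shows "(\<lambda>s. (norm (f s))\<^sup>2) integrable_on {x..}" "integral {x..} (\<lambda>s. (norm (f s))\<^sup>2) \<le> k * integral {x..} g"
proof -
  have kg: "(\<lambda>s. k * g s) integrable_on {x..}" "integral {x..} (\<lambda>s. k * g s) = k * integral {x..} g"
    using integrable_on_cmult_left[OF g(1)] by auto
  have cont: "continuous_on UNIV (\<lambda>s. (norm (f s))\<^sup>2)" "continuous_on UNIV (\<lambda>s. k * g s)"
    by (intro continuous_intros f g)+
  have "norm ((norm (f s))\<^sup>2) \<le> k * g s" for s using le by simp
  note dom = dominated_integral_Ici[OF cont this kg(1)]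
  show "(\<lambda>s. (norm (f s))\<^sup>2) integrable_on {x..}" by (rule dom(1))
  show "integral {x..} (\<lambda>s. (norm (f s))\<^sup>2) \<le> k * integral {x..} g" using dom(2) kg(2) by simp
qed

text \<open>The integrals that bound the trace norm of \<open>R\<close>.\<close>

definition "I1 x = integral {x..} (\<lambda>s. (norm (cw s 0 0))\<^sup>2)"
definition "I2 x = integral {x..} (\<lambda>s. (norm (bv s 0 0))\<^sup>2)"

lemma square_integrable:
  "(\<lambda>s. (norm (bv s y t))\<^sup>2) integrable_on {x..}" "integral {x..} (\<lambda>s. (norm (bv s y t))\<^sup>2) \<le> (norm (U2 0 y t))\<^sup>2 * I2 x"
  "(\<lambda>s. (norm (cw s y t))\<^sup>2) integrable_on {x..}" "integral {x..} (\<lambda>s. (norm (cw s y t))\<^sup>2) \<le> (norm (U1 0 y t))\<^sup>2 * I1 x"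
proof -
  have b: "(norm (bv s y t))\<^sup>2 \<le> (norm (U2 0 y t))\<^sup>2 * (norm (bv s 0 0))\<^sup>2" for s
    unfolding bv_split[of s y t] power_mult_distrib[symmetric] by (intro power_mono norm_blinfun) simp
  have c: "(norm (cw s y t))\<^sup>2 \<le> (norm (U1 0 y t))\<^sup>2 * (norm (cw s 0 0))\<^sup>2" for s
    unfolding cw_split[of s y t] power_mult_distrib[symmetric] by (intro power_mono norm_cadj_le) simp_all
  have cont: "continuous_on UNIV (\<lambda>s. (norm (bv s 0 0))\<^sup>2)" "continuous_on UNIV (\<lambda>s. (norm (cw s 0 0))\<^sup>2)"
    by (intro continuous_intros continuous_bv continuous_cw)+
  note bi = square_integrable_dominated[OF continuous_bv(1) square_integrable_0(1)[folded bv_0] cont(1) b]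
  note ci = square_integrable_dominated[OF continuous_cw(1) square_integrable_0(2)[folded cw_0] cont(2) c]
  show "(\<lambda>s. (norm (bv s y t))\<^sup>2) integrable_on {x..}" "integral {x..} (\<lambda>s. (norm (bv s y t))\<^sup>2) \<le> (norm (U2 0 y t))\<^sup>2 * I2 x"
    unfolding I2_def by (rule bi)+
  show "(\<lambda>s. (norm (cw s y t))\<^sup>2) integrable_on {x..}" "integral {x..} (\<lambda>s. (norm (cw s y t))\<^sup>2) \<le> (norm (U1 0 y t))\<^sup>2 * I1 x"
    unfolding I1_def by (rule ci)+
qed

lemma continuous_I: "continuous_on UNIV I1" "continuous_on UNIV I2"
proof -
  have cont: "continuous_on UNIV (\<lambda>s. (norm (bv s 0 0))\<^sup>2)" "continuous_on UNIV (\<lambda>s. (norm (cw s 0 0))\<^sup>2)"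
    by (intro continuous_intros continuous_bv continuous_cw)+
  show "continuous_on UNIV I1" "continuous_on UNIV I2"
    unfolding I1_def I2_def
    by (rule continuous_UNIV integral_Ici_has_vector_derivative cont square_integrable)+
qed

text \<open>An upper bound for the trace norm of \<open>R x y t\<close> that is continuous in each variable.\<close>

definition "trace_bound x y t = ((norm (U2 0 y t))\<^sup>2 * I2 x + (norm (U1 0 y t))\<^sup>2 * I1 x) / 2"

lemma continuous_trace_bound:
  "continuous_on UNIV (\<lambda>x. trace_bound x y t)" "continuous_on UNIV (\<lambda>y. trace_bound x y t)" "continuous_on UNIV (\<lambda>t. trace_bound x y t)"
  unfolding trace_bound_def
  by (intro continuous_intros continuous_I continuous_U1 continuous_U2; simp)+

lemma integrand_integrable: "(\<lambda>s. integrand s y t) integrable_on {x..}"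
  unfolding integrand_rank1 by (intro rank1_integrable continuous_bv continuous_cw square_integrable)

lemma R_dominated:
  assumes "exhausted_basis E G"
  shows "\<exists>S. \<exists>K\<le>trace_bound x y t. exhausted_basis.dominated G (R x y t) S K"
proof -
  let ?K = "integral {x..} (\<lambda>s. ((norm (bv s y t))\<^sup>2 + (norm (cw s y t))\<^sup>2) / 2)"
  have "?K = (integral {x..} (\<lambda>s. (norm (bv s y t))\<^sup>2) + integral {x..} (\<lambda>s. (norm (cw s y t))\<^sup>2)) / 2"
    by (simp add: integral_add square_integrable)
  also have "\<dots> \<le> trace_bound x y t"
    unfolding trace_bound_def by (intro divide_right_mono add_mono square_integrable) simp
  finally show ?thesis
    using dominated_integral_rank1[OF continuous_bv(1) continuous_cw(1) square_integrable(1) square_integrable(3) assms, of x y t y t]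
    unfolding R_eq integrand_rank1 by blast
qed

lemma clinear_R [simp]: "clinear_op (R x y t)"
  unfolding R_eq by (intro clinear_integral integrand_integrable) (simp add: integrand_rank1 clinear_rank1)

text \<open>Since \<open>A2\<close> commutes with the evolution of \<open>b\<close>, and \<open>A1\<close> with that of \<open>c\<close>, the dependence on \<open>y\<close> and \<open>t\<close>
  moves out of the integral. This makes \<open>R\<close> differentiable in \<open>y\<close> and \<open>t\<close> without differentiating under the
  integral sign.\<close>

lemma R_split: "R x y t = U2 0 y t o\<^sub>L (R x 0 0 o\<^sub>L U1 0 y t)"
proof -
  have "bounded_linear (\<lambda>T. U2 0 y t o\<^sub>L (T o\<^sub>L U1 0 y t))"
    by (intro bounded_linear_compose[OF bounded_bilinear.bounded_linear_right[OF bounded_bilinear_blinfun_compose]]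
        bounded_bilinear.bounded_linear_left[OF bounded_bilinear_blinfun_compose])
  from has_integral_linear[OF integrable_integral[OF integrand_integrable[of 0 0 x]] this]
  have "((\<lambda>s. integrand s y t) has_integral U2 0 y t o\<^sub>L (R x 0 0 o\<^sub>L U1 0 y t)) {x..}"
    unfolding o_def integrand_split[symmetric] R_eq[symmetric] .
  then show ?thesis unfolding R_eq[of x y t] by (rule integral_unique)
qed

lemma R_deriv:
  "((\<lambda>x. R x y t) has_vector_derivative - integrand x y t) (at x)"
  "((\<lambda>y. R x y t) has_vector_derivative (My2 o\<^sub>L R x y t) + (R x y t o\<^sub>L My1)) (at y)"
  "((\<lambda>t. R x y t) has_vector_derivative (Mt2 o\<^sub>L R x y t) + (R x y t o\<^sub>L Mt1)) (at t)"
proof -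
  show "((\<lambda>x. R x y t) has_vector_derivative - integrand x y t) (at x)"
    unfolding R_eq by (intro integral_Ici_has_vector_derivative continuous_integrand integrand_integrable)
  note L = bounded_linear.has_vector_derivative[OF bounded_bilinear.bounded_linear_right[OF bounded_bilinear_blinfun_compose]]
  show "((\<lambda>y. R x y t) has_vector_derivative (My2 o\<^sub>L R x y t) + (R x y t o\<^sub>L My1)) (at y)"
    unfolding R_split[of x _ t]
    using comp_has_vector_derivative[OF U2_deriv(2)[of 0 t y] L[OF U1_deriv(2)[of 0 t y], of "R x 0 0"]]
    by (simp add: comp_assoc add.commute)
  show "((\<lambda>t. R x y t) has_vector_derivative (Mt2 o\<^sub>L R x y t) + (R x y t o\<^sub>L Mt1)) (at t)"
    unfolding R_split[of x y]
    using comp_has_vector_derivative[OF U2_deriv(3)[of 0 y t] L[OF U1_deriv(3)[of 0 y t], of "R x 0 0"]]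
    by (simp add: comp_assoc add.commute)
qed

text \<open>Both sides have the same derivative in \<open>x\<close>, and both tend to \<open>0\<close> at infinity.\<close>

lemma Sylvester: "(A2 o\<^sub>L R x y t) + (R x y t o\<^sub>L A1) = integrand x y t"
proof -
  define Z where "Z x = (A2 o\<^sub>L R x y t) + (R x y t o\<^sub>L A1) - integrand x y t" for x
  note L = bounded_linear.has_vector_derivative[OF bounded_bilinear.bounded_linear_right[OF bounded_bilinear_blinfun_compose]]
  note L' = bounded_linear.has_vector_derivative[OF bounded_bilinear.bounded_linear_left[OF bounded_bilinear_blinfun_compose]]
  have Z: "(Z has_vector_derivative 0) (at x within UNIV)" for x
    unfolding Z_def
    using has_vector_derivative_diff[OF has_vector_derivative_add[OF L[OF R_deriv(1)[of y t x], of A2] L'[OF R_deriv(1)[of y t x], of A1]]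
        integrand_deriv[of y t x]]
    by (simp add: comp_linear)
  obtain z where "\<And>x. x \<in> UNIV \<Longrightarrow> Z x = z"
    by (rule has_vector_derivative_zero_constant[OF convex_UNIV Z]) blast
  then have z: "Z x = z" for x by simp
  have R0: "((\<lambda>x. R x y t) \<longlongrightarrow> 0) at_top"
    unfolding R_eq by (intro integral_Ici_tendsto_0 continuous_integrand integrand_integrable)
  note B = bounded_bilinear.tendsto[OF bounded_bilinear_blinfun_compose]
  have "((\<lambda>x. (A2 o\<^sub>L R x y t) + (R x y t o\<^sub>L A1) - z) \<longlongrightarrow> (A2 o\<^sub>L 0) + (0 o\<^sub>L A1) - z) at_top"
    by (intro tendsto_add tendsto_diff B R0 tendsto_const)
  moreover have "(A2 o\<^sub>L R x y t) + (R x y t o\<^sub>L A1) - z = integrand x y t" for x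
    using z[of x] by (simp add: Z_def algebra_simps)
  ultimately have "((\<lambda>x. integrand x y t) \<longlongrightarrow> (A2 o\<^sub>L 0) + (0 o\<^sub>L A1) - z) at_top"
    by simp
  from integrable_limit_zero[OF continuous_integrand integrand_integrable this]
  have "z = 0" by (simp add: bounded_bilinear.zero_left[OF bounded_bilinear_blinfun_compose]
      bounded_bilinear.zero_right[OF bounded_bilinear_blinfun_compose])
  then show ?thesis using z[of x] by (simp add: Z_def)
qed

end

section \<open>Differential polynomials\<close>

text \<open>The functions \<open>P j k\<close> attached below to the systems have derivatives in \<open>x\<close>, \<open>y\<close> and \<open>t\<close> that are
  quadratic polynomials in themselves. All the derivatives in the equation are therefore values of formal
  polynomials in variables \<open>Pv j k\<close>, and the equation is a polynomial identity. As syntax trees, the polynomials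
  come with their derivations by recursion, and an identity is a statement about their values at all \<open>p\<close>.\<close>

datatype dexp = Pv nat nat | Plus dexp dexp | Minus dexp dexp | Times dexp dexp

primrec deval :: "(nat \<Rightarrow> nat \<Rightarrow> complex) \<Rightarrow> dexp \<Rightarrow> complex" where
  "deval p (Pv j k) = p j k"
| "deval p (Plus e f) = deval p e + deval p f"
| "deval p (Minus e f) = deval p e - deval p f"
| "deval p (Times e f) = deval p e * deval p f"

primrec derivation :: "(nat \<Rightarrow> nat \<Rightarrow> dexp) \<Rightarrow> dexp \<Rightarrow> dexp" where
  "derivation D (Pv j k) = D j k"
| "derivation D (Plus e f) = Plus (derivation D e) (derivation D f)"
| "derivation D (Minus e f) = Minus (derivation D e) (derivation D f)"
| "derivation D (Times e f) = Plus (Times (derivation D e) f) (Times e (derivation D f))"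

text \<open>\<open>Dx\<close> stands for \<open>\<partial>\<^sub>x\<close>, \<open>Dy\<close> for \<open>\<beta> \<partial>\<^sub>y\<close> and \<open>Dt\<close> for \<open>\<alpha> \<partial>\<^sub>t + \<lambda> \<partial>\<^sub>x\<close>. In these combinations the parameters
  disappear, from the derivations and from the equation.\<close>

definition "Dx = derivation (\<lambda>j k. Minus (Times (Pv j 0) (Pv 0 k)) (Plus (Pv (j + 1) k) (Pv j (k + 1))))"
definition "Dy = derivation (\<lambda>j k. Plus (Minus (Pv j (k + 2)) (Pv (j + 2) k)) (Minus (Times (Pv j 0) (Pv 1 k)) (Times (Pv j 1) (Pv 0 k))))"
definition "Dt = derivation (\<lambda>j k. Minus (Plus (Pv (j + 3) k) (Pv j (k + 3)))
  (Plus (Minus (Times (Pv j 2) (Pv 0 k)) (Times (Pv j 1) (Pv 1 k))) (Times (Pv j 0) (Pv 2 k))))"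

abbreviation "Vx \<equiv> Dx (Pv 0 0)"
abbreviation "Vxx \<equiv> Dx Vx"

text \<open>The equation for \<open>v = P 0 0\<close>, where \<open>u = 2 \<partial>\<^sub>x v\<close>, integrated once in \<open>x\<close>.\<close>

lemma kp_identity:
  "deval p (Dx (Dx Vxx)) - 12 * deval p Vx * deval p Vxx + 4 * deval p (Dx (Dt (Pv 0 0))) + 3 * deval p (Dy (Dy (Pv 0 0))) = 0"
  by (simp add: Dx_def Dy_def Dt_def algebra_simps numeral_2_eq_2 numeral_3_eq_3)

lemma derivations_commute:
  "deval p (Dx (Dt (Pv 0 0))) = deval p (Dt (Dx (Pv 0 0)))"
  "deval p (Dx (Dy (Dy (Pv 0 0)))) = deval p (Dy (Dy (Dx (Pv 0 0))))"
  by (simp_all add: Dx_def Dy_def Dt_def algebra_simps numeral_2_eq_2 numeral_3_eq_3)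

section \<open>The entries of the resolvent\<close>

lemma sum_lessThan_3: "(\<Sum>k<3. f k) = f 0 + f 1 + f (2::nat)" for f :: "nat \<Rightarrow> 'a::comm_monoid_add"
  by (simp add: numeral_3_eq_3 numeral_2_eq_2)

context kp_system
begin

definition "cv_pow k x y t = cv x y t o\<^sub>L op_pow A1 k"

text \<open>The \<open>x\<close>-, \<open>y\<close>- and \<open>t\<close>-derivatives of \<open>R\<close> are \<open>\<Sum>k<3. p k \<otimes> (c A1 ^ k)\<close> with \<open>p\<close> one of the next three
  families of vectors.\<close>

definition "Rx_vec k x y t = (if k = 0 then - bv x y t else 0)" for k :: nat

definition "Ry_vec k x y t = (if k = 0 then (1 / \<beta>) *\<^sub>C A2 (bv x y t)
  else if k = 1 then - ((1 / \<beta>) *\<^sub>C bv x y t) else 0)" for k :: nat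

definition "Rt_vec k x y t = (if k = 0 then (1 / \<alpha>) *\<^sub>C (op_pow A2 2 (bv x y t) + lam *\<^sub>C bv x y t)
  else if k = 1 then - ((1 / \<alpha>) *\<^sub>C A2 (bv x y t)) else (1 / \<alpha>) *\<^sub>C bv x y t)" for k :: nat

lemma clinear_cv_pow [simp]: "clinear_op (cv_pow k x y t)"
  by (simp add: cv_pow_def clinear_comp clinear_op_pow)

lemma Sylvester_apply: "A2 (R x y t h) = cv x y t h *\<^sub>C bv x y t - R x y t (A1 h)"
  using arg_cong[OF Sylvester[of x y t], of "\<lambda>T. blinfun_apply T h"]
  by (simp add: blinfun.add_left integrand_outer outer_apply eq_diff_eq)

text \<open>In \<open>y\<close> the derivative is \<open>(A2\<^sup>2 R - R A1\<^sup>2) / \<beta>\<close>, and in \<open>t\<close> it is \<open>(A2\<^sup>3 R + R A1\<^sup>3 + \<lambda> (A2 R + R A1)) / \<alpha>\<close>.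
  Moving the powers of \<open>A2\<close> through \<open>R\<close> by the Sylvester equation cancels all terms that contain \<open>R\<close>.\<close>

lemma R_derivative_finite_rank:
  "((\<lambda>x. R x y t) has_vector_derivative (\<Sum>k<3. outer (Rx_vec k x y t) (cv_pow k x y t))) (at x)"
  "((\<lambda>y. R x y t) has_vector_derivative (\<Sum>k<3. outer (Ry_vec k x y t) (cv_pow k x y t))) (at y)"
  "((\<lambda>t. R x y t) has_vector_derivative (\<Sum>k<3. outer (Rt_vec k x y t) (cv_pow k x y t))) (at t)"
proof -
  note simps = sum_lessThan_3 cv_pow_def blinfun.add_left outer_apply clinear_comp clinear_op_pow op_pow_numeral
    scaleC_blinfun.rep_eq blinfun.minus_left blinfun.minus_right blinfun.add_right blinfun.diff_right clinear_opD
    Sylvester_apply scaleC_add_right scaleC_diff_right scaleC_minus_right scaleC_scaleC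
  have "- integrand x y t = (\<Sum>k<3. outer (Rx_vec k x y t) (cv_pow k x y t))"
    by (simp add: sum_lessThan_3 Rx_vec_def cv_pow_def outer_linear integrand_outer)
  then show "((\<lambda>x. R x y t) has_vector_derivative (\<Sum>k<3. outer (Rx_vec k x y t) (cv_pow k x y t))) (at x)"
    using R_deriv(1) by metis
  have "(My2 o\<^sub>L R x y t) + (R x y t o\<^sub>L My1) = (\<Sum>k<3. outer (Ry_vec k x y t) (cv_pow k x y t))"
    by (rule blinfun_eqI) (simp add: simps Ry_vec_def My1_def My2_def mult_ac)
  then show "((\<lambda>y. R x y t) has_vector_derivative (\<Sum>k<3. outer (Ry_vec k x y t) (cv_pow k x y t))) (at y)"
    using R_deriv(2) by metis
  have "(Mt2 o\<^sub>L R x y t) + (R x y t o\<^sub>L Mt1) = (\<Sum>k<3. outer (Rt_vec k x y t) (cv_pow k x y t))"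
    by (rule blinfun_eqI) (simp add: simps Rt_vec_def Mt1_def Mt2_def mult_ac)
  then show "((\<lambda>t. R x y t) has_vector_derivative (\<Sum>k<3. outer (Rt_vec k x y t) (cv_pow k x y t))) (at t)"
    using R_deriv(3) by metis
qed

definition "resolvent x y t = (SOME B. op_inverses (id_blinfun + R x y t) B)"

text \<open>The entries \<open>c A1\<^sup>j (I + R)\<^sup>-\<^sup>1 A2\<^sup>k b\<close>.\<close>

definition "P x y t j k = cv x y t (op_pow A1 j (resolvent x y t (op_pow A2 k (bv x y t))))"

text \<open>The derivative \<open>- (I + R)\<^sup>-\<^sup>1 R' (I + R)\<^sup>-\<^sup>1\<close> of the resolvent splits, for \<open>R'\<close> a sum of the operators
  \<open>p \<otimes> (c A1\<^sup>l)\<close>, into products of two entries.\<close>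

lemma P_curve_derivative:
  fixes X Y T :: "real \<Rightarrow> real"
  assumes b: "((\<lambda>s. bv (X s) (Y s) (T s)) has_vector_derivative b') (at s)"
    and c: "((\<lambda>s. cv (X s) (Y s) (T s)) has_vector_derivative c') (at s)"
    and R: "((\<lambda>s. R (X s) (Y s) (T s)) has_vector_derivative (\<Sum>l<3. outer (p l) (cv_pow l (X s) (Y s) (T s)))) (at s)"
    and inv: "\<forall>\<^sub>F r in nhds s. op_inverses (id_blinfun + R (X r) (Y r) (T r)) (resolvent (X r) (Y r) (T r))"
  shows "((\<lambda>s. P (X s) (Y s) (T s) j k) has_vector_derivative
    c' (op_pow A1 j (resolvent (X s) (Y s) (T s) (op_pow A2 k (bv (X s) (Y s) (T s)))))
    + cv (X s) (Y s) (T s) (op_pow A1 j (resolvent (X s) (Y s) (T s) (op_pow A2 k b')))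
    - (\<Sum>l<3. P (X s) (Y s) (T s) l k * cv (X s) (Y s) (T s) (op_pow A1 j (resolvent (X s) (Y s) (T s) (p l))))) (at s)"
proof -
  let ?G = "\<lambda>s. resolvent (X s) (Y s) (T s)" and ?b = "\<lambda>s. bv (X s) (Y s) (T s)" and ?c = "\<lambda>s. cv (X s) (Y s) (T s)"
  let ?R' = "\<Sum>l<3. outer (p l) (cv_pow l (X s) (Y s) (T s))"
  have clG: "clinear_op (?G s)"
    by (rule clinear_op_inverse[OF eventually_nhds_x_imp_x[OF inv]]) (simp add: clinear_add clinear_id)
  have "((\<lambda>s. id_blinfun + R (X s) (Y s) (T s)) has_vector_derivative 0 + ?R') (at s)"
    by (intro has_vector_derivative_add has_vector_derivative_const R)
  from op_inverse_has_vector_derivative[OF this inv]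
  have G: "(?G has_vector_derivative - (?G s o\<^sub>L (?R' o\<^sub>L ?G s))) (at s)" by simp
  note ap = bounded_bilinear.has_vector_derivative[OF bounded_bilinear_blinfun_apply]
  note lin = bounded_linear.has_vector_derivative[OF blinfun.bounded_linear_right]
  have R': "?R' h = (\<Sum>l<3. ?c s (op_pow A1 l h) *\<^sub>C p l)" for h
    by (simp add: blinfun.sum_left outer_apply, simp add: cv_pow_def)
  from ap[OF c lin[OF ap[OF G lin[OF b, of "op_pow A2 k"]], of "op_pow A1 j"]]
  show ?thesis
    by (simp add: P_def R' blinfun.add_right blinfun.diff_right blinfun.minus_left blinfun.minus_right blinfun.sum_right
        clinear_opD clG clinear_op_pow scaleC_complex_def algebra_simps)
qed

lemma P_derivative:
  "\<forall>\<^sub>F r in nhds x. op_inverses (id_blinfun + R r y t) (resolvent r y t) \<Longrightarrow>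
    ((\<lambda>x. P x y t j k) has_vector_derivative deval (P x y t) (Dx (Pv j k))) (at x)"
  "\<forall>\<^sub>F r in nhds y. op_inverses (id_blinfun + R x r t) (resolvent x r t) \<Longrightarrow>
    ((\<lambda>y. P x y t j k) has_vector_derivative deval (P x y t) (Dy (Pv j k)) / \<beta>) (at y)"
  "\<forall>\<^sub>F r in nhds t. op_inverses (id_blinfun + R x y r) (resolvent x y r) \<Longrightarrow>
    ((\<lambda>t. P x y t j k) has_vector_derivative
      (deval (P x y t) (Dt (Pv j k)) - lam * deval (P x y t) (Dx (Pv j k))) / \<alpha>) (at t)"
proof -
  have A: "A1 v = op_pow A1 1 v" "A2 v = op_pow A2 1 v" for v by (simp_all add: op_pow_numeral)
  note simps = P_def sum_lessThan_3 Dx_def Dy_def Dt_def op_pow_apply_add scaleC_blinfun.rep_eq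
    blinfun.add_left blinfun.minus_left blinfun.minus_right blinfun.add_right blinfun.diff_right clinear_opD clinear_op_pow
    scaleC_complex_def
  have clG: "clinear_op (resolvent x y t)" if "op_inverses (id_blinfun + R x y t) (resolvent x y t)"
    by (rule clinear_op_inverse[OF that]) (simp add: clinear_add clinear_id)
  show "((\<lambda>x. P x y t j k) has_vector_derivative deval (P x y t) (Dx (Pv j k))) (at x)"
    if inv: "\<forall>\<^sub>F r in nhds x. op_inverses (id_blinfun + R r y t) (resolvent r y t)"
    using P_curve_derivative[OF bv_deriv(1) cv_deriv(1) R_derivative_finite_rank(1) inv, of j k]
      clG[OF eventually_nhds_x_imp_x[OF inv]]
    by (simp add: simps Rx_vec_def A algebra_simps)
  show "((\<lambda>y. P x y t j k) has_vector_derivative deval (P x y t) (Dy (Pv j k)) / \<beta>) (at y)"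
    if inv: "\<forall>\<^sub>F r in nhds y. op_inverses (id_blinfun + R x r t) (resolvent x r t)"
    using P_curve_derivative[OF bv_deriv(2) cv_deriv(2) R_derivative_finite_rank(2) inv, of j k]
      clG[OF eventually_nhds_x_imp_x[OF inv]]
    by (simp add: simps Ry_vec_def My1_def My2_def A divide_inverse algebra_simps)
  show "((\<lambda>t. P x y t j k) has_vector_derivative
      (deval (P x y t) (Dt (Pv j k)) - lam * deval (P x y t) (Dx (Pv j k))) / \<alpha>) (at t)"
    if inv: "\<forall>\<^sub>F r in nhds t. op_inverses (id_blinfun + R x y r) (resolvent x y r)"
    using P_curve_derivative[OF bv_deriv(3) cv_deriv(3) R_derivative_finite_rank(3) inv, of j k]
      clG[OF eventually_nhds_x_imp_x[OF inv]]
    by (simp add: simps Rt_vec_def Mt1_def Mt2_def A divide_inverse algebra_simps)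
qed

end

section \<open>The tau function\<close>

locale kp_determinant = kp_system \<alpha> \<beta> lam A1 A2 B0 C0 + exhausted_basis E G
  for \<alpha> \<beta> lam :: complex
    and A1 A2 :: "'h::{complex_hilbert, second_countable_topology} \<Rightarrow>\<^sub>L 'h"
    and B0 :: "complex \<Rightarrow>\<^sub>L 'h" and C0 :: "'h \<Rightarrow>\<^sub>L complex"
    and E :: "'h set" and G :: "nat \<Rightarrow> 'h set" +
  assumes E_choice: "E = (SOME E. orthonormal_basis E)"
begin

definition "\<tau> = tau \<alpha> \<beta> lam A1 A2 B0 C0"

lemma detn_tendsto_tau: "(\<lambda>n. detn n (R x y t)) \<longlonglongrightarrow> \<tau> x y t"
proof -
  obtain S K where "dominated (R x y t) S K"
    using R_dominated[OF exhausted_basis_axioms] by blast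
  from detn_tendsto_infsum[OF this] show ?thesis
    unfolding \<tau>_def tau_def fredholm_det_def Let_def E_choice[symmetric] R_def .
qed

lemma resolvent_inverse: "\<tau> x y t \<noteq> 0 \<Longrightarrow> op_inverses (id_blinfun + R x y t) (resolvent x y t)"
proof -
  assume "\<tau> x y t \<noteq> 0"
  obtain S K where "dominated (R x y t) S K"
    using R_dominated[OF exhausted_basis_axioms] by blast
  from invertible_if_limit_nonzero[OF this detn_tendsto_tau \<open>\<tau> x y t \<noteq> 0\<close>]
  show ?thesis unfolding resolvent_def by (rule someI_ex)
qed

lemma eventually_nonzero:
  fixes f :: "real \<Rightarrow> complex"
  assumes "isCont f s" "f s \<noteq> 0" shows "\<forall>\<^sub>F r in nhds s. f r \<noteq> 0"
proof -
  have "(f \<longlongrightarrow> f s) (nhds s)"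
    using assms(1) by (simp add: isCont_def tendsto_at_iff_tendsto_nhds)
  then show ?thesis using assms(2) by (rule tendsto_imp_eventually_ne)
qed

lemma bounded_above_ivl:
  fixes f :: "real \<Rightarrow> real"
  assumes "continuous_on UNIV f" shows "\<exists>K. \<forall>s\<in>{a..b}. f s \<le> K"
proof -
  have "compact (f ` {a..b})"
    by (intro compact_continuous_image continuous_on_subset[OF assms]) auto
  then have "bdd_above (f ` {a..b})" by (intro bounded_imp_bdd_above compact_imp_bounded)
  then show ?thesis by (auto simp: bdd_above_def)
qed

text \<open>A common statement for curves in the three coordinate directions: continuity keeps \<open>\<tau>\<close> away from zero
  near a point, in each of them, and the derivative formula in \<open>x\<close> gives the potential.\<close>

lemma tau_curve:
  fixes X Y T :: "real \<Rightarrow> real" and p :: "nat \<Rightarrow> real \<Rightarrow> 'h"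
  assumes K: "continuous_on UNIV (\<lambda>s. trace_bound (X s) (Y s) (T s))"
    and R: "\<And>s. ((\<lambda>s. R (X s) (Y s) (T s)) has_vector_derivative
      (\<Sum>k<3. outer (p k s) (cv_pow k (X s) (Y s) (T s)))) (at s)"
    and p: "\<And>k. continuous_on UNIV (p k)"
    and c: "continuous_on UNIV (\<lambda>s. cv (X s) (Y s) (T s))"
  shows "isCont (\<lambda>s. \<tau> (X s) (Y s) (T s)) s"
    and "\<tau> (X s) (Y s) (T s) \<noteq> 0 \<Longrightarrow> ((\<lambda>s. \<tau> (X s) (Y s) (T s)) has_vector_derivative
      \<tau> (X s) (Y s) (T s) * (\<Sum>k<3. cv_pow k (X s) (Y s) (T s) (resolvent (X s) (Y s) (T s) (p k s)))) (at s)"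
proof -
  define q where "q k s = cadj (cv_pow k (X s) (Y s) (T s)) 1" for k s
  let ?R = "\<lambda>s. R (X s) (Y s) (T s)" and ?\<tau> = "\<lambda>s. \<tau> (X s) (Y s) (T s)" and ?G = "\<lambda>s. resolvent (X s) (Y s) (T s)"
  have q: "continuous_on UNIV (q k)" for k
    unfolding q_def
    by (intro continuous_on_cadj_1 clinear_cv_pow)
      (unfold cv_pow_def, intro bounded_bilinear.continuous_on[OF bounded_bilinear_blinfun_compose] c continuous_on_const)
  have "\<forall>s. \<exists>S. \<exists>K\<le>trace_bound (X s) (Y s) (T s). dominated (?R s) S K"
    using R_dominated[OF exhausted_basis_axioms] by blast
  then obtain S where S: "\<And>s. \<exists>K\<le>trace_bound (X s) (Y s) (T s). dominated (?R s) (S s) K"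
    unfolding choice_iff by blast
  have cont: "continuous_on {a..b} ?\<tau>"
    and deriv: "(\<And>s. s \<in> {a..b} \<Longrightarrow> ?\<tau> s \<noteq> 0) \<Longrightarrow> s \<in> {a<..<b} \<Longrightarrow>
      (?\<tau> has_vector_derivative ?\<tau> s * (\<Sum>k<3. cinner (?G s (p k s)) (q k s))) (at s)" for a b s
  proof -
    obtain K0 where K0: "\<forall>s\<in>{a..b}. trace_bound (X s) (Y s) (T s) \<le> K0"
      using bounded_above_ivl[OF K] by blast
    have "continuous_on UNIV (\<lambda>s. \<Sum>k<3. norm (p k s) * norm (q k s))"
      by (intro continuous_intros p q)
    then obtain c0 where c0: "\<forall>s\<in>{a..b}. (\<Sum>k<3. norm (p k s) * norm (q k s)) \<le> c0"
      using bounded_above_ivl by blast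
    have d1: "(?R has_vector_derivative (\<Sum>k<3. rank1 (p k s) (q k s))) (at s)" for s
      using R[of s] unfolding outer_def q_def .
    have d2: "\<exists>K'\<le>K0. dominated (?R s) (S s) K'" if "s \<in> {a..b}" for s
    proof -
      obtain K' where "K' \<le> trace_bound (X s) (Y s) (T s)" "dominated (?R s) (S s) K'" using S by blast
      then show ?thesis using K0 that order_trans by blast
    qed
    have d3: "norm (p k s) * norm (q k s) \<le> c0" if "s \<in> {a..b}" "k \<in> {..<3}" for s k
    proof -
      have "norm (p k s) * norm (q k s) \<le> (\<Sum>k<3. norm (p k s) * norm (q k s))"
        using that by (intro member_le_sum) auto
      then show ?thesis using c0 that by (meson order_trans)
    qed
    show "continuous_on {a..b} ?\<tau>"
      by (rule determinant_path_continuous[where T = ?R and S = S and K = K0 and c = c0 and I = "{..<3}" and x = p and y = q])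
        (simp_all add: d1 d2 d3 detn_tendsto_tau)
    show "(?\<tau> has_vector_derivative ?\<tau> s * (\<Sum>k<3. cinner (?G s (p k s)) (q k s))) (at s)"
      if nz: "\<And>s. s \<in> {a..b} \<Longrightarrow> ?\<tau> s \<noteq> 0" and s: "s \<in> {a<..<b}"
      by (rule determinant_path_derivative[where T = ?R and S = S and K = K0 and c = c0 and I = "{..<3}" and x = p and y = q
            and a = a and b = b and d = ?\<tau> and B = ?G])
        (use s in \<open>simp_all add: d1 d2 d3 detn_tendsto_tau resolvent_inverse nz continuous_on_subset[OF p] continuous_on_subset[OF q]\<close>)
  qed
  show isCont: "isCont ?\<tau> s"
    by (rule continuous_on_interior[OF cont[of "s - 1" "s + 1"]]) (simp add: interior_atLeastAtMost_real)
  assume "?\<tau> s \<noteq> 0"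
  with isCont have "\<forall>\<^sub>F r in nhds s. ?\<tau> r \<noteq> 0" by (rule eventually_nonzero)
  then obtain d where d: "d > 0" "\<And>r. dist r s < d \<Longrightarrow> ?\<tau> r \<noteq> 0"
    unfolding eventually_nhds_metric by blast
  have "?\<tau> r \<noteq> 0" if "r \<in> {s - d / 2..s + d / 2}" for r
    using that d(1) by (intro d(2)) (auto simp: dist_real_def)
  from deriv[OF this] have "(?\<tau> has_vector_derivative ?\<tau> s * (\<Sum>k<3. cinner (?G s (p k s)) (q k s))) (at s)"
    using d(1) by simp
  then show "(?\<tau> has_vector_derivative ?\<tau> s * (\<Sum>k<3. cv_pow k (X s) (Y s) (T s) (?G s (p k s)))) (at s)"
    by (simp add: q_def cinner_cadj_1)
qed

lemma continuous_R_vec: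
  "continuous_on UNIV (\<lambda>x. Rx_vec k x y t)" "continuous_on UNIV (\<lambda>y. Ry_vec k x y t)" "continuous_on UNIV (\<lambda>t. Rt_vec k x y t)"
proof -
  note lin = bounded_linear.continuous_on[OF blinfun.bounded_linear_right] bounded_linear.continuous_on[OF bounded_linear_scaleC]
  show "continuous_on UNIV (\<lambda>x. Rx_vec k x y t)"
    unfolding Rx_vec_def by (cases "k = 0") (auto intro!: continuous_intros continuous_bv)
  show "continuous_on UNIV (\<lambda>y. Ry_vec k x y t)"
    unfolding Ry_vec_def by (cases "k = 0"; cases "k = 1") (auto intro!: continuous_on_minus lin continuous_bv)
  show "continuous_on UNIV (\<lambda>t. Rt_vec k x y t)"
    unfolding Rt_vec_def by (cases "k = 0"; cases "k = 1") (auto intro!: continuous_on_minus continuous_on_add lin continuous_bv)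
qed

lemma tau_isCont:
  "isCont (\<lambda>x. \<tau> x y t) x" "isCont (\<lambda>y. \<tau> x y t) y" "isCont (\<lambda>t. \<tau> x y t) t"
  by (rule tau_curve(1) continuous_trace_bound R_derivative_finite_rank continuous_R_vec continuous_cv)+

lemma tau_nonzero_nhds:
  assumes "\<tau> x y t \<noteq> 0"
  shows "\<forall>\<^sub>F s in nhds x. \<tau> s y t \<noteq> 0" "\<forall>\<^sub>F s in nhds y. \<tau> x s t \<noteq> 0" "\<forall>\<^sub>F s in nhds t. \<tau> x y s \<noteq> 0"
  using assms by (auto intro!: eventually_nonzero tau_isCont)

text \<open>\<open>\<partial>\<^sub>x R = - b \<otimes> c\<close> has rank one, and \<open>\<partial>\<^sub>x log det (I + R)\<close> is the trace of \<open>(I + R)\<^sup>-\<^sup>1 \<partial>\<^sub>x R\<close>.\<close>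

lemma tau_deriv:
  assumes "\<tau> x y t \<noteq> 0"
  shows "((\<lambda>x. \<tau> x y t) has_vector_derivative \<tau> x y t * (- P x y t 0 0)) (at x)"
proof -
  have "((\<lambda>x. \<tau> x y t) has_vector_derivative \<tau> x y t * (\<Sum>k<3. cv_pow k x y t (resolvent x y t (Rx_vec k x y t)))) (at x)"
    using assms by (rule tau_curve(2)[OF continuous_trace_bound(1) R_derivative_finite_rank(1) continuous_R_vec(1) continuous_cv(1)])
  then show ?thesis by (simp add: sum_lessThan_3 Rx_vec_def cv_pow_def P_def blinfun.minus_right)
qed

definition "V e x y t = deval (P x y t) e"

lemma V_simps: "V (Plus e f) x y t = V e x y t + V f x y t" "V (Minus e f) x y t = V e x y t - V f x y t"
  "V (Times e f) x y t = V e x y t * V f x y t"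
  by (simp_all add: V_def)

lemma V_deriv:
  assumes "\<tau> x y t \<noteq> 0"
  shows "((\<lambda>x. V e x y t) has_vector_derivative V (Dx e) x y t) (at x)"
    and "((\<lambda>y. V e x y t) has_vector_derivative V (Dy e) x y t / \<beta>) (at y)"
    and "((\<lambda>t. V e x y t) has_vector_derivative (V (Dt e) x y t - lam * V (Dx e) x y t) / \<alpha>) (at t)"
proof -
  note nz = tau_nonzero_nhds[OF assms]
  have P_der: "((\<lambda>x. P x y t j k) has_vector_derivative deval (P x y t) (Dx (Pv j k))) (at x)"
    "((\<lambda>y. P x y t j k) has_vector_derivative deval (P x y t) (Dy (Pv j k)) / \<beta>) (at y)"
    "((\<lambda>t. P x y t j k) has_vector_derivative
      (deval (P x y t) (Dt (Pv j k)) - lam * deval (P x y t) (Dx (Pv j k))) / \<alpha>) (at t)" for j k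
    by (rule P_derivative; rule eventually_mono[OF nz(1)] eventually_mono[OF nz(2)] eventually_mono[OF nz(3)]; rule resolvent_inverse; assumption)+
  note D = has_vector_derivative_add has_vector_derivative_diff has_vector_derivative_mult
  have D_simps: "D (Plus e f) = Plus (D e) (D f)" "D (Minus e f) = Minus (D e) (D f)"
    "D (Times e f) = Plus (Times (D e) f) (Times e (D f))" if "D = Dx \<or> D = Dy \<or> D = Dt" for D e f
    using that by (auto simp: Dx_def Dy_def Dt_def)
  show "((\<lambda>x. V e x y t) has_vector_derivative V (Dx e) x y t) (at x)"
  proof (induction e)
    case (Pv j k) then show ?case using P_der(1) by (simp add: V_def)
  next
    case (Times e f) from has_vector_derivative_mult[OF this] show ?case by (simp add: V_simps D_simps algebra_simps)
  qed (use D in \<open>simp_all add: V_simps D_simps\<close>)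
  show "((\<lambda>y. V e x y t) has_vector_derivative V (Dy e) x y t / \<beta>) (at y)"
  proof (induction e)
    case (Pv j k) then show ?case using P_der(2) by (simp add: V_def)
  next
    case (Times e f) from has_vector_derivative_mult[OF this] show ?case
      by (simp add: V_simps D_simps add_divide_distrib algebra_simps)
  qed (use D in \<open>simp_all add: V_simps D_simps add_divide_distrib diff_divide_distrib\<close>)
  show "((\<lambda>t. V e x y t) has_vector_derivative (V (Dt e) x y t - lam * V (Dx e) x y t) / \<alpha>) (at t)"
  proof (induction e)
    case (Pv j k) then show ?case using P_der(3) by (simp add: V_def)
  next
    case (Plus e f) from has_vector_derivative_add[OF this] show ?case
      by (simp add: V_simps D_simps divide_inverse algebra_simps)
  next
    case (Minus e f) from has_vector_derivative_diff[OF this] show ?case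
      by (simp add: V_simps D_simps divide_inverse algebra_simps)
  next
    case (Times e f) from has_vector_derivative_mult[OF this] show ?case
      by (simp add: V_simps D_simps divide_inverse algebra_simps)
  qed
qed

section \<open>The equation\<close>

lemma has_vector_derivative_eventually_eq:
  fixes f g :: "real \<Rightarrow> complex"
  assumes "\<forall>\<^sub>F s in nhds x. f s = g s" "(g has_vector_derivative g') (at x)"
  shows "(f has_vector_derivative g') (at x)"
proof -
  have "\<forall>\<^sub>F s in nhds x. s \<in> UNIV \<longrightarrow> f s = g s" using assms(1) by simp
  from has_vector_derivative_cong_ev[OF this eventually_nhds_x_imp_x[OF assms(1)]] assms(2) show ?thesis by simp
qed

lemma V_scaled_deriv:
  assumes "\<tau> x y t \<noteq> 0"
  shows "((\<lambda>s. c * V e s y t) has_vector_derivative c * V (Dx e) x y t) (at x)"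
    and "((\<lambda>s. c * V e x s t) has_vector_derivative c / \<beta> * V (Dy e) x y t) (at y)"
    and "((\<lambda>s. c * V e x y s) has_vector_derivative c / \<alpha> * (V (Dt e) x y t - lam * V (Dx e) x y t)) (at t)"
  using V_deriv[OF assms, THEN has_vector_derivative_mult_right, of c] by simp_all

text \<open>A point with \<open>\<tau> \<noteq> 0\<close> has neighbourhoods without zeros on the lines parallel to the axes, so functions that
  agree where \<open>\<tau>\<close> does not vanish have the same derivatives there.\<close>

context
  fixes f :: "real \<Rightarrow> real \<Rightarrow> real \<Rightarrow> complex" and c e
  assumes eq: "\<And>x y t. \<tau> x y t \<noteq> 0 \<Longrightarrow> f x y t = c * V e x y t"
begin

lemma dx_agree:
  assumes nz: "\<tau> x y t \<noteq> 0"
  shows "(\<lambda>s. f s y t) differentiable (at x)" "dx f x y t = c * V (Dx e) x y t"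
proof -
  have "((\<lambda>s. f s y t) has_vector_derivative c * V (Dx e) x y t) (at x)"
    by (rule has_vector_derivative_eventually_eq[OF eventually_mono[OF tau_nonzero_nhds(1)[OF nz]] V_scaled_deriv(1)[OF nz]]) (rule eq)
  then show "(\<lambda>s. f s y t) differentiable (at x)" "dx f x y t = c * V (Dx e) x y t"
    unfolding dx_def by (auto intro: differentiableI_vector vector_derivative_at)
qed

lemma dy_agree:
  assumes nz: "\<tau> x y t \<noteq> 0"
  shows "(\<lambda>s. f x s t) differentiable (at y)" "dy f x y t = c / \<beta> * V (Dy e) x y t"
proof -
  have "((\<lambda>s. f x s t) has_vector_derivative c / \<beta> * V (Dy e) x y t) (at y)"
    by (rule has_vector_derivative_eventually_eq[OF eventually_mono[OF tau_nonzero_nhds(2)[OF nz]] V_scaled_deriv(2)[OF nz]]) (rule eq)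
  then show "(\<lambda>s. f x s t) differentiable (at y)" "dy f x y t = c / \<beta> * V (Dy e) x y t"
    unfolding dy_def by (auto intro: differentiableI_vector vector_derivative_at)
qed

lemma dt_agree:
  assumes nz: "\<tau> x y t \<noteq> 0"
  shows "(\<lambda>s. f x y s) differentiable (at t)" "dt f x y t = c / \<alpha> * (V (Dt e) x y t - lam * V (Dx e) x y t)"
proof -
  have "((\<lambda>s. f x y s) has_vector_derivative c / \<alpha> * (V (Dt e) x y t - lam * V (Dx e) x y t)) (at t)"
    by (rule has_vector_derivative_eventually_eq[OF eventually_mono[OF tau_nonzero_nhds(3)[OF nz]] V_scaled_deriv(3)[OF nz]]) (rule eq)
  then show "(\<lambda>s. f x y s) differentiable (at t)" "dt f x y t = c / \<alpha> * (V (Dt e) x y t - lam * V (Dx e) x y t)"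
    unfolding dt_def by (auto intro: differentiableI_vector vector_derivative_at)
qed

end

end

text \<open>\<open>f s / f x\<close> has positive real part near \<open>x\<close>, where \<open>Ln\<close> is holomorphic.\<close>

lemma local_log_derivative:
  assumes "\<forall>\<^sub>F s in nhds x. f s \<noteq> 0 \<and> (f has_vector_derivative f s * g s) (at s)"
  shows "\<forall>\<^sub>F s in nhds x. (local_log f x has_vector_derivative g s) (at s)"
proof -
  have x: "f x \<noteq> 0" "(f has_vector_derivative f x * g x) (at x)"
    using eventually_nhds_x_imp_x[OF assms] by auto
  have "(f \<longlongrightarrow> f x) (nhds x)"
    using has_vector_derivative_continuous[OF x(2)] by (simp add: continuous_within tendsto_at_iff_tendsto_nhds)
  then have "((\<lambda>s. Re (f s / f x)) \<longlongrightarrow> Re (f x / f x)) (nhds x)"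
    using x(1) by (intro tendsto_intros)
  then have "\<forall>\<^sub>F s in nhds x. 0 < Re (f s / f x)"
    by (rule order_tendstoD) (simp add: x(1))
  with assms show ?thesis
  proof eventually_elim
    case (elim s)
    have h: "((\<lambda>s. f s / f x) has_vector_derivative f s * g s / f x) (at s)"
      using elim by (intro has_vector_derivative_divide) auto
    have "f s / f x \<notin> \<real>\<^sub>\<le>\<^sub>0" using elim by (auto simp: complex_nonpos_Reals_iff)
    from field_vector_diff_chain_at[OF h has_field_derivative_Ln[OF this]]
    have "((\<lambda>s. Ln (f s / f x)) has_vector_derivative g s) (at s)"
      using elim x(1) by (simp add: o_def field_simps)
    from has_vector_derivative_add[OF has_vector_derivative_const[of "Ln (f x)"] this]
    show ?case by (simp add: local_log_def[abs_def])
  qed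
qed

context kp_determinant
begin

abbreviation "v \<equiv> Pv 0 0"

lemma tau_log_derivative:
  assumes "\<tau> x y t \<noteq> 0"
  shows "\<forall>\<^sub>F s in nhds x. (local_log (\<lambda>r. \<tau> r y t) x has_vector_derivative - V v s y t) (at s)"
  using tau_nonzero_nhds(1)[OF assms]
  by (intro local_log_derivative) (auto elim!: eventually_mono simp: V_def dest: tau_deriv)

lemma log_derivative_derivative:
  assumes "\<tau> x y t \<noteq> 0"
  shows "((\<lambda>s. vector_derivative (local_log (\<lambda>r. \<tau> r y t) x) (at s)) has_vector_derivative - V Vx x y t) (at x)"
proof (rule has_vector_derivative_eventually_eq)
  show "\<forall>\<^sub>F s in nhds x. vector_derivative (local_log (\<lambda>r. \<tau> r y t) x) (at s) = - V v s y t"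
    using tau_log_derivative[OF assms] by (rule eventually_mono) (rule vector_derivative_at)
  show "((\<lambda>s. - V v s y t) has_vector_derivative - V Vx x y t) (at x)"
    by (intro has_vector_derivative_minus V_deriv assms)
qed

lemma potential_eq: "\<tau> x y t \<noteq> 0 \<Longrightarrow> potential \<tau> x y t = 2 * V Vx x y t"
  using vector_derivative_at[OF log_derivative_derivative] by (simp add: potential_def)

theorem Kadomtsev_Petviashvili:
  defines "u \<equiv> potential \<tau>"
  defines "F \<equiv> (\<lambda>x y t. dx (dx (dx u)) x y t - 6 * u x y t * dx u x y t
                 + 4 * lam * dx u x y t + 4 * \<alpha> * dt u x y t)"
  assumes nz: "\<tau> x y t \<noteq> 0"
  shows "\<forall>\<^sub>F s in nhds x. local_log (\<lambda>r. \<tau> r y t) x differentiable (at s)"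
    and "(\<lambda>s. vector_derivative (local_log (\<lambda>r. \<tau> r y t) x) (at s)) differentiable (at x)"
    and "(\<lambda>s. u s y t) differentiable (at x)" "(\<lambda>s. dx u s y t) differentiable (at x)"
    and "(\<lambda>s. dx (dx u) s y t) differentiable (at x)" "(\<lambda>s. u x y s) differentiable (at t)"
    and "(\<lambda>s. F s y t) differentiable (at x)" "(\<lambda>s. u x s t) differentiable (at y)"
    and "(\<lambda>s. dy u x s t) differentiable (at y)"
    and "dx F x y t + 3 * \<beta>\<^sup>2 * dy (dy u) x y t = 0"
proof -
  show "\<forall>\<^sub>F s in nhds x. local_log (\<lambda>r. \<tau> r y t) x differentiable (at s)"
    using tau_log_derivative[OF nz] by (rule eventually_mono) (rule differentiableI_vector)
  show "(\<lambda>s. vector_derivative (local_log (\<lambda>r. \<tau> r y t) x) (at s)) differentiable (at x)"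
    using log_derivative_derivative[OF nz] by (rule differentiableI_vector)
  have u0: "u x y t = 2 * V Vx x y t" if "\<tau> x y t \<noteq> 0" for x y t
    unfolding u_def by (rule potential_eq[OF that])
  have u1: "(\<lambda>s. u s y t) differentiable (at x)" "dx u x y t = 2 * V Vxx x y t" if "\<tau> x y t \<noteq> 0" for x y t
    by (rule dx_agree[OF u0]; (assumption | rule that))+
  have u2: "(\<lambda>s. dx u s y t) differentiable (at x)" "dx (dx u) x y t = 2 * V (Dx Vxx) x y t" if "\<tau> x y t \<noteq> 0" for x y t
    by (rule dx_agree[OF u1(2)]; (assumption | rule that))+
  have u3: "(\<lambda>s. dx (dx u) s y t) differentiable (at x)" "dx (dx (dx u)) x y t = 2 * V (Dx (Dx Vxx)) x y t" if "\<tau> x y t \<noteq> 0" for x y t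
    by (rule dx_agree[OF u2(2)]; (assumption | rule that))+
  have uy: "(\<lambda>s. u x s t) differentiable (at y)" "dy u x y t = 2 / \<beta> * V (Dy Vx) x y t" if "\<tau> x y t \<noteq> 0" for x y t
    by (rule dy_agree[OF u0]; (assumption | rule that))+
  have uyy: "(\<lambda>s. dy u x s t) differentiable (at y)" "dy (dy u) x y t = 2 / \<beta> / \<beta> * V (Dy (Dy Vx)) x y t" if "\<tau> x y t \<noteq> 0" for x y t
    by (rule dy_agree[OF uy(2)]; (assumption | rule that))+
  have ut: "(\<lambda>s. u x y s) differentiable (at t)" "dt u x y t = 2 / \<alpha> * (V (Dt Vx) x y t - lam * V Vxx x y t)" if "\<tau> x y t \<noteq> 0" for x y t
    by (rule dt_agree[OF u0]; (assumption | rule that))+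
  \<comment> \<open>The integrated equation turns \<open>F\<close> into a multiple of \<open>\<partial>\<^sub>y\<^sup>2 v\<close>; one more derivative in \<open>x\<close> then gives
    \<open>- 3 \<beta>\<^sup>2 \<partial>\<^sub>y\<^sup>2 u\<close>.\<close>
  have F: "F x y t = - 6 * V (Dy (Dy v)) x y t" if "\<tau> x y t \<noteq> 0" for x y t
  proof -
    have "F x y t = 2 * (V (Dx (Dx Vxx)) x y t - 12 * V Vx x y t * V Vxx x y t + 4 * V (Dx (Dt v)) x y t)"
      using \<alpha> unfolding F_def u0[OF that] u1(2)[OF that] u3(2)[OF that] ut(2)[OF that]
      by (simp add: V_def derivations_commute(1) algebra_simps)
    moreover have "V (Dx (Dx Vxx)) x y t - 12 * V Vx x y t * V Vxx x y t + 4 * V (Dx (Dt v)) x y t = - (3 * V (Dy (Dy v)) x y t)"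
      using kp_identity[of "P x y t"] unfolding V_def eq_neg_iff_add_eq_0 .
    ultimately show ?thesis by simp
  qed
  have F1: "(\<lambda>s. F s y t) differentiable (at x)" "dx F x y t = - 6 * V (Dx (Dy (Dy v))) x y t" if "\<tau> x y t \<noteq> 0" for x y t
    by (rule dx_agree[OF F]; (assumption | rule that))+
  show "(\<lambda>s. u s y t) differentiable (at x)" "(\<lambda>s. dx u s y t) differentiable (at x)"
    "(\<lambda>s. dx (dx u) s y t) differentiable (at x)" "(\<lambda>s. u x y s) differentiable (at t)"
    "(\<lambda>s. F s y t) differentiable (at x)" "(\<lambda>s. u x s t) differentiable (at y)"
    "(\<lambda>s. dy u x s t) differentiable (at y)"
    by (fact u1(1)[OF nz] u2(1)[OF nz] u3(1)[OF nz] ut(1)[OF nz] F1(1)[OF nz] uy(1)[OF nz] uyy(1)[OF nz])+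
  show "dx F x y t + 3 * \<beta>\<^sup>2 * dy (dy u) x y t = 0"
    unfolding F1(2)[OF nz] uyy(2)[OF nz] using \<beta>
    by (simp add: V_def derivations_commute(2) power2_eq_square)
qed

end

theorem theorem1p2:
  fixes \<alpha> \<beta> lam :: complex
    and A1 A2 :: "'h::{complex_hilbert, second_countable_topology} \<Rightarrow>\<^sub>L 'h"
    and B0 :: "complex \<Rightarrow>\<^sub>L 'h" and C0 :: "'h \<Rightarrow>\<^sub>L complex"
    and \<tau> u F :: "real \<Rightarrow> real \<Rightarrow> real \<Rightarrow> complex"
  assumes "\<alpha> \<noteq> 0" and "\<beta> \<noteq> 0"
    and "linear_system A1 B0 C0" and "admissible_2_2 A1 B0 C0"
    and "linear_system A2 B0 C0" and "admissible_2_2 A2 B0 C0"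
  defines "\<tau> \<equiv> tau \<alpha> \<beta> lam A1 A2 B0 C0"
  defines "u \<equiv> potential \<tau>"
  defines "F \<equiv> (\<lambda>x y t. dx (dx (dx u)) x y t - 6 * u x y t * dx u x y t
                 + 4 * lam * dx u x y t + 4 * \<alpha> * dt u x y t)"
  shows "\<forall>x y t. \<tau> x y t \<noteq> 0 \<longrightarrow>
    (\<comment> \<open>the derivatives that define \<open>u\<close> exist\<close>
     (\<forall>\<^sub>F s in nhds x. local_log (\<lambda>r. \<tau> r y t) x differentiable (at s)) \<and>
     (\<lambda>s. vector_derivative (local_log (\<lambda>r. \<tau> r y t) x) (at s)) differentiable (at x)) \<and>
    (\<comment> \<open>the derivatives in the equation exist\<close>
     (\<lambda>s. u s y t) differentiable (at x) \<and>
     (\<lambda>s. dx u s y t) differentiable (at x) \<and>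
     (\<lambda>s. dx (dx u) s y t) differentiable (at x) \<and>
     (\<lambda>s. u x y s) differentiable (at t) \<and>
     (\<lambda>s. F s y t) differentiable (at x) \<and>
     (\<lambda>s. u x s t) differentiable (at y) \<and>
     (\<lambda>s. dy u x s t) differentiable (at y)) \<and>
    dx F x y t + 3 * \<beta>\<^sup>2 * dy (dy u) x y t = 0"
proof -
  define E :: "'h set" where "E = (SOME E. orthonormal_basis E)"
  have "orthonormal_basis E"
    unfolding E_def by (rule someI_ex[OF orthonormal_basis_exists])
  from exhausted_basis_exists[OF this] obtain G where "exhausted_basis E G" ..
  then interpret kp: kp_determinant \<alpha> \<beta> lam A1 A2 B0 C0 E G
    by (intro kp_determinant.intro kp_system.intro kp_determinant_axioms.intro assms E_def)
  have \<tau>: "\<tau> = kp.\<tau>"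
    unfolding \<tau>_def kp.\<tau>_def ..
  show ?thesis
    unfolding F_def u_def \<tau> by (intro allI impI conjI kp.Kadomtsev_Petviashvili)
qed

end
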